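(* Let $\mathrm{M}$ be a finite-dimensional manifold and let $X_a,X_b,X_c$ be smooth tangent vector fields on $\mathrm{M}$ satisfying $[X_a,X_b]=2X_a$, $[X_a,X_c]=-X_b$, $[X_b,X_c]=2X_c$. Let $u_a,u_b,u_c:[0,T]\to\mathbb{R}$ be measurable (and integrable) functions and let $x_0\in \mathrm{M}$. Then (locally) the solution $x:[0,T]\to \mathrm{M}$ of the differential equation $$\dot x(t)=u_c(t)X_c+u_b(t)X_b+u_a(t)X_a,\qquad x(0)=x_0,$$ is of the form $$x(t)=\exp(\Xi_c(t)X_c)\,\exp(\Xi_b(t)X_b)\,\exp(\Xi_a(t)X_a)(x_0).$$ Here $\Xi_a,\Xi_b,\Xi_c:[0,T]\to\mathbb{R}$ are given by $\Xi_d(t):=\Upsilon^t(S^d)$ for $d=a,b,c$, where $$S^a=a\,\exp_{\sqcup\!\sqcup}(2S_{\mathfrak{a}_1}),\qquad S^b=S_{\mathfrak{a}_1},\qquad S^c=\exp_{\sqcup\!\sqcup}(2S_{\mathfrak{a}_1})\,c,$$ and $S_{\mathfrak{a}_1}\in\mathbb{R}\langle\langle \mathrm{A}\rangle\rangle$ is the unique solution (with zero constant term) of the algebraic equation $$S_{\mathfrak{a}_1}=b-a\,\exp_{\sqcup\!\sqcup}(2S_{\mathfrak{a}_1})\,c .$$ In particular, $b-aS^c=S^b=b-S^a c$.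
   Context: Let $\mathrm{A}=\{a,b,c\}$ be a set of three letters, $\mathrm{A}^*$ the set of all words in these letters (free monoid under concatenation, with empty word $1$), and $\mathbb{R}\langle\langle \mathrm{A}\rangle\rangle$ the algebra of non-commutative formal power series on $\mathrm{A}$; juxtaposition of series denotes the concatenation product. The shuffle product $\sqcup\!\sqcup$ on $\mathbb{R}\langle\langle \mathrm{A}\rangle\rangle$ is the bilinear commutative product defined on words by $1\sqcup\!\sqcup w=w\sqcup\!\sqcup 1=w$ and $(w_1a_1)\sqcup\!\sqcup(w_2a_2)=(w_1\sqcup\!\sqcup(w_2a_2))a_1+((w_1a_1)\sqcup\!\sqcup w_2)a_2$ for letters $a_1,a_2$ and words $w_1,w_2$. For a series $P$ with zero constant term, $\exp_{\sqcup\!\sqcup}(P):=1+\sum_{k\ge1}P^{\sqcup\!\sqcup k}/k!$, where $P^{\sqcup\!\sqcup k}$ is the $k$-th shuffle power. For the given functions $u_a,u_b,u_c$, $\Upsilon^t:\mathbb{R}\langle\langle \mathrm{A}\rangle\rangle\to\mathbb{R}$ is the linear map given by $\Upsilon^t(1)=1$ and, for a word $w=a_1\cdots a_n$ with letters $a_i\in \mathrm{A}$, $$\Upsilon^t(w)=\int_0^t u_{a_n}(t_n)\int_0^{t_n}\cdots\int_0^{t_2}u_{a_1}(t_1)\,dt_1\cdots dt_{n-1}\,dt_n,$$ so that $\Upsilon^t(\sum_w c_w w)=\sum_w c_w\Upsilon^t(w)$. $[\cdot,\cdot]$ is the standard Lie bracket of tangent vector fields, and $\exp(tX):\mathrm{M}\to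 \mathrm{M}$ denotes the flow of the tangent vector field $X$ at time $t$; a product of flows is a composition of these maps.
   Formalization: The product of flows is read left to right: the flow of X_c acts on x_0 first, then X_b, then X_a. Applying X_a first fails, e.g. on the line with X_c=d/dy, X_b=-2y d/dy, X_a=-y^2 d/dy, u_a=0, u_b=u_c=1, x_0=0. *)

theory Defs
  imports "HOL-Analysis.Analysis"
begin

section \<open>Smooth manifolds, vector fields, Lie brackets and flows\<close>

text \<open>\<open>k\<close>-fold continuous differentiability; meant for open sets \<open>S\<close>.\<close>

fun Ck_on :: "nat \<Rightarrow> 'e set \<Rightarrow> ('e::euclidean_space \<Rightarrow> 'f::euclidean_space) \<Rightarrow> bool" where
  "Ck_on 0 S f \<longleftrightarrow> continuous_on S f"
| "Ck_on (Suc k) S f \<longleftrightarrow>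
     (\<forall>x\<in>S. f differentiable (at x)) \<and> (\<forall>v. Ck_on k S (\<lambda>x. frechet_derivative f (at x) v))"

definition smooth_on :: "'e set \<Rightarrow> ('e::euclidean_space \<Rightarrow> 'f::euclidean_space) \<Rightarrow> bool" where
  "smooth_on S f \<longleftrightarrow> (\<forall>k. Ck_on k S f)"

type_synonym ('a, 'e) chart = "'a set \<times> ('a \<Rightarrow> 'e)"

definition chart_inv :: "('a, 'e) chart \<Rightarrow> 'e \<Rightarrow> 'a" where
  "chart_inv c = inv_into (fst c) (snd c)"

text \<open>The topology of \<open>M\<close> is the subspace topology of the ambient type; the Hausdorff property and
  second countability come from the type classes. The dimension of \<open>M\<close> is that of the model
  space \<open>'e\<close>.\<close>

definition smooth_manifold ::
  "'a::{t2_space, second_countable_topology} set \<Rightarrow> ('a, 'e::euclidean_space) chart set \<Rightarrow> bool" where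
  "smooth_manifold M \<A> \<longleftrightarrow>
     (\<Union>(U, \<phi>)\<in>\<A>. U) = M \<and>
     (\<forall>(U, \<phi>)\<in>\<A>. openin (top_of_set M) U \<and> open (\<phi> ` U) \<and>
        homeomorphism U (\<phi> ` U) \<phi> (chart_inv (U, \<phi>))) \<and>
     (\<forall>(U, \<phi>)\<in>\<A>. \<forall>(V, \<psi>)\<in>\<A>. smooth_on (\<phi> ` (U \<inter> V)) (\<psi> \<circ> chart_inv (U, \<phi>)))"

text \<open>A tangent vector at \<open>p\<close> is a family of coordinate vectors, one for each chart around \<open>p\<close>, which
  transform into each other by the derivatives of the coordinate changes. A vector field \<open>X\<close> thus
  has the representative \<open>X c p\<close> at the point \<open>p\<close> in the chart \<open>c\<close>; values for \<open>p\<close> outside the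
  domain of \<open>c\<close> are irrelevant.\<close>

type_synonym ('a, 'e) tangent = "('a, 'e) chart \<Rightarrow> 'e"
type_synonym ('a, 'e) vector_field = "('a, 'e) chart \<Rightarrow> 'a \<Rightarrow> 'e"

definition smooth_vector_field ::
  "('a, 'e::euclidean_space) chart set \<Rightarrow> ('a, 'e) vector_field \<Rightarrow> bool" where
  "smooth_vector_field \<A> X \<longleftrightarrow>
     (\<forall>(U, \<phi>)\<in>\<A>. smooth_on (\<phi> ` U) (X (U, \<phi>) \<circ> chart_inv (U, \<phi>))) \<and>
     (\<forall>(U, \<phi>)\<in>\<A>. \<forall>(V, \<psi>)\<in>\<A>. \<forall>p\<in>U \<inter> V.
        X (V, \<psi>) p = frechet_derivative (\<psi> \<circ> chart_inv (U, \<phi>)) (at (\<phi> p)) (X (U, \<phi>) p))"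

definition vf_eq :: "('a, 'e) chart set \<Rightarrow> ('a, 'e) vector_field \<Rightarrow> ('a, 'e) vector_field \<Rightarrow> bool" where
  "vf_eq \<A> X Y \<longleftrightarrow> (\<forall>(U, \<phi>)\<in>\<A>. \<forall>p\<in>U. X (U, \<phi>) p = Y (U, \<phi>) p)"

definition vf_add ::
  "('a, 'e::real_vector) vector_field \<Rightarrow> ('a, 'e) vector_field \<Rightarrow> ('a, 'e) vector_field" where
  "vf_add X Y = (\<lambda>c p. X c p + Y c p)"

definition vf_scale :: "real \<Rightarrow> ('a, 'e::real_vector) vector_field \<Rightarrow> ('a, 'e) vector_field" where
  "vf_scale r X = (\<lambda>c p. r *\<^sub>R X c p)"

text \<open>Sign convention: as operators on functions \<open>[X, Y] f = X (Y f) - Y (X f)\<close>, that is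
  \<open>[X, Y] = DY X - DX Y\<close> in coordinates.\<close>

definition lie_bracket ::
  "('a, 'e::euclidean_space) vector_field \<Rightarrow> ('a, 'e) vector_field \<Rightarrow> ('a, 'e) vector_field" where
  "lie_bracket X Y = (\<lambda>c p.
     frechet_derivative (Y c \<circ> chart_inv c) (at (snd c p)) (X c p) -
     frechet_derivative (X c \<circ> chart_inv c) (at (snd c p)) (Y c p))"

text \<open>Only meaningful for curves \<open>x\<close> that are continuous on \<open>I\<close>.\<close>

definition has_velocity ::
  "('a, 'e::euclidean_space) chart set \<Rightarrow> real set \<Rightarrow> (real \<Rightarrow> 'a) \<Rightarrow> real \<Rightarrow> ('a, 'e) tangent \<Rightarrow> bool" where
  "has_velocity \<A> I x t v \<longleftrightarrow>
     (\<forall>(U, \<phi>)\<in>\<A>. x t \<in> U \<longrightarrow> ((\<phi> \<circ> x) has_vector_derivative v (U, \<phi>)) (at t within I))"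

definition integral_curve ::
  "'a::topological_space set \<Rightarrow> ('a, 'e::euclidean_space) chart set \<Rightarrow> ('a, 'e) vector_field \<Rightarrow>
   real set \<Rightarrow> (real \<Rightarrow> 'a) \<Rightarrow> bool" where
  "integral_curve M \<A> X J \<gamma> \<longleftrightarrow>
     open J \<and> is_interval J \<and> continuous_on J \<gamma> \<and> \<gamma> ` J \<subseteq> M \<and>
     (\<forall>s\<in>J. has_velocity \<A> J \<gamma> s (\<lambda>c. X c (\<gamma> s)))"

definition flows_to ::
  "'a::topological_space set \<Rightarrow> ('a, 'e::euclidean_space) chart set \<Rightarrow> ('a, 'e) vector_field \<Rightarrow>
   real \<Rightarrow> 'a \<Rightarrow> 'a \<Rightarrow> bool" where
  "flows_to M \<A> X t p q \<longleftrightarrow>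
     (\<exists>J \<gamma>. integral_curve M \<A> X J \<gamma> \<and> 0 \<in> J \<and> t \<in> J \<and> \<gamma> 0 = p \<and> \<gamma> t = q)"

text \<open>The map \<open>exp(tX)\<close>. It is partial, as vector fields need not be complete.\<close>

definition flow ::
  "'a::topological_space set \<Rightarrow> ('a, 'e::euclidean_space) chart set \<Rightarrow> ('a, 'e) vector_field \<Rightarrow>
   real \<Rightarrow> 'a \<rightharpoonup> 'a" where
  "flow M \<A> X t p =
     (if \<exists>q. flows_to M \<A> X t p q then Some (THE q. flows_to M \<A> X t p q) else None)"

section \<open>Differential equations with integrable time dependence\<close>

definition absolutely_continuous_on :: "real set \<Rightarrow> (real \<Rightarrow> 'e::euclidean_space) \<Rightarrow> bool" where
  "absolutely_continuous_on S f \<longleftrightarrow>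
     (\<forall>\<epsilon>>0. \<exists>\<delta>>0. \<forall>D. D division_of \<Union>D \<and> \<Union>D \<subseteq> S \<and> (\<Sum>K\<in>D. Sup K - Inf K) < \<delta> \<longrightarrow>
        (\<Sum>K\<in>D. norm (f (Sup K) - f (Inf K))) < \<epsilon>)"

text \<open>Solutions on \<open>{0..\<tau>}\<close> of \<open>x' = F t x\<close>, \<open>x 0 = x0\<close> in the sense of Caratheodory.\<close>

definition ode_solution ::
  "'a::topological_space set \<Rightarrow> ('a, 'e::euclidean_space) chart set \<Rightarrow>
   (real \<Rightarrow> ('a, 'e) vector_field) \<Rightarrow> 'a \<Rightarrow> real \<Rightarrow> (real \<Rightarrow> 'a) \<Rightarrow> bool" where
  "ode_solution M \<A> F x0 \<tau> x \<longleftrightarrow>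
     x 0 = x0 \<and> continuous_on {0..\<tau>} x \<and> x ` {0..\<tau>} \<subseteq> M \<and>
     (\<forall>(U, \<phi>)\<in>\<A>. \<forall>r s. {r..s} \<subseteq> {0..\<tau>} \<and> x ` {r..s} \<subseteq> U \<longrightarrow>
        absolutely_continuous_on {r..s} (\<phi> \<circ> x)) \<and>
     (AE t in lebesgue. t \<in> {0..\<tau>} \<longrightarrow> has_velocity \<A> {0..\<tau>} x t (\<lambda>c. F t c (x t)))"

section \<open>Non-commutative series and the shuffle product\<close>

text \<open>The letters \<open>a\<close>, \<open>b\<close>, \<open>c\<close>.\<close>

datatype letter = La | Lb | Lc

text \<open>A series is its coefficient function.\<close>

type_synonym series = "letter list \<Rightarrow> real"

definition one_series :: series where
  "one_series w = (if w = [] then 1 else 0)"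

definition letter_series :: "letter \<Rightarrow> series" where
  "letter_series d w = (if w = [d] then 1 else 0)"

definition conc :: "series \<Rightarrow> series \<Rightarrow> series" (infixr "\<cdot>" 75) where
  "(P \<cdot> Q) w = (\<Sum>i\<le>length w. P (take i w) * Q (drop i w))"

text \<open>The shuffle product of two words as the multiset of its terms.\<close>

function shuffle_word :: "'l list \<Rightarrow> 'l list \<Rightarrow> 'l list multiset" where
  "shuffle_word u v =
     (if u = [] then {#v#}
      else if v = [] then {#u#}
      else image_mset (\<lambda>w. w @ [last u]) (shuffle_word (butlast u) v) +
           image_mset (\<lambda>w. w @ [last v]) (shuffle_word u (butlast v)))"
  by pat_completeness auto
termination by (relation "Wellfounded.measure (\<lambda>(u, v). length u + length v)") auto

declare shuffle_word.simps [simp del]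

lemma length_shuffle_word: "w \<in># shuffle_word u v \<Longrightarrow> length w = length u + length v"
proof (induction u v arbitrary: w rule: shuffle_word.induct)
  case (1 u v)
  show ?case
  proof (cases "u = [] \<or> v = []")
    case True
    then show ?thesis using "1.prems" by (subst (asm) shuffle_word.simps) (auto split: if_splits)
  next
    case False
    then have "length u > 0" "length v > 0" by auto
    with False show ?thesis using "1.prems" "1.IH"
      by (subst (asm) shuffle_word.simps) fastforce
  qed
qed

text \<open>The sum below is finite.\<close>

lemma finite_shuffle_word_preimage:
  "finite {(u, v :: letter list). w \<in># shuffle_word u v}"
proof (rule finite_subset)
  have "finite (UNIV :: letter set)"
    by (rule finite_subset[of _ "{La, Lb, Lc}"]) (auto intro: letter.exhaust)
  then have "finite {u :: letter list. length u \<le> length w}"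
    using finite_lists_length_le[of "UNIV :: letter set"] by simp
  then show "finite ({u :: letter list. length u \<le> length w} \<times> {v :: letter list. length v \<le> length w})"
    by simp
qed (auto dest: length_shuffle_word)

definition shuffle :: "series \<Rightarrow> series \<Rightarrow> series" where
  "shuffle P Q w =
     (\<Sum>(u, v) | w \<in># shuffle_word u v. P u * Q v * real (count (shuffle_word u v) w))"

fun shuffle_power :: "series \<Rightarrow> nat \<Rightarrow> series" where
  "shuffle_power P 0 = one_series"
| "shuffle_power P (Suc k) = shuffle P (shuffle_power P k)"

text \<open>For series \<open>P\<close> with zero constant term, where each coefficient is a finite sum.\<close>

definition shuffle_exp :: "series \<Rightarrow> series" where
  "shuffle_exp P w = (\<Sum>k. shuffle_power P k w / fact k)"

definition exp2 :: "series \<Rightarrow> series" where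
  "exp2 S = shuffle_exp (\<lambda>w. 2 * S w)"

definition solves_series_eq :: "series \<Rightarrow> bool" where
  "solves_series_eq S \<longleftrightarrow> S [] = 0 \<and>
     S = letter_series Lb - letter_series La \<cdot> exp2 S \<cdot> letter_series Lc"

definition S_a1 :: series where
  "S_a1 = (THE S. solves_series_eq S)"

fun S_of :: "letter \<Rightarrow> series" where
  "S_of La = letter_series La \<cdot> exp2 S_a1"
| "S_of Lb = S_a1"
| "S_of Lc = exp2 S_a1 \<cdot> letter_series Lc"

section \<open>Iterated integrals\<close>

text \<open>The integrals of a word given in reverse: the last letter of a word belongs to the outermost
  integral.\<close>

fun iter_int_rev :: "(letter \<Rightarrow> real \<Rightarrow> real) \<Rightarrow> letter list \<Rightarrow> real \<Rightarrow> real" where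
  "iter_int_rev u [] t = 1"
| "iter_int_rev u (d # w) t = (LINT s:{0..t}|lebesgue. u d s * iter_int_rev u w s)"

definition iter_int :: "(letter \<Rightarrow> real \<Rightarrow> real) \<Rightarrow> real \<Rightarrow> letter list \<Rightarrow> real" where
  "iter_int u t w = iter_int_rev u (rev w) t"

text \<open>The functional \<open>\<Upsilon>\<^sup>t\<close> is only defined on the series for which the sum over all words converges
  (unconditionally, hence absolutely).\<close>

definition Upsilon_defined :: "(letter \<Rightarrow> real \<Rightarrow> real) \<Rightarrow> real \<Rightarrow> series \<Rightarrow> bool" where
  "Upsilon_defined u t P \<longleftrightarrow> (\<lambda>w. P w * iter_int u t w) summable_on UNIV"

definition Upsilon :: "(letter \<Rightarrow> real \<Rightarrow> real) \<Rightarrow> real \<Rightarrow> series \<Rightarrow> real" where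
  "Upsilon u t P = (\<Sum>\<^sub>\<infinity>w. P w * iter_int u t w)"

definition Xi :: "(letter \<Rightarrow> real \<Rightarrow> real) \<Rightarrow> letter \<Rightarrow> real \<Rightarrow> real" where
  "Xi u d t = Upsilon u t (S_of d)"

section \<open>The control system and the product of flows\<close>

definition control_field ::
  "(letter \<Rightarrow> ('a, 'e::real_vector) vector_field) \<Rightarrow> (letter \<Rightarrow> real \<Rightarrow> real) \<Rightarrow> real \<Rightarrow>
   ('a, 'e) vector_field" where
  "control_field X u t =
     vf_add (vf_scale (u Lc t) (X Lc)) (vf_add (vf_scale (u Lb t) (X Lb)) (vf_scale (u La t) (X La)))"

text \<open>The product \<open>exp(\<Xi>\<^sub>c X\<^sub>c) exp(\<Xi>\<^sub>b X\<^sub>b) exp(\<Xi>\<^sub>a X\<^sub>a)\<close> is read from left to right, as is usual when flows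
  are identified with operators on functions (\<open>exp(X) f = f \<circ> exp(X)\<close>): the flow of \<open>X\<^sub>c\<close> is
  applied to the point first. With the sign convention of \<open>lie_bracket\<close> and the order of
  integration of \<open>iter_int\<close>, the other order of composition does not solve the equation: for
  \<open>X\<^sub>c = d/dy\<close>, \<open>X\<^sub>b = -2y d/dy\<close>, \<open>X\<^sub>a = -y^2 d/dy\<close> on the line, \<open>u\<^sub>a = 0\<close>, \<open>u\<^sub>b = u\<^sub>c = 1\<close> and \<open>x0 = 0\<close>,
  one has \<open>\<Xi>\<^sub>a = 0\<close>, \<open>\<Xi>\<^sub>b = t\<close>, \<open>\<Xi>\<^sub>c = (exp(2t) - 1) / 2\<close> and \<open>x(t) = (1 - exp(-2t)) / 2\<close>.\<close>

definition flow_product ::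
  "'a::topological_space set \<Rightarrow> ('a, 'e::euclidean_space) chart set \<Rightarrow>
   (letter \<Rightarrow> ('a, 'e) vector_field) \<Rightarrow> (letter \<Rightarrow> real \<Rightarrow> real) \<Rightarrow> real \<Rightarrow> 'a \<rightharpoonup> 'a" where
  "flow_product M \<A> X \<Xi> t =
     flow M \<A> (X La) (\<Xi> La t) \<circ>\<^sub>m flow M \<A> (X Lb) (\<Xi> Lb t) \<circ>\<^sub>m flow M \<A> (X Lc) (\<Xi> Lc t)"

end

theory Submission
  imports Defs
begin

text \<open>Removing the last letter of words (the right quotient) is a derivation of the shuffle product.
  Applied to the algebraic equation this yields, with \<open>E = exp(2 S\<^sup>b)\<close> and \<open>*\<close> for the shuffle product,
  \<open>S\<^sup>a = a + 2 S\<^sup>a b - (S\<^sup>a * S\<^sup>a) c\<close>, \<open>S\<^sup>b = b - S\<^sup>a c\<close>, \<open>E = 1 + 2 E b - 2 (S\<^sup>a * E) c\<close> and \<open>S\<^sup>c = E c\<close>.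
  The functional \<open>\<Upsilon>\<close> turns an appended letter into an integration and the shuffle product into the
  product of numbers, so the \<open>\<Xi>\<close> solve
  \<open>\<Xi>\<^sub>a' = u\<^sub>a + 2 u\<^sub>b \<Xi>\<^sub>a - u\<^sub>c \<Xi>\<^sub>a\<^sup>2\<close>, \<open>\<Xi>\<^sub>b' = u\<^sub>b - u\<^sub>c \<Xi>\<^sub>a\<close>, \<open>\<Xi>\<^sub>c' = u\<^sub>c exp(2 \<Xi>\<^sub>b)\<close>. The same recursions with
  absolute values bound the partial sums, by induction on the word length, as long as the integral
  of \<open>\<bar>u\<^sub>a\<bar> + \<bar>u\<^sub>b\<bar> + \<bar>u\<^sub>c\<bar>\<close> is at most \<open>1/8\<close>.

  On the geometric side, the bracket relations determine how the flows transport the fields: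
  \<open>exp(\<alpha>X\<^sub>a)\<close> maps \<open>X\<^sub>b\<close> to \<open>X\<^sub>b - 2\<alpha>X\<^sub>a\<close> and \<open>X\<^sub>c\<close> to \<open>X\<^sub>c + \<alpha>X\<^sub>b - \<alpha>\<^sup>2X\<^sub>a\<close>, and \<open>exp(\<beta>X\<^sub>b)\<close> maps \<open>X\<^sub>c\<close> to
  \<open>exp(-2\<beta>)X\<^sub>c\<close>. By the chain rule the product of flows has the required velocity exactly when the
  exponents solve the system above. Solutions are unique since two of them agree on a set of times
  that is closed and, by a Gronwall estimate in a chart, open.\<close>

section \<open>Right and left quotients of shuffle products\<close>

text \<open>The last letter of a word belongs to the outermost integral, so differentiating in
  \<open>t\<close> removes exactly this letter; hence quotients on the right.

  Two obstacles shape the analytic part. The controls are merely integrable, so the equations in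
  \<open>t\<close> hold almost everywhere only; identities between functions of \<open>t\<close> are
  obtained by comparing absolutely continuous functions with the same derivative and the same
  initial value. And \<open>flow\<close> is given by a description, so identifying it with a curve
  found in a chart requires uniqueness of integral curves on the whole manifold. A single field is a
  control field with constant controls, hence one uniqueness theorem serves both the flows and the
  solutions.

  The bounds have to survive the quadratic term of the recursion. They are proved for iterated
  integrals of the absolute values of the controls: these are nonnegative, so truncating the product
  of two sums can only decrease it.\<close>

definition rquot :: "'l \<Rightarrow> ('l list \<Rightarrow> real) \<Rightarrow> 'l list \<Rightarrow> real" where
  "rquot x P w = P (w @ [x])"

definition lquot :: "'l \<Rightarrow> ('l list \<Rightarrow> real) \<Rightarrow> 'l list \<Rightarrow> real" where
  "lquot x P w = P (x # w)"

lemma UNIV_letter: "(UNIV :: letter set) = {La, Lb, Lc}"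
  by (auto intro: letter.exhaust)

lemma finite_UNIV_letter [simp]: "finite (UNIV :: letter set)"
  by (simp add: UNIV_letter)

lemma sum_letter: "(\<Sum>d\<in>UNIV. f d) = f La + f Lb + f Lc" for f :: "letter \<Rightarrow> 'b::comm_monoid_add"
  by (simp add: UNIV_letter add.assoc)

definition words :: "nat \<Rightarrow> letter list set" where
  "words n = {w. length w \<le> n}"

lemma finite_words [simp]: "finite (words n)"
  using finite_lists_length_le[of "UNIV :: letter set" n] by (simp add: words_def)

lemma in_words [simp]: "w \<in> words n \<longleftrightarrow> length w \<le> n"
  by (simp add: words_def)

lemma words_0 [simp]: "words 0 = {[]}"
  by (auto simp: words_def)

lemma words_Suc: "words (Suc n) = insert [] ((\<lambda>(w, x). w @ [x]) ` (words n \<times> UNIV))"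
proof -
  have "w \<in> (\<lambda>(w, x). w @ [x]) ` (words n \<times> UNIV)" if "length w \<le> Suc n" "w \<noteq> []" for w
    using that by (cases w rule: rev_cases) auto
  then show ?thesis by (auto simp: words_def)
qed

text \<open>Splits by the last letter, the one that the recursion of \<open>shuffle_word\<close> and
  the outermost integral both peel off.\<close>

lemma sum_words_Suc:
  fixes f :: "letter list \<Rightarrow> 'b::comm_monoid_add"
  shows "(\<Sum>w\<in>words (Suc n). f w) = f [] + (\<Sum>x\<in>UNIV. \<Sum>w\<in>words n. f (w @ [x]))"
proof -
  have inj: "inj_on (\<lambda>(w, x). w @ [x]) (words n \<times> UNIV)"
    by (auto simp: inj_on_def)
  have "(\<Sum>w\<in>words (Suc n). f w) = f [] + (\<Sum>w\<in>(\<lambda>(w, x). w @ [x]) ` (words n \<times> UNIV). f w)"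
    unfolding words_Suc by (subst sum.insert) auto
  also have "\<dots> = f [] + (\<Sum>(w, x)\<in>words n \<times> UNIV. f (w @ [x]))"
    by (subst sum.reindex[OF inj]) (simp add: case_prod_unfold comp_def)
  also have "(\<Sum>(w, x)\<in>words n \<times> UNIV. f (w @ [x])) = (\<Sum>x\<in>UNIV. \<Sum>w\<in>words n. f (w @ [x]))"
    unfolding sum.cartesian_product[symmetric] by (rule sum.swap)
  finally show ?thesis .
qed

lemma count_image_append:
  "count (image_mset (\<lambda>w. w @ [y]) A) (w @ [x]) = (if y = x then count A w else 0)"
  by (induction A) auto

lemma shuffle_word_Nil [simp]: "shuffle_word [] v = {#v#}" "shuffle_word u [] = {#u#}"
  by (simp_all add: shuffle_word.simps)

lemma count_shuffle_word_append:
  "count (shuffle_word u v) (w @ [x]) =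
     (if u \<noteq> [] \<and> last u = x then count (shuffle_word (butlast u) v) w else 0) +
     (if v \<noteq> [] \<and> last v = x then count (shuffle_word u (butlast v)) w else 0)"
proof (cases "u = [] \<or> v = []")
  case True
  then show ?thesis
    by (cases u rule: rev_cases; cases v rule: rev_cases) auto
next
  case False
  then show ?thesis
    by (subst shuffle_word.simps) (simp add: count_image_append)
qed

text \<open>A term of a shuffle has the total length of its factors, so any box of words at least as
  long as \<open>w\<close> contains all contributing pairs. The two bounds are independent since the
  step from \<open>w\<close> to \<open>w @ [x]\<close> shortens only one factor at a time.\<close>

lemma shuffle_eq_sum:
  assumes "length w \<le> n" "length w \<le> m"
  shows "shuffle P Q w = (\<Sum>u\<in>words n. \<Sum>v\<in>words m. P u * Q v * real (count (shuffle_word u v) w))"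
proof -
  have "shuffle P Q w =
      (\<Sum>(u, v)\<in>words n \<times> words m. P u * Q v * real (count (shuffle_word u v) w))"
    unfolding shuffle_def
  proof (rule sum.mono_neutral_left)
    show "{(u, v). w \<in># shuffle_word u v} \<subseteq> words n \<times> words m"
      using assms by (auto dest: length_shuffle_word)
  qed (auto simp: not_in_iff)
  then show ?thesis by (simp add: sum.cartesian_product)
qed

lemma shuffle_Nil [simp]: "shuffle P Q [] = P [] * Q []"
  by (subst shuffle_eq_sum[of _ 0 0]) auto

lemma sum_words_last:
  assumes "\<And>u. u \<noteq> [] \<Longrightarrow> last u = x \<Longrightarrow> f u = g (butlast u)"
    and "\<And>u. \<not> (u \<noteq> [] \<and> last u = x) \<Longrightarrow> f u = 0"
  shows "(\<Sum>u\<in>words (Suc n). f u) = (\<Sum>u\<in>words n. g u :: real)"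
proof -
  have "(\<Sum>u\<in>words n. f (u @ [y])) = (if y = x then \<Sum>u\<in>words n. g u else 0)" for y
    using assms by (auto intro!: sum.cong sum.neutral)
  moreover have "f [] = 0" using assms(2) by simp
  ultimately show ?thesis by (simp add: sum_words_Suc)
qed

text \<open>Counted with multiplicity, the last letter of a term of a shuffle comes from exactly one
  of the two factors.\<close>

lemma shuffle_append:
  "shuffle P Q (w @ [x]) = shuffle (rquot x P) Q w + shuffle P (rquot x Q) w"
proof -
  let ?n = "length w"
  have 1: "(\<Sum>u\<in>words (Suc ?n). \<Sum>v\<in>words (Suc ?n). P u * Q v *
      real (if u \<noteq> [] \<and> last u = x then count (shuffle_word (butlast u) v) w else 0)) =
      (\<Sum>u\<in>words ?n. \<Sum>v\<in>words (Suc ?n). rquot x P u * Q v * real (count (shuffle_word u v) w))"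
  proof (rule sum_words_last[of x])
    fix u :: "letter list"
    assume "u \<noteq> []" "last u = x"
    then have "u = butlast u @ [x]" by auto
    then have "rquot x P (butlast u) = P u" by (simp add: rquot_def)
    then show "(\<Sum>v\<in>words (Suc ?n). P u * Q v *
        real (if u \<noteq> [] \<and> last u = x then count (shuffle_word (butlast u) v) w else 0)) =
      (\<Sum>v\<in>words (Suc ?n). rquot x P (butlast u) * Q v * real (count (shuffle_word (butlast u) v) w))"
      using \<open>u \<noteq> []\<close> \<open>last u = x\<close> by simp
  qed auto
  have 2: "(\<Sum>v\<in>words (Suc ?n). P u * Q v *
      real (if v \<noteq> [] \<and> last v = x then count (shuffle_word u (butlast v)) w else 0)) =
      (\<Sum>v\<in>words ?n. P u * rquot x Q v * real (count (shuffle_word u v) w))" for u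
  proof (rule sum_words_last[of x])
    fix v :: "letter list"
    assume "v \<noteq> []" "last v = x"
    then have "v = butlast v @ [x]" by auto
    then have "rquot x Q (butlast v) = Q v" by (simp add: rquot_def)
    then show "P u * Q v * real (if v \<noteq> [] \<and> last v = x then count (shuffle_word u (butlast v)) w else 0) =
      P u * rquot x Q (butlast v) * real (count (shuffle_word u (butlast v)) w)"
      using \<open>v \<noteq> []\<close> \<open>last v = x\<close> by simp
  qed auto
  have "shuffle P Q (w @ [x]) = (\<Sum>u\<in>words (Suc ?n). \<Sum>v\<in>words (Suc ?n).
      P u * Q v * real (count (shuffle_word u v) (w @ [x])))"
    by (rule shuffle_eq_sum) auto
  also have "\<dots> = (\<Sum>u\<in>words ?n. \<Sum>v\<in>words (Suc ?n). rquot x P u * Q v * real (count (shuffle_word u v) w)) +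
      (\<Sum>u\<in>words (Suc ?n). \<Sum>v\<in>words ?n. P u * rquot x Q v * real (count (shuffle_word u v) w))"
    unfolding count_shuffle_word_append of_nat_add distrib_left sum.distrib 1 2 by simp
  also have "\<dots> = shuffle (rquot x P) Q w + shuffle P (rquot x Q) w"
    by (simp add: shuffle_eq_sum[of w ?n "Suc ?n" "rquot x P" Q]
        shuffle_eq_sum[of w "Suc ?n" ?n P "rquot x Q"] del: sum.cong)
  finally show ?thesis .
qed

lemma rquot_shuffle: "rquot x (shuffle P Q) = (\<lambda>w. shuffle (rquot x P) Q w + shuffle P (rquot x Q) w)"
  using shuffle_append by (simp add: fun_eq_iff rquot_def[of x "shuffle P Q"])

lemma shuffle_add_left: "shuffle (\<lambda>w. P w + Q w) S w = shuffle P S w + shuffle Q S w"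
  by (simp add: shuffle_eq_sum[OF order_refl order_refl] distrib_right sum.distrib)

lemma shuffle_scale_left: "shuffle (\<lambda>w. r * P w) Q w = r * shuffle P Q w"
  by (simp add: shuffle_eq_sum[OF order_refl order_refl] sum_distrib_left mult.assoc)

text \<open>A series is determined by its constant term and its right quotients, and those of a
  product obey the derivation rule. The laws of the shuffle algebra therefore follow by induction on
  the word from the right, for all series at once.\<close>

lemma shuffle_commute: "shuffle P Q = shuffle Q P"
proof
  show "shuffle P Q w = shuffle Q P w" for w
    by (induction w arbitrary: P Q rule: rev_induct) (simp_all add: shuffle_append)
qed

lemma shuffle_add_right: "shuffle S (\<lambda>w. P w + Q w) w = shuffle S P w + shuffle S Q w"
  using shuffle_add_left by (simp only: shuffle_commute[of S])

lemma shuffle_scale_right: "shuffle P (\<lambda>w. r * Q w) w = r * shuffle P Q w"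
  using shuffle_scale_left by (simp only: shuffle_commute[of P])

lemma shuffle_assoc: "shuffle (shuffle P Q) S = shuffle P (shuffle Q S)"
proof
  show "shuffle (shuffle P Q) S w = shuffle P (shuffle Q S) w" for w
    by (induction w arbitrary: P Q S rule: rev_induct)
      (simp_all add: shuffle_append rquot_shuffle shuffle_add_left shuffle_add_right)
qed

lemma shuffle_left_commute: "shuffle P (shuffle Q S) = shuffle Q (shuffle P S)"
  by (metis shuffle_assoc shuffle_commute)

lemma shuffle_zero_left [simp]: "shuffle (\<lambda>w. 0) Q w = 0"
  using shuffle_scale_left[of 0 "\<lambda>w. 0" Q w] by simp

lemma shuffle_zero_right [simp]: "shuffle P (\<lambda>w. 0) w = 0"
  by (subst shuffle_commute) simp

lemma rquot_one [simp]: "rquot x one_series = (\<lambda>w. 0)"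
  by (auto simp: rquot_def one_series_def fun_eq_iff)

lemma shuffle_one_left [simp]: "shuffle one_series P = P"
proof
  show "shuffle one_series P w = P w" for w
    by (induction w arbitrary: P rule: rev_induct) (simp_all add: shuffle_append rquot_def, simp_all add: one_series_def)
qed

lemma shuffle_one_right [simp]: "shuffle P one_series = P"
  by (subst shuffle_commute) simp

lemma lquot_rquot: "lquot y (rquot x P) = rquot x (lquot y P)"
  by (simp add: fun_eq_iff rquot_def lquot_def)

text \<open>Left and right quotients commute, so the rule for the first letter is inherited from the
  rule for the last one.\<close>

lemma shuffle_Cons:
  "shuffle P Q (y # w) = shuffle (lquot y P) Q w + shuffle P (lquot y Q) w"
proof (induction w arbitrary: P Q rule: rev_induct)
  case Nil
  show ?case using shuffle_append[of P Q "[]" y] by (simp add: rquot_def lquot_def)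
next
  case (snoc x w)
  show ?case
    using shuffle_append[of P Q "y # w" x]
    by (simp add: snoc.IH shuffle_append lquot_rquot)
qed

text \<open>Locality in the word length: below, it lets truncated series replace full ones and makes
  the algebraic equation a contraction.\<close>

lemma shuffle_cong:
  assumes "\<And>v. length v \<le> length w \<Longrightarrow> P v = P' v" "\<And>v. length v \<le> length w \<Longrightarrow> Q v = Q' v"
  shows "shuffle P Q w = shuffle P' Q' w"
  using assms by (simp add: shuffle_eq_sum[OF order_refl order_refl])

lemma abs_shuffle_le: "\<bar>shuffle P Q w\<bar> \<le> shuffle (\<lambda>w. \<bar>P w\<bar>) (\<lambda>w. \<bar>Q w\<bar>) w"
proof -
  have "\<bar>shuffle P Q w\<bar> \<le> (\<Sum>u\<in>words (length w). \<bar>\<Sum>v\<in>words (length w). P u * Q v * real (count (shuffle_word u v) w)\<bar>)"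
    by (simp add: shuffle_eq_sum[OF order_refl order_refl])
  also have "\<dots> \<le> (\<Sum>u\<in>words (length w). \<Sum>v\<in>words (length w). \<bar>P u * Q v * real (count (shuffle_word u v) w)\<bar>)"
    by (intro sum_mono) auto
  finally show ?thesis by (simp add: shuffle_eq_sum[OF order_refl order_refl] abs_mult)
qed

section \<open>The shuffle exponential\<close>

text \<open>The power rule of a derivation. For \<open>n = 0\<close> the factor
  \<open>real n\<close> vanishes, so the truncated \<open>n - 1\<close> does no harm.\<close>

lemma rquot_shuffle_power:
  "rquot x (shuffle_power P n) = (\<lambda>w. real n * shuffle (rquot x P) (shuffle_power P (n - 1)) w)"
proof (induction n)
  case (Suc n)
  have "rquot x (shuffle_power P (Suc n)) w = real (Suc n) * shuffle (rquot x P) (shuffle_power P n) w" for w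
  proof (cases n)
    case (Suc m)
    have "shuffle P (rquot x (shuffle_power P n)) w = real n * shuffle (rquot x P) (shuffle_power P n) w"
      unfolding Suc.IH shuffle_scale_right shuffle_left_commute[of P "rquot x P"] by (simp add: Suc)
    then show ?thesis
      by (simp add: rquot_shuffle algebra_simps)
  qed (use Suc.IH in \<open>simp add: rquot_shuffle\<close>)
  then show ?case by auto
qed simp

text \<open>Without constant term, every factor uses up at least one letter. In the proof, the power
  rule trades the last letter of \<open>w\<close> for one power, so that length and exponent
  decrease together.\<close>

lemma shuffle_power_eq_0:
  assumes "P [] = 0" "length w < k"
  shows "shuffle_power P k w = 0"
  using assms(2)
proof (induction w arbitrary: k rule: length_induct)
  case (1 w)
  have "shuffle Q (shuffle_power P n) v = 0"
    if "length v < length w" "length v < n" for Q n v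
  proof -
    have "shuffle Q (shuffle_power P n) v = shuffle Q (\<lambda>w. 0) v"
      by (rule shuffle_cong) (use that 1 in auto)
    then show ?thesis by simp
  qed
  note * = this
  show ?case
  proof (cases k)
    case 0 then show ?thesis using 1 by simp
  next
    case (Suc n)
    show ?thesis
    proof (cases w rule: rev_cases)
      case Nil
      then show ?thesis using assms Suc by simp
    next
      case (snoc v x)
      have "shuffle_power P k w = rquot x (shuffle_power P k) v"
        using snoc by (simp add: rquot_def)
      also have "\<dots> = 0"
        unfolding rquot_shuffle_power using * [of v "k - 1" "rquot x P"] snoc Suc 1 by simp
      finally show ?thesis .
    qed
  qed
qed

lemma shuffle_exp_eq_sum:
  assumes "P [] = 0" "length w \<le> n"
  shows "shuffle_exp P w = (\<Sum>k\<le>n. shuffle_power P k w / fact k)"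
  unfolding shuffle_exp_def
  by (rule suminf_finite) (use assms in \<open>auto simp: shuffle_power_eq_0\<close>)

lemma shuffle_sum_right:
  "finite I \<Longrightarrow> shuffle P (\<lambda>w. \<Sum>i\<in>I. Q i w) w = (\<Sum>i\<in>I. shuffle P (Q i) w)"
  by (induction I rule: finite_induct)
    (simp_all add: shuffle_add_right)

lemma shuffle_exp_Nil:
  assumes "P [] = 0"
  shows "shuffle_exp P [] = 1"
  using shuffle_exp_eq_sum[where P = P and w = "[]" and n = 0] assms by (simp add: one_series_def)

text \<open>The chain rule for the exponential: the power rule, summed up, with \<open>Suc k\<close>
  cancelling against the factorial.\<close>

lemma rquot_shuffle_exp:
  assumes "P [] = 0"
  shows "rquot x (shuffle_exp P) = shuffle (rquot x P) (shuffle_exp P)"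
proof
  fix w :: "letter list"
  let ?n = "length w"
  have "rquot x (shuffle_exp P) w = (\<Sum>k\<le>Suc ?n. rquot x (shuffle_power P k) w / fact k)"
    using shuffle_exp_eq_sum[where P = P and w = "w @ [x]" and n = "Suc ?n"] assms by (simp add: rquot_def)
  \<comment> \<open>The term for \<open>k = 0\<close> drops out because the right quotients of
    \<open>one_series\<close> vanish.\<close>
  also have "\<dots> = (\<Sum>k\<le>?n. rquot x (shuffle_power P (Suc k)) w / fact (Suc k))"
    by (simp add: sum.atMost_Suc_shift del: sum.atMost_Suc)
  also have "\<dots> = (\<Sum>k\<le>?n. shuffle (rquot x P) (\<lambda>w. inverse (fact k) * shuffle_power P k w) w)"
    unfolding rquot_shuffle_power shuffle_scale_right by (simp add: field_simps del: of_nat_Suc shuffle_power.simps)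
  also have "\<dots> = shuffle (rquot x P) (\<lambda>w. \<Sum>k\<le>?n. inverse (fact k) * shuffle_power P k w) w"
    by (simp add: shuffle_sum_right)
  \<comment> \<open>At words no longer than \<open>w\<close> the partial sum up to
    \<open>length w\<close> is already the full exponential, and the product at \<open>w\<close>
    sees no other words.\<close>
  also have "\<dots> = shuffle (rquot x P) (shuffle_exp P) w"
    by (rule shuffle_cong) (simp_all add: shuffle_exp_eq_sum[where P = P and n = ?n] assms field_simps)
  finally show "rquot x (shuffle_exp P) w = shuffle (rquot x P) (shuffle_exp P) w" .
qed

lemma shuffle_power_cong:
  assumes "\<And>v. length v \<le> length w \<Longrightarrow> P v = Q v"
  shows "shuffle_power P k w = shuffle_power Q k w"
  using assms
proof (induction k arbitrary: w)
  case (Suc k)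
  then show ?case by (auto intro!: shuffle_cong)
qed simp

lemma exp2_cong:
  assumes "\<And>v. length v \<le> length w \<Longrightarrow> P v = Q v"
  shows "exp2 P w = exp2 Q w"
proof -
  have "shuffle_power (\<lambda>w. 2 * P w) k w = shuffle_power (\<lambda>w. 2 * Q w) k w" for k
    using assms by (intro shuffle_power_cong) simp
  then show ?thesis by (simp add: exp2_def shuffle_exp_def)
qed

section \<open>The algebraic equation\<close>

lemma conc_Nil [simp]: "(P \<cdot> Q) [] = P [] * Q []"
  by (simp add: conc_def)

lemma letter_series_Nil [simp]: "letter_series d [] = 0"
  by (simp add: letter_series_def)

text \<open>Only the cut after the last letter separates \<open>x\<close> from the right factor,
  which is empty there; if \<open>Q\<close> has zero constant term, the quotient acts on
  \<open>Q\<close> alone.\<close>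

lemma conc_append:
  "(P \<cdot> Q) (w @ [x]) = (P \<cdot> rquot x Q) w + P (w @ [x]) * Q []"
proof -
  have "(P \<cdot> Q) (w @ [x]) = (\<Sum>i\<le>length w. P (take i w) * Q (drop i w @ [x])) + P (w @ [x]) * Q []"
    by (simp add: conc_def)
  then show ?thesis by (simp add: conc_def rquot_def)
qed

lemma conc_Cons:
  "(P \<cdot> Q) (x # w) = (lquot x P \<cdot> Q) w + P [] * Q (x # w)"
  by (simp add: conc_def lquot_def sum.atMost_Suc_shift del: sum.atMost_Suc)

lemma conc_zero [simp]: "((\<lambda>w. 0) \<cdot> Q) w = 0" "(Q \<cdot> (\<lambda>w. 0)) w = 0"
  by (simp_all add: conc_def)

lemma conc_one [simp]: "(one_series \<cdot> Q) = Q" "(Q \<cdot> one_series) = Q"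
proof -
  have l: "lquot x one_series = (\<lambda>w. 0)" for x by (auto simp: lquot_def one_series_def)
  show "(one_series \<cdot> Q) = Q"
  proof
    show "(one_series \<cdot> Q) w = Q w" for w
      by (cases w) (simp_all add: conc_Cons l, simp_all add: one_series_def)
  qed
  show "(Q \<cdot> one_series) = Q"
  proof
    show "(Q \<cdot> one_series) w = Q w" for w
      by (cases w rule: rev_cases) (simp_all add: conc_append, simp_all add: one_series_def)
  qed
qed

lemma rquot_letter: "rquot x (letter_series d) = (\<lambda>w. if x = d then one_series w else 0)"
  by (auto simp: rquot_def letter_series_def one_series_def)

lemma lquot_letter: "lquot x (letter_series d) = (\<lambda>w. if x = d then one_series w else 0)"
  by (auto simp: lquot_def letter_series_def one_series_def)

lemma rquot_conc_letter:
  "rquot x (P \<cdot> letter_series d) = (if x = d then P else (\<lambda>w. 0))"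
  by (auto simp: rquot_def conc_append rquot_letter)

lemma lquot_letter_conc:
  "lquot x (letter_series d \<cdot> P) = (if x = d then P else (\<lambda>w. 0))"
  by (auto simp: lquot_def conc_Cons lquot_letter)

text \<open>\<open>conc\<close> is written right associated; the regrouped form exhibits
  \<open>S_of La\<close> in the algebraic equation and has immediate right quotients.\<close>

lemma letter_conc_assoc:
  "letter_series d \<cdot> P \<cdot> letter_series e = (letter_series d \<cdot> P) \<cdot> letter_series e"
proof
  show "(letter_series d \<cdot> P \<cdot> letter_series e) w = ((letter_series d \<cdot> P) \<cdot> letter_series e) w" for w
  proof (cases w)
    case (Cons x v)
    have "lquot x (letter_series d \<cdot> (P \<cdot> letter_series e)) v = (if x = d then (P \<cdot> letter_series e) v else 0)"
      by (simp add: lquot_letter_conc)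
    moreover have "(lquot x (letter_series d \<cdot> P) \<cdot> letter_series e) v = (if x = d then (P \<cdot> letter_series e) v else 0)"
      by (simp add: lquot_letter_conc)
    ultimately show ?thesis
      using Cons by (simp add: conc_Cons[of "letter_series d \<cdot> P"] lquot_def[of x "letter_series d \<cdot> _"])
  qed simp
qed

lemma rquot_letter_conc:
  assumes "P [] = c"
  shows "rquot x (letter_series d \<cdot> P) =
    (\<lambda>w. (letter_series d \<cdot> rquot x P) w + (if x = d then c * one_series w else 0))"
  using assms by (auto simp: rquot_def conc_append fun_eq_iff letter_series_def one_series_def)

text \<open>A contraction for the ultrametric given by the length of the shortest word where two
  series differ. The iterates of \<open>\<Phi>\<close> become stationary in each coefficient, and
  every fixpoint has these coefficients.\<close>

lemma contraction_unique_fixpoint: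
  fixes \<Phi> :: "('l list \<Rightarrow> 'b::zero) \<Rightarrow> 'l list \<Rightarrow> 'b"
  assumes contr: "\<And>P Q n. (\<And>w. length w < n \<Longrightarrow> P w = Q w) \<Longrightarrow>
      (\<And>w. length w < Suc n \<Longrightarrow> \<Phi> P w = \<Phi> Q w)"
  shows "\<exists>!S. S = \<Phi> S"
proof
  \<comment> \<open>After \<open>n\<close> iterations the coefficients of words shorter than
    \<open>n\<close> are final, so a word of length \<open>n\<close> takes \<open>n + 1\<close> of
    them.\<close>
  define S where "S w = (\<Phi> ^^ Suc (length w)) (\<lambda>_. 0) w" for w
  have *: "(\<Phi> ^^ (n + m)) (\<lambda>_. 0) w = (\<Phi> ^^ n) (\<lambda>_. 0) w" if "length w < n" for n m w
    using that
  proof (induction n arbitrary: w)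
    case (Suc n)
    show ?case using contr[of n "(\<Phi> ^^ (n + m)) (\<lambda>_. 0)" "(\<Phi> ^^ n) (\<lambda>_. 0)" w] Suc by simp
  qed simp
  have S: "S w = (\<Phi> ^^ n) (\<lambda>_. 0) w" if "length w < n" for w n
    using *[of w "Suc (length w)" "n - Suc (length w)"] that by (simp add: S_def)
  show "S = \<Phi> S"
  proof
    fix w
    have "\<Phi> S w = \<Phi> ((\<Phi> ^^ length w) (\<lambda>_. 0)) w"
      by (rule contr[of "length w"]) (auto simp: S)
    then show "S w = \<Phi> S w" by (simp add: S_def)
  qed
  fix P assume P: "P = \<Phi> P"
  have "\<forall>w. length w < n \<longrightarrow> P w = S w" for n
  proof (induction n)
    case (Suc n)
    then show ?case using contr[of n P S] P \<open>S = \<Phi> S\<close> by metis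
  qed simp
  then show "P = S" by blast
qed

lemma ex1_solves_series_eq: "\<exists>!S. solves_series_eq S"
proof -
  define \<Phi> where "\<Phi> S = letter_series Lb - letter_series La \<cdot> exp2 S \<cdot> letter_series Lc" for S
  \<comment> \<open>Multiplication by a letter shifts the dependence to strictly shorter words. The
    contraction comes from here, as \<open>exp2\<close> depends on words up to the same
    length.\<close>
  have conc: "(letter_series La \<cdot> P) w = (letter_series La \<cdot> Q) w"
    if "\<And>v. length v < length w \<Longrightarrow> P v = Q v" for P Q w
    using that lquot_letter_conc[of _ La P] lquot_letter_conc[of _ La Q]
    by (cases w) (auto simp: lquot_def fun_eq_iff)
  have conc': "(P \<cdot> letter_series Lc) w = (Q \<cdot> letter_series Lc) w"
    if "\<And>v. length v < length w \<Longrightarrow> P v = Q v" for P Q w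
    using that rquot_conc_letter[of _ P Lc] rquot_conc_letter[of _ Q Lc]
    by (cases w rule: rev_cases) (auto simp: rquot_def fun_eq_iff split: if_splits)
  have "\<exists>!S. S = \<Phi> S"
  proof (rule contraction_unique_fixpoint)
    fix P Q :: series and n and w :: "letter list"
    assume *: "\<And>w. length w < n \<Longrightarrow> P w = Q w" and "length w < Suc n"
    then show "\<Phi> P w = \<Phi> Q w"
      unfolding \<Phi>_def minus_apply
      by (intro arg_cong2[where f = minus] refl conc conc' exp2_cong) simp
  qed
  \<comment> \<open>Fixpoints of \<open>\<Phi>\<close> have zero constant term, since every word on
    the right-hand side contains a letter.\<close>
  moreover have "solves_series_eq S \<longleftrightarrow> S = \<Phi> S" for S
  proof -
    have "\<Phi> S [] = 0" by (simp add: \<Phi>_def)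
    then show ?thesis unfolding solves_series_eq_def \<Phi>_def by metis
  qed
  ultimately show ?thesis by simp
qed

lemma S_a1_eq:
  "S_a1 [] = 0" "S_a1 = letter_series Lb - letter_series La \<cdot> exp2 S_a1 \<cdot> letter_series Lc"
proof -
  have "solves_series_eq S_a1"
    unfolding S_a1_def by (rule theI'[OF ex1_solves_series_eq])
  then show "S_a1 [] = 0" "S_a1 = letter_series Lb - letter_series La \<cdot> exp2 S_a1 \<cdot> letter_series Lc"
    by (auto simp: solves_series_eq_def)
qed

lemma S_a1_eq': "S_a1 = letter_series Lb - S_of La \<cdot> letter_series Lc"
  using S_a1_eq(2) unfolding letter_conc_assoc S_of.simps .

lemma rquot_S_b:
  "rquot La S_a1 = (\<lambda>w. 0)" "rquot Lb S_a1 = one_series" "rquot Lc S_a1 = (\<lambda>w. - S_of La w)"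
proof -
  have "rquot x S_a1 = (\<lambda>w. rquot x (letter_series Lb) w - rquot x (S_of La \<cdot> letter_series Lc) w)" for x
    by (subst S_a1_eq') (simp add: rquot_def fun_eq_iff del: S_of.simps)
  note * = this
  show "rquot La S_a1 = (\<lambda>w. 0)" "rquot Lb S_a1 = one_series" "rquot Lc S_a1 = (\<lambda>w. - S_of La w)"
    unfolding * by (simp_all add: rquot_letter rquot_conc_letter del: S_of.simps)
qed

lemma exp2_S_Nil: "exp2 S_a1 [] = 1"
  by (simp add: exp2_def shuffle_exp_Nil S_a1_eq(1))

lemma shuffle_uminus_left: "shuffle (\<lambda>w. - P w) Q w = - shuffle P Q w"
  using shuffle_scale_left[of "-1" P Q w] by simp

lemma rquot_exp2_S:
  "rquot La (exp2 S_a1) = (\<lambda>w. 0)"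
  "rquot Lb (exp2 S_a1) = (\<lambda>w. 2 * exp2 S_a1 w)"
  "rquot Lc (exp2 S_a1) = (\<lambda>w. - 2 * shuffle (S_of La) (exp2 S_a1) w)"
proof -
  have "rquot x (exp2 S_a1) = (\<lambda>w. 2 * shuffle (rquot x S_a1) (exp2 S_a1) w)" for x
  proof -
    have eq: "rquot x (\<lambda>w. 2 * S_a1 w) = (\<lambda>w. 2 * rquot x S_a1 w)"
      by (simp add: rquot_def fun_eq_iff)
    show ?thesis
      unfolding exp2_def
      by (subst rquot_shuffle_exp) (simp_all add: S_a1_eq(1) eq fun_eq_iff shuffle_scale_left)
  qed
  note * = this
  show "rquot La (exp2 S_a1) = (\<lambda>w. 0)"
    "rquot Lb (exp2 S_a1) = (\<lambda>w. 2 * exp2 S_a1 w)"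
    "rquot Lc (exp2 S_a1) = (\<lambda>w. - 2 * shuffle (S_of La) (exp2 S_a1) w)"
    unfolding * by (simp_all add: rquot_S_b shuffle_uminus_left del: S_of.simps)
qed

lemma S_of_La_Nil [simp]: "S_of La [] = 0"
  by simp

lemma conc_letter_scale: "(letter_series d \<cdot> (\<lambda>w. r * P w)) w = r * (letter_series d \<cdot> P) w"
  by (simp add: conc_def sum_distrib_left mult.left_commute)

text \<open>Without this identity the right quotient of \<open>S_of La\<close> by \<open>c\<close>, which comes out as
  \<open>- 2 a shuffle (S_of La) (exp2 S_a1)\<close>, would not be expressible by \<open>S_of La\<close> itself.\<close>

lemma shuffle_letter_conc_self:
  "shuffle (letter_series d \<cdot> P) (letter_series d \<cdot> P) w =
     2 * (letter_series d \<cdot> shuffle (letter_series d \<cdot> P) P) w"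
proof (cases w)
  case (Cons x v)
  have "(letter_series d \<cdot> shuffle (letter_series d \<cdot> P) P) (x # v) =
      (if x = d then shuffle (letter_series d \<cdot> P) P v else 0)"
    using lquot_letter_conc[of x d "shuffle (letter_series d \<cdot> P) P"]
    by (simp add: lquot_def fun_eq_iff split: if_splits)
  then show ?thesis
    using Cons by (simp add: shuffle_Cons lquot_letter_conc shuffle_commute[of P "letter_series d \<cdot> P"])
qed simp

lemma rquot_S_La:
  "rquot La (S_of La) = one_series"
  "rquot Lb (S_of La) = (\<lambda>w. 2 * S_of La w)"
  "rquot Lc (S_of La) = (\<lambda>w. - shuffle (S_of La) (S_of La) w)"
proof -
  \<comment> \<open>The constant term 1 of the exponential contributes the one-letter word
    \<open>a\<close> to the series, and thus the summand \<open>one_series\<close> to its quotient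
    by \<open>a\<close>.\<close>
  note * = rquot_letter_conc[where P = "exp2 S_a1", OF exp2_S_Nil, of _ La]
  show "rquot La (S_of La) = one_series"
    by (simp add: * rquot_exp2_S)
  show "rquot Lb (S_of La) = (\<lambda>w. 2 * S_of La w)"
    by (simp add: * rquot_exp2_S conc_letter_scale)
  show "rquot Lc (S_of La) = (\<lambda>w. - shuffle (S_of La) (S_of La) w)"
    unfolding S_of.simps * rquot_exp2_S
    using conc_letter_scale[of La "-2"] by (simp add: shuffle_letter_conc_self)
qed

section \<open>Absolutely continuous functions\<close>

lemma division_of_Sup_Inf:
  fixes K :: "real set"
  assumes "D division_of A" "K \<in> D"
  shows "K = {Inf K..Sup K}" "Inf K \<le> Sup K" "Inf K \<in> A" "Sup K \<in> A"
proof -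
  obtain u v where K: "K = {u..v}" "K \<noteq> {}" "K \<subseteq> A"
    using division_ofD[OF assms(1)] assms(2) by (metis box_real(2))
  then have "u \<le> v" by auto
  with K show "K = {Inf K..Sup K}" "Inf K \<le> Sup K" "Inf K \<in> A" "Sup K \<in> A"
    by auto
qed

abbreviation total_length :: "real set set \<Rightarrow> real" where
  "total_length D \<equiv> (\<Sum>K\<in>D. Sup K - Inf K)"

abbreviation variation :: "(real \<Rightarrow> 'e::real_normed_vector) \<Rightarrow> real set set \<Rightarrow> real" where
  "variation f D \<equiv> (\<Sum>K\<in>D. norm (f (Sup K) - f (Inf K)))"

lemma absolutely_continuous_onE:
  assumes "absolutely_continuous_on S f" "\<epsilon> > 0"
  obtains \<delta> where "\<delta> > 0"
    "\<And>D. D division_of \<Union>D \<Longrightarrow> \<Union>D \<subseteq> S \<Longrightarrow> total_length D < \<delta> \<Longrightarrow>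
      variation f D < \<epsilon>"
proof -
  from assms(1)[unfolded absolutely_continuous_on_def, rule_format, OF assms(2)]
  obtain \<delta> where \<delta>: "\<delta> > 0 \<and> (\<forall>D. D division_of \<Union>D \<and> \<Union>D \<subseteq> S \<and> total_length D < \<delta> \<longrightarrow>
      variation f D < \<epsilon>)" ..
  show thesis
    by (rule that[OF conjunct1[OF \<delta>]]) (rule conjunct2[OF \<delta>, rule_format], intro conjI)
qed

lemma absolutely_continuous_on_subset:
  assumes "absolutely_continuous_on S f" "T \<subseteq> S"
  shows "absolutely_continuous_on T f"
  unfolding absolutely_continuous_on_def
proof (intro allI impI)
  fix \<epsilon> :: real assume "\<epsilon> > 0"
  then obtain \<delta> where "\<delta> > 0" and
    D: "\<And>D. D division_of \<Union>D \<Longrightarrow> \<Union>D \<subseteq> S \<Longrightarrow> total_length D < \<delta> \<Longrightarrow>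
      variation f D < \<epsilon>"
    using absolutely_continuous_onE[OF assms(1)] by blast
  show "\<exists>\<delta>>0. \<forall>D. D division_of \<Union>D \<and> \<Union>D \<subseteq> T \<and> total_length D < \<delta> \<longrightarrow>
        variation f D < \<epsilon>"
    by (rule exI[of _ \<delta>], rule conjI[OF \<open>\<delta> > 0\<close>], intro allI impI, elim conjE, rule D)
      (use assms(2) in \<open>blast+\<close>)
qed

text \<open>Most closure properties rest on this: an absolutely continuous function, possibly with
  values in a product, followed by a map that is Lipschitz on its range. Only increments are
  compared, so \<open>f\<close> and \<open>g\<close> may live in different spaces.\<close>

lemma absolutely_continuous_on_dominated:
  fixes f :: "real \<Rightarrow> 'e::euclidean_space" and g :: "real \<Rightarrow> 'f::euclidean_space"
  assumes g: "absolutely_continuous_on S g"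
    and le: "\<And>s t. s \<in> S \<Longrightarrow> t \<in> S \<Longrightarrow> norm (f t - f s) \<le> L * norm (g t - g s)"
  shows "absolutely_continuous_on S f"
  unfolding absolutely_continuous_on_def
proof (intro allI impI)
  fix \<epsilon> :: real assume "\<epsilon> > 0"
  \<comment> \<open>\<open>\<bar>L\<bar> + 1\<close> is positive and bounds \<open>L\<close>,
    whatever the sign of \<open>L\<close>.\<close>
  then have e: "\<epsilon> / (\<bar>L\<bar> + 1) > 0" by simp
  obtain \<delta> where \<delta>: "\<delta> > 0" and
    D: "\<And>D. D division_of \<Union>D \<Longrightarrow> \<Union>D \<subseteq> S \<Longrightarrow> total_length D < \<delta> \<Longrightarrow>
      variation g D < \<epsilon> / (\<bar>L\<bar> + 1)"
    using absolutely_continuous_onE[OF g e] by blast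
  show "\<exists>\<delta>>0. \<forall>D. D division_of \<Union>D \<and> \<Union>D \<subseteq> S \<and> total_length D < \<delta> \<longrightarrow>
        variation f D < \<epsilon>"
  proof (intro exI[of _ \<delta>] conjI \<delta> allI impI, elim conjE)
    fix D :: "real set set"
    assume *: "D division_of \<Union>D" "\<Union>D \<subseteq> S" "total_length D < \<delta>"
    have "variation f D \<le> (\<Sum>K\<in>D. (\<bar>L\<bar> + 1) * norm (g (Sup K) - g (Inf K)))"
    proof (rule sum_mono)
      fix K assume "K \<in> D"
      then have "Inf K \<in> S" "Sup K \<in> S" using division_of_Sup_Inf[OF *(1)] *(2) by auto
      then have "norm (f (Sup K) - f (Inf K)) \<le> L * norm (g (Sup K) - g (Inf K))" by (rule le)
      also have "\<dots> \<le> (\<bar>L\<bar> + 1) * norm (g (Sup K) - g (Inf K))"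
        by (rule mult_right_mono) auto
      finally show "norm (f (Sup K) - f (Inf K)) \<le> (\<bar>L\<bar> + 1) * norm (g (Sup K) - g (Inf K))" .
    qed
    also have "\<dots> = (\<bar>L\<bar> + 1) * variation g D"
      by (simp add: sum_distrib_left)
    also have "\<dots> < \<epsilon>"
      using D[OF *] by (simp add: field_simps)
    finally show "variation f D < \<epsilon>" .
  qed
qed

lemma absolutely_continuous_on_ident: "absolutely_continuous_on S (\<lambda>t. t)"
  unfolding absolutely_continuous_on_def
proof (intro allI impI)
  fix \<epsilon> :: real assume "\<epsilon> > 0"
  have eq: "(\<Sum>K\<in>D. norm (Sup K - Inf K)) = total_length D"
    if "D division_of \<Union>D" for D :: "real set set"
  proof (intro sum.cong refl)
    fix K assume "K \<in> D"
    from division_of_Sup_Inf(2)[OF that this] show "norm (Sup K - Inf K) = Sup K - Inf K" by simp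
  qed
  show "\<exists>\<delta>>0. \<forall>D. D division_of \<Union>D \<and> \<Union>D \<subseteq> S \<and> total_length D < \<delta> \<longrightarrow>
        (\<Sum>K\<in>D. norm (Sup K - Inf K)) < \<epsilon>"
  proof (rule exI[of _ \<epsilon>], rule conjI[OF \<open>\<epsilon> > 0\<close>], intro allI impI)
    fix D :: "real set set"
    assume "D division_of \<Union>D \<and> \<Union>D \<subseteq> S \<and> total_length D < \<epsilon>"
    then have "D division_of \<Union>D" "total_length D < \<epsilon>" by blast+
    then show "(\<Sum>K\<in>D. norm (Sup K - Inf K)) < \<epsilon>" by (simp only: eq)
  qed
qed

lemma absolutely_continuous_on_Pair:
  assumes f: "absolutely_continuous_on S f" and g: "absolutely_continuous_on S g"
  shows "absolutely_continuous_on S (\<lambda>t. (f t, g t))"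
  unfolding absolutely_continuous_on_def
proof (intro allI impI)
  fix \<epsilon> :: real assume "\<epsilon> > 0"
  then have "\<epsilon> / 2 > 0" by simp
  then have e: "\<epsilon> / 2 > 0" .
  obtain \<delta>1 where \<delta>1: "\<delta>1 > 0"
      "\<And>D. D division_of \<Union>D \<Longrightarrow> \<Union>D \<subseteq> S \<Longrightarrow> total_length D < \<delta>1 \<Longrightarrow>
      variation f D < \<epsilon> / 2"
    using absolutely_continuous_onE[OF f e] by blast
  obtain \<delta>2 where \<delta>2: "\<delta>2 > 0"
      "\<And>D. D division_of \<Union>D \<Longrightarrow> \<Union>D \<subseteq> S \<Longrightarrow> total_length D < \<delta>2 \<Longrightarrow>
      variation g D < \<epsilon> / 2"
    using absolutely_continuous_onE[OF g e] by blast
  show "\<exists>\<delta>>0. \<forall>D. D division_of \<Union>D \<and> \<Union>D \<subseteq> S \<and> total_length D < \<delta> \<longrightarrow>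
        variation (\<lambda>t. (f t, g t)) D < \<epsilon>"
  proof (intro exI[of _ "min \<delta>1 \<delta>2"] conjI allI impI, goal_cases)
    case 1 then show ?case using \<delta>1 \<delta>2 by simp
  next
    case (2 D)
    have "variation (\<lambda>t. (f t, g t)) D \<le>
      (\<Sum>K\<in>D. norm (f (Sup K) - f (Inf K)) + norm (g (Sup K) - g (Inf K)))"
      by (intro sum_mono) (auto intro: norm_Pair_le)
    moreover have "variation f D < \<epsilon> / 2"
      by (rule \<delta>1(2)) (use 2 in auto)
    moreover have "variation g D < \<epsilon> / 2"
      by (rule \<delta>2(2)) (use 2 in auto)
    ultimately show ?case unfolding sum.distrib by linarith
  qed
qed

lemma absolutely_continuous_on_lipschitz:
  fixes f :: "real \<Rightarrow> 'e::euclidean_space"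
  assumes "\<And>s t. s \<in> S \<Longrightarrow> t \<in> S \<Longrightarrow> norm (f t - f s) \<le> L * \<bar>t - s\<bar>"
  shows "absolutely_continuous_on S f"
  using absolutely_continuous_on_dominated[OF absolutely_continuous_on_ident, of S f L] assms
  by (simp only: real_norm_def)

lemma absolutely_continuous_on_imp_continuous_on:
  assumes f: "absolutely_continuous_on {a..b} f"
  shows "continuous_on {a..b} f"
  unfolding continuous_on_iff
proof (intro ballI allI impI)
  fix x \<epsilon> :: real assume x: "x \<in> {a..b}" and e: "\<epsilon> > 0"
  obtain \<delta> where \<delta>: "\<delta> > 0" and
    D: "\<And>D. D division_of \<Union>D \<Longrightarrow> \<Union>D \<subseteq> {a..b} \<Longrightarrow> total_length D < \<delta> \<Longrightarrow>
      variation f D < \<epsilon>"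
    using absolutely_continuous_onE[OF f e] by blast
  have *: "norm (f v - f u) < \<epsilon>" if "u \<in> {a..b}" "v \<in> {a..b}" "u \<le> v" "v - u < \<delta>" for u v
    using D[of "{{u..v}}"] that division_of_self[of u v] by auto
  have "dist (f y) (f x) < \<epsilon>" if "y \<in> {a..b}" "dist y x < \<delta>" for y
    using *[of x y] *[of y x] x that by (cases "x \<le> y") (auto simp: dist_norm norm_minus_commute)
  then show "\<exists>d>0. \<forall>x'\<in>{a..b}. dist x' x < d \<longrightarrow> dist (f x') (f x) < \<epsilon>"
    using \<delta> by blast
qed

lemma absolutely_continuous_on_mult:
  fixes f g :: "real \<Rightarrow> real"
  assumes f: "absolutely_continuous_on {a..b} f" and g: "absolutely_continuous_on {a..b} g"
  shows "absolutely_continuous_on {a..b} (\<lambda>t. f t * g t)"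
proof -
  have "bounded (f ` {a..b})" "bounded (g ` {a..b})"
    using assms by (auto intro!: compact_imp_bounded compact_continuous_image
        absolutely_continuous_on_imp_continuous_on)
  then obtain B C where "\<forall>t\<in>{a..b}. \<bar>f t\<bar> \<le> B" "\<forall>t\<in>{a..b}. \<bar>g t\<bar> \<le> C"
    unfolding bounded_iff by auto
  then have B: "\<And>t. t \<in> {a..b} \<Longrightarrow> \<bar>f t\<bar> \<le> B" and C: "\<And>t. t \<in> {a..b} \<Longrightarrow> \<bar>g t\<bar> \<le> C"
    by blast+
  show ?thesis
  proof (rule absolutely_continuous_on_dominated[OF absolutely_continuous_on_Pair[OF f g]])
    fix s t assume st: "s \<in> {a..b}" "t \<in> {a..b}"
    have "f t * g t - f s * g s = f t * (g t - g s) + g s * (f t - f s)"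
      by (simp add: algebra_simps)
    then have "norm (f t * g t - f s * g s) \<le> \<bar>f t\<bar> * \<bar>g t - g s\<bar> + \<bar>g s\<bar> * \<bar>f t - f s\<bar>"
      using abs_triangle_ineq[of "f t * (g t - g s)" "g s * (f t - f s)"] by (simp add: abs_mult)
    also have "\<dots> \<le> B * norm ((f t, g t) - (f s, g s)) + C * norm ((f t, g t) - (f s, g s))"
      using norm_snd_le[of "g t - g s" "f t - f s"] norm_fst_le[of "f t - f s" "g t - g s"]
        B[OF st(2)] C[OF st(1)]
      by (intro add_mono mult_mono) auto
    finally show "norm (f t * g t - f s * g s) \<le> (B + C) * norm ((f t, g t) - (f s, g s))"
      by (simp add: distrib_right)
  qed
qed

section \<open>Null sets, the fundamental theorem of calculus and indefinite integrals\<close>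

lemma AE_lebesgue_iff_negligible:
  "(AE t in lebesgue. P t) \<longleftrightarrow> (\<exists>N. negligible N \<and> (\<forall>t. t \<notin> N \<longrightarrow> P t))"
  unfolding eventually_ae_filter negligible_iff_null_sets by (auto intro: exI[of _ "{t. \<not> P t}"])

lemma negligible_outer_open:
  assumes N: "negligible N" and "\<delta> > 0"
  obtains T where "open T" "N \<subseteq> T" "T \<in> lmeasurable" "measure lebesgue T < \<delta>"
proof -
  obtain T where T: "open T" "N \<subseteq> T" "T - N \<in> lmeasurable" "emeasure lebesgue (T - N) < ennreal \<delta>"
    using sets_lebesgue_outer_open[OF negligible_imp_sets[OF N] \<open>\<delta> > 0\<close>] .
  have eq: "T = (T - N) \<union> N" using T(2) by blast
  have "T \<in> lmeasurable"
    using fmeasurable.Un[OF T(3) negligible_imp_measurable[OF N]] eq by simp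
  moreover have "measure lebesgue (T - N) < \<delta>"
    using T(3,4) \<open>\<delta> > 0\<close> by (simp add: emeasure_eq_measure2 ennreal_less_iff)
  then have "measure lebesgue T < \<delta>"
    using measure_Un_le[of "T - N" lebesgue N] T(3) negligible_imp_sets[OF N] negligible_imp_measure0[OF N] eq
    by auto
  ultimately show thesis using that T by blast
qed

text \<open>On the exceptional null set, the gauge is an open set of small measure; absolute continuity
  makes the contribution of the intervals tagged there small.\<close>

theorem fundamental_theorem_of_calculus_absolutely_continuous:
  fixes f :: "real \<Rightarrow> 'e::euclidean_space"
  assumes ac: "absolutely_continuous_on {a..b} f" and ab: "a \<le> b" and N: "negligible N"
    and der: "\<And>t. t \<in> {a..b} - N \<Longrightarrow> (f has_vector_derivative g t) (at t within {a..b})"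
  shows "(g has_integral f b - f a) {a..b}"
proof -
  \<comment> \<open>With value 0 on \<open>N\<close>, the tags in \<open>N\<close> contribute
    nothing to the Riemann sum and only the increments of \<open>f\<close> remain there. The values
    are restored at the end, \<open>N\<close> being null.\<close>
  define h where "h t = (if t \<in> N then 0 else g t)" for t
  have "(h has_integral f b - f a) {a..b}"
    unfolding has_integral_real
  proof (intro allI impI)
    fix e :: real assume e: "e > 0"
    \<comment> \<open>Tags outside \<open>N\<close> may cost \<open>e'\<close> per unit length,
      those in \<open>N\<close> another \<open>e / 2\<close> in all; the summand 1 covers
      \<open>a = b\<close>.\<close>
    define e' where "e' = e / 2 / (b - a + 1)"
    have e': "e' > 0" "e' * (b - a) < e / 2"
      using e ab by (auto simp: e'_def field_simps)
    have e2: "e / 2 > 0" using e by simp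
    obtain \<delta> where \<delta>: "\<delta> > 0" and
      D: "\<And>D. D division_of \<Union>D \<Longrightarrow> \<Union>D \<subseteq> {a..b} \<Longrightarrow> total_length D < \<delta> \<Longrightarrow>
        variation f D < e / 2"
      using absolutely_continuous_onE[OF ac e2] by blast
    obtain T where T: "open T" "N \<subseteq> T" "T \<in> lmeasurable" "measure lebesgue T < \<delta>"
      using negligible_outer_open[OF N \<delta>] by blast
    have "\<exists>d>0. \<forall>y\<in>{a..b}. norm (y - t) < d \<longrightarrow> norm (f y - f t - (y - t) *\<^sub>R g t) \<le> e' * norm (y - t)"
      if "t \<in> {a..b} - N" for t
      using der[OF that] e'(1) unfolding has_vector_derivative_def has_derivative_within_alt by auto
    then obtain d where d: "\<And>t. t \<in> {a..b} - N \<Longrightarrow> d t > 0"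
      "\<And>t y. t \<in> {a..b} - N \<Longrightarrow> y \<in> {a..b} \<Longrightarrow> norm (y - t) < d t \<Longrightarrow>
         norm (f y - f t - (y - t) *\<^sub>R g t) \<le> e' * norm (y - t)"
      by metis
    define \<gamma> where "\<gamma> t = (if t \<in> N then T else if t \<in> {a..b} then ball t (d t) else ball t 1)" for t
    have g: "gauge \<gamma>"
      unfolding gauge_def \<gamma>_def using T d(1) by auto
    have m: "norm (sum (\<lambda>(x,k). measure lborel k *\<^sub>R h x) \<D> - (f b - f a)) < e"
      if tag: "\<D> tagged_division_of {a..b}" and fine: "\<gamma> fine \<D>" for \<D>
    proof -
      have fin: "finite \<D>" using tag by auto
      define \<D>N where "\<D>N = {(x, k) \<in> \<D>. x \<in> N}"
      have sub: "\<D>N \<subseteq> \<D>" by (auto simp: \<D>N_def)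
      have "\<D>N tagged_partial_division_of {a..b}"
        using tag sub by (meson tagged_division_of_def tagged_partial_division_subset)
      then have DN: "\<D>N tagged_division_of \<Union>(snd ` \<D>N)"
        by (rule tagged_partial_division_of_Union_self)
      then have div: "(snd ` \<D>N) division_of \<Union>(snd ` \<D>N)"
        by (rule division_of_tagged_division)
      have subT: "\<Union>(snd ` \<D>N) \<subseteq> T"
        using fine sub by (force simp: \<D>N_def \<gamma>_def fine_def)
      have subab: "\<Union>(snd ` \<D>N) \<subseteq> {a..b}"
        using tag sub by fastforce
      have len: "Sup K - Inf K = measure lebesgue K" if "K \<in> snd ` \<D>N" for K
      proof -
        have "measure lebesgue {Inf K..Sup K} = Sup K - Inf K"
          using division_of_Sup_Inf(2)[OF div that] by simp
        then show ?thesis using division_of_Sup_Inf(1)[OF div that] by simp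
      qed
      have "total_length (snd ` \<D>N) = measure lebesgue (\<Union>(snd ` \<D>N))"
        using content_division[OF div] len by simp
      also have "\<dots> \<le> measure lebesgue T"
        using subT T(3) lmeasurable_division[OF div] by (intro measure_mono_fmeasurable) auto
      also have "\<dots> < \<delta>" by fact
      finally have small: "variation f (snd ` \<D>N) < e / 2"
        using D[OF div subab] by simp
      \<comment> \<open>\<open>Sup\<close> and \<open>Inf\<close> of the empty set are unspecified,
        while passing from tagged intervals to the set of intervals requires value 0 on all
        degenerate ones.\<close>
      define \<Delta> where "\<Delta> K = (if K = {} then 0 else norm (f (Sup K) - f (Inf K)))" for K
      have "(\<Sum>(x, K)\<in>\<D>N. norm (f (Sup K) - f (Inf K))) = (\<Sum>(x, K)\<in>\<D>N. \<Delta> K)"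
        using tagged_division_ofD(2)[OF DN] by (intro sum.cong) (fastforce simp: \<Delta>_def)+
      also have "\<dots> = (\<Sum>K\<in>snd ` \<D>N. \<Delta> K)"
      proof (rule sum.over_tagged_division_lemma[OF DN])
        fix u v :: real assume "box u v = {}"
        then have "v \<le> u" by simp
        then show "\<Delta> (cbox u v) = 0" by (cases "u = v") (auto simp: \<Delta>_def)
      qed
      also have "\<dots> = variation f (snd ` \<D>N)"
        using division_ofD(3)[OF div] by (intro sum.cong) (auto simp: \<Delta>_def)
      finally have "(\<Sum>(x, K)\<in>\<D>N. norm (f (Sup K) - f (Inf K))) = variation f (snd ` \<D>N)" .
      with small have A: "(\<Sum>(x, K)\<in>\<D>N. norm (f (Sup K) - f (Inf K))) < e / 2" by simp
      have B: "(\<Sum>(x, K)\<in>\<D> - \<D>N. norm (measure lborel K *\<^sub>R h x - (f (Sup K) - f (Inf K)))) \<le> e' * (b - a)"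
      proof -
        have "(\<Sum>(x, K)\<in>\<D> - \<D>N. norm (measure lborel K *\<^sub>R h x - (f (Sup K) - f (Inf K)))) \<le>
            (\<Sum>(x, K)\<in>\<D> - \<D>N. e' * measure lborel K)"
        proof (intro sum_mono, clarify)
          fix x K assume xK: "(x, K) \<in> \<D>" "(x, K) \<notin> \<D>N"
          then have xN: "x \<notin> N" by (auto simp: \<D>N_def)
          obtain u v where K: "K = {u..v}"
            using tagged_division_ofD(4)[OF tag xK(1)] by (metis box_real(2))
          have xin: "x \<in> K" and Kab: "K \<subseteq> {a..b}"
            using tagged_division_ofD[OF tag] xK(1) by auto
          then have uv: "u \<le> x" "x \<le> v" "u \<in> {a..b}" "v \<in> {a..b}" "x \<in> {a..b}" using K by auto
          have "K \<subseteq> ball x (d x)"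
          proof -
            have "K \<subseteq> \<gamma> x" using fine xK(1) by (auto simp: fine_def)
            then show ?thesis using xN uv(5) by (simp add: \<gamma>_def)
          qed
          moreover have "u \<in> K" "v \<in> K" using K uv by auto
          ultimately have "u \<in> ball x (d x)" "v \<in> ball x (d x)" by blast+
          then have "norm (f u - f x - (u - x) *\<^sub>R g x) \<le> e' * norm (u - x)"
            "norm (f v - f x - (v - x) *\<^sub>R g x) \<le> e' * norm (v - x)"
            using d(2)[of x u] d(2)[of x v] uv xN by (auto simp: dist_norm norm_minus_commute)
          \<comment> \<open>The tag splits the interval, and the derivative at the tag controls both
            pieces.\<close>
          moreover have "measure lborel K *\<^sub>R h x - (f (Sup K) - f (Inf K)) =
              (f u - f x - (u - x) *\<^sub>R g x) - (f v - f x - (v - x) *\<^sub>R g x)"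
            using K uv xN by (simp add: h_def algebra_simps)
          ultimately have "norm (measure lborel K *\<^sub>R h x - (f (Sup K) - f (Inf K))) \<le>
              e' * norm (u - x) + e' * norm (v - x)"
            by (simp only:) (rule order_trans[OF norm_triangle_ineq4 add_mono])
          also have "\<dots> = e' * measure lborel K"
            using uv K by (simp add: algebra_simps)
          finally show "norm (measure lborel K *\<^sub>R h x - (f (Sup K) - f (Inf K))) \<le> e' * measure lborel K" .
        qed
        also have "\<dots> \<le> (\<Sum>(x, K)\<in>\<D>. e' * measure lborel K)"
          using fin e'(1) by (intro sum_mono2) auto
        also have "\<dots> = e' * (b - a)"
          using additive_content_tagged_division[of \<D> a b] tag ab
          by (simp add: sum_distrib_left[symmetric] case_prod_unfold)
        finally show ?thesis .
      qed
      have "sum (\<lambda>(x,k). measure lborel k *\<^sub>R h x) \<D> - (f b - f a) =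
          (\<Sum>(x, K)\<in>\<D>. measure lborel K *\<^sub>R h x - (f (Sup K) - f (Inf K)))"
        using additive_tagged_division_1[OF ab tag, of f]
        by (simp add: sum_subtractf case_prod_unfold)
      also have "norm \<dots> \<le> (\<Sum>(x, K)\<in>\<D>. norm (measure lborel K *\<^sub>R h x - (f (Sup K) - f (Inf K))))"
        unfolding case_prod_unfold by (rule norm_sum)
      also have "\<dots> = (\<Sum>(x, K)\<in>\<D> - \<D>N. norm (measure lborel K *\<^sub>R h x - (f (Sup K) - f (Inf K)))) +
          (\<Sum>(x, K)\<in>\<D>N. norm (measure lborel K *\<^sub>R h x - (f (Sup K) - f (Inf K))))"
        by (rule sum.subset_diff[OF sub fin])
      also have "(\<Sum>(x, K)\<in>\<D>N. norm (measure lborel K *\<^sub>R h x - (f (Sup K) - f (Inf K)))) =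
          (\<Sum>(x, K)\<in>\<D>N. norm (f (Sup K) - f (Inf K)))"
        by (intro sum.cong) (auto simp: \<D>N_def h_def norm_minus_commute)
      finally show ?thesis using A B e'(2) by linarith
    qed
    show "\<exists>\<gamma>. gauge \<gamma> \<and> (\<forall>\<D>. \<D> tagged_division_of {a..b} \<and> \<gamma> fine \<D> \<longrightarrow>
        norm (sum (\<lambda>(x,k). measure lborel k *\<^sub>R h x) \<D> - (f b - f a)) < e)"
      by (intro exI[of _ \<gamma>] conjI g allI impI) (elim conjE, rule m)
  qed
  then show ?thesis
    by (rule has_integral_spike[OF N, rotated]) (auto simp: h_def)
qed

lemma set_integral_interval_diff:
  fixes f :: "real \<Rightarrow> real"
  assumes f: "set_integrable lebesgue {a..b} f" and st: "a \<le> s" "s \<le> t" "t \<le> b"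
  shows "(LINT x:{a..t}|lebesgue. f x) - (LINT x:{a..s}|lebesgue. f x) = integral {s..t} f"
proof -
  have "set_integrable lebesgue {a..t} f" "set_integrable lebesgue {a..s} f"
    by (rule set_integrable_subset[OF f]; use st in auto)+
  moreover from this have "integral {a..s} f + integral {s..t} f = integral {a..t} f"
    using st by (intro Henstock_Kurzweil_Integration.integral_combine) (auto intro: set_lebesgue_integral_eq_integral)
  ultimately show ?thesis by (simp add: set_lebesgue_integral_eq_integral)
qed

text \<open>The integrand is cut at height \<open>n\<close>. What exceeds \<open>n\<close> has small
  integral over the whole interval, by dominated convergence; the rest contributes at most
  \<open>n\<close> times the total length of the intervals.\<close>

theorem absolutely_continuous_on_set_integral:
  fixes f :: "real \<Rightarrow> real"
  assumes f: "set_integrable lebesgue {a..b} f"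
  shows "absolutely_continuous_on {a..b} (\<lambda>t. LINT s:{a..t}|lebesgue. f s)"
  unfolding absolutely_continuous_on_def
proof (intro allI impI)
  fix \<epsilon> :: real assume \<epsilon>: "\<epsilon> > 0"
  define f0 where "f0 x = indicator {a..b} x *\<^sub>R f x" for x
  define r where "r n x = max 0 (\<bar>f0 x\<bar> - real n)" for n x
  have f0: "integrable lebesgue f0"
    using f unfolding set_integrable_def f0_def .
  then have [measurable]: "f0 \<in> borel_measurable lebesgue" by auto
  have rm: "r n \<in> borel_measurable lebesgue" for n unfolding r_def by measurable
  have r: "integrable lebesgue (r n)" for n
    by (rule Bochner_Integration.integrable_bound[OF f0 rm]) (auto simp: r_def)
  have "(\<lambda>n. integral\<^sup>L lebesgue (r n)) \<longlonglongrightarrow> (LINT (x::real)|lebesgue. (0 :: real))"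
  proof (rule Bochner_Integration.integral_dominated_convergence[where w = "\<lambda>x. \<bar>f0 x\<bar>" and s = r and f = "\<lambda>x::real. 0"])
    show "AE x in lebesgue. (\<lambda>n. r n x) \<longlonglongrightarrow> 0"
    proof (rule AE_I2)
      fix x
      obtain n0 :: nat where "\<bar>f0 x\<bar> \<le> real n0" using real_arch_simple by blast
      then have "\<forall>\<^sub>F n in sequentially. r n x = 0"
        by (intro eventually_sequentiallyI[of n0]) (auto simp: r_def)
      then show "(\<lambda>n. r n x) \<longlonglongrightarrow> 0" by (rule tendsto_eventually)
    qed
  qed (use f0 rm in \<open>auto simp: r_def\<close>)
  then have "(\<lambda>n. integral\<^sup>L lebesgue (r n)) \<longlonglongrightarrow> 0" by simp
  then have "\<forall>\<^sub>F n in sequentially. integral\<^sup>L lebesgue (r n) < \<epsilon> / 2"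
    by (rule order_tendstoD) (use \<epsilon> in simp)
  then obtain n where n: "integral\<^sup>L lebesgue (r n) < \<epsilon> / 2"
    unfolding eventually_sequentially by blast
  have f0s: "f0 absolutely_integrable_on S" "r n absolutely_integrable_on S" if "S \<in> sets lebesgue" for S
    using integrable_mult_indicator[OF that f0] integrable_mult_indicator[OF that r]
    unfolding set_integrable_def by auto
  define \<delta> where "\<delta> = \<epsilon> / 2 / (real n + 1)"
  have \<delta>: "\<delta> > 0" "real n * \<delta> < \<epsilon> / 2" using \<epsilon> by (auto simp: \<delta>_def field_simps)
  show "\<exists>\<delta>>0. \<forall>D. D division_of \<Union>D \<and> \<Union>D \<subseteq> {a..b} \<and> total_length D < \<delta> \<longrightarrow>
      variation (\<lambda>t. LINT s:{a..t}|lebesgue. f s) D < \<epsilon>"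
  proof (intro exI[of _ \<delta>] conjI \<delta> allI impI, elim conjE)
    fix D :: "real set set"
    assume D: "D division_of \<Union>D" "\<Union>D \<subseteq> {a..b}" "total_length D < \<delta>"
    have *: "norm ((LINT s:{a..Sup K}|lebesgue. f s) - (LINT s:{a..Inf K}|lebesgue. f s)) \<le>
        real n * (Sup K - Inf K) + integral K (r n)" if "K \<in> D" for K
    proof -
      note K = division_of_Sup_Inf[OF D(1) that]
      have KL: "K \<in> sets lebesgue" by (subst K(1)) auto
      have ab: "Inf K \<in> {a..b}" "Sup K \<in> {a..b}" using K D(2) by auto
      have sub: "{Inf K..Sup K} \<subseteq> {a..b}" using ab by auto
      have "(LINT s:{a..Sup K}|lebesgue. f s) - (LINT s:{a..Inf K}|lebesgue. f s) = integral {Inf K..Sup K} f"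
        using ab K by (intro set_integral_interval_diff[OF f]) auto
      also have "\<dots> = integral {Inf K..Sup K} f0"
        by (rule integral_cong) (use sub in \<open>auto simp: f0_def\<close>)
      also have "\<dots> = integral K f0" using K(1) by simp
      also have "norm \<dots> \<le> integral K (\<lambda>x. real n + r n x)"
      proof (rule Henstock_Kurzweil_Integration.integral_norm_bound_integral)
        show "f0 integrable_on K" using f0s(1)[OF KL] by (simp add: absolutely_integrable_on_def)
        have "(\<lambda>x. real n) integrable_on {Inf K..Sup K}" by (intro integrable_continuous_interval) auto
        then show "(\<lambda>x. real n + r n x) integrable_on K"
          using f0s(2)[OF KL] K(1) by (intro integrable_add) (auto simp: absolutely_integrable_on_def)
      qed (auto simp: r_def)
      also have "\<dots> = integral K (\<lambda>x. real n) + integral K (r n)"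
        using f0s(2)[OF KL] K(1) by (intro integral_add) (auto simp: absolutely_integrable_on_def intro!: integrable_continuous_interval, metis continuous_on_const integrable_continuous_interval)
      also have "integral K (\<lambda>x. real n) = real n * (Sup K - Inf K)"
        using K(2) by (subst K(1)) (simp add: mult.commute)
      finally show ?thesis .
    qed
    have "variation (\<lambda>t. LINT s:{a..t}|lebesgue. f s) D \<le>
        (\<Sum>K\<in>D. real n * (Sup K - Inf K) + integral K (r n))"
      by (intro sum_mono *)
    also have "\<dots> = real n * total_length D + (\<Sum>K\<in>D. integral K (r n))"
      by (simp add: sum.distrib sum_distrib_left)
    also have "(\<Sum>K\<in>D. integral K (r n)) = integral (\<Union>D) (r n)"
    proof (rule integral_combine_division_bottomup[OF D(1), symmetric])
      fix K assume "K \<in> D"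
      then have "K \<in> sets lebesgue" by (subst division_of_Sup_Inf(1)[OF D(1)]) auto
      then show "r n integrable_on K" using f0s(2) by (simp add: absolutely_integrable_on_def)
    qed
    also have "\<dots> \<le> integral UNIV (r n)"
    proof (rule integral_subset_le)
      have "\<Union>D \<in> sets lebesgue" using lmeasurable_division[OF D(1)] by auto
      then show "r n integrable_on \<Union>D" using f0s(2) by (simp add: absolutely_integrable_on_def)
      show "r n integrable_on UNIV" using f0s(2)[of UNIV] by (simp add: absolutely_integrable_on_def)
    qed (auto simp: r_def)
    also have "integral UNIV (r n) = integral\<^sup>L lebesgue (r n)"
      using r by (simp add: integral_lebesgue)
    also have "real n * total_length D \<le> real n * \<delta>"
      using D(3) by (intro mult_left_mono) auto
    finally show "variation (\<lambda>t. LINT s:{a..t}|lebesgue. f s) D < \<epsilon>"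
      using n \<delta>(2) by linarith
  qed
qed

text \<open>Lebesgue differentiation. The averages at hand are over intervals to the right of a
  point; applied to the reflected integrand they also yield the left derivative, outside the mirror
  image of a null set.\<close>

theorem has_vector_derivative_set_integral_AE:
  fixes f :: "real \<Rightarrow> real"
  assumes f: "set_integrable lebesgue {a..b} f"
  shows "AE t in lebesgue. t \<in> {a..b} \<longrightarrow>
    ((\<lambda>t. LINT s:{a..t}|lebesgue. f s) has_vector_derivative f t) (at t within {a..b})"
proof -
  define f0 where "f0 x = indicator {a..b} x *\<^sub>R f x" for x
  define F where "F t = (LINT s:{a..t}|lebesgue. f s)" for t
  have f0: "integrable lebesgue f0"
    using f unfolding set_integrable_def f0_def .
  have f0i: "f0 integrable_on {c..d}" for c d
  proof -
    have "f0 absolutely_integrable_on {c..d}"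
      using integrable_mult_indicator[OF _ f0, of "{c..d}"] unfolding set_integrable_def by simp
    then show ?thesis by (simp add: absolutely_integrable_on_def)
  qed
  have "f0 integrable_on cbox c d" for c d using f0i by simp
  from integrable_ccontinuous_explicit[OF this] obtain N1 where N1: "negligible N1"
    "\<And>x e. x \<notin> N1 \<Longrightarrow> 0 < e \<Longrightarrow> \<exists>d>0. \<forall>h. 0 < h \<and> h < d \<longrightarrow>
       norm (integral (cbox x (x + h *\<^sub>R One)) f0 /\<^sub>R h ^ DIM(real) - f0 x) < e"
    by metis
  have "(\<lambda>x. f0 (- x)) integrable_on cbox c d" for c d
    using f0i[of "- d" "- c"] Henstock_Kurzweil_Integration.integrable_reflect_real[of f0 "-c" "-d"] by simp
  from integrable_ccontinuous_explicit[OF this] obtain N2 where N2: "negligible N2"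
    "\<And>x e. x \<notin> N2 \<Longrightarrow> 0 < e \<Longrightarrow> \<exists>d>0. \<forall>h. 0 < h \<and> h < d \<longrightarrow>
       norm (integral (cbox x (x + h *\<^sub>R One)) (\<lambda>x. f0 (- x)) /\<^sub>R h ^ DIM(real) - f0 (- x)) < e"
    by metis
  have "negligible (uminus ` N2)"
    by (rule negligible_differentiable_image_negligible[OF _ N2(1)])
      (auto intro: differentiable_on_minus differentiable_on_id)
  then have N: "negligible (N1 \<union> uminus ` N2)" using N1(1) by simp
  have "(F has_vector_derivative f t) (at t within {a..b})" if t: "t \<in> {a..b} - (N1 \<union> uminus ` N2)" for t
    unfolding has_vector_derivative_def has_derivative_within_alt
  proof (intro conjI allI impI bounded_linear_scaleR_left)
    fix e :: real assume e: "e > 0"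
    have tN: "t \<notin> N1" "- t \<notin> N2" using t by force+
    have ft: "f0 t = f t" using t by (simp add: f0_def)
    obtain d1 where d1: "d1 > 0" "\<And>h. 0 < h \<Longrightarrow> h < d1 \<Longrightarrow> norm (integral {t..t+h} f0 / h - f t) < e"
      using N1(2)[OF tN(1) e] ft by (auto simp: divide_inverse mult.commute)
    obtain d2 where d2: "d2 > 0" "\<And>h. 0 < h \<Longrightarrow> h < d2 \<Longrightarrow> norm (integral {-t..-t+h} (\<lambda>x. f0 (-x)) / h - f t) < e"
      using N2(2)[OF tN(2) e] ft by (auto simp: divide_inverse mult.commute)
    have F: "F v - F u = integral {u..v} f0" if "a \<le> u" "u \<le> v" "v \<le> b" for u v
      unfolding F_def set_integral_interval_diff[OF f that]
      by (rule integral_cong) (use that in \<open>auto simp: f0_def\<close>)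
    have "norm (F y - F t - (y - t) *\<^sub>R f t) \<le> e * norm (y - t)"
      if y: "y \<in> {a..b}" "norm (y - t) < min d1 d2" for y
    proof (cases y t rule: linorder_cases)
      case greater
      define h where "h = y - t"
      have "norm (integral {t..t+h} f0 / h - f t) < e"
        using d1(2)[of h] greater y by (auto simp: h_def)
      moreover have "F y - F t = integral {t..t+h} f0" using F[of t y] greater y t by (simp add: h_def)
      ultimately have "norm ((F y - F t) / h - f t) < e" by simp
      moreover have "h > 0" using greater by (simp add: h_def)
      ultimately have "h * norm ((F y - F t) / h - f t) \<le> h * e" by simp
      also have "h * norm ((F y - F t) / h - f t) = norm (h * ((F y - F t) / h - f t))"
        using \<open>h > 0\<close> by (simp add: abs_mult)
      also have "h * ((F y - F t) / h - f t) = F y - F t - h * f t"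
        by (subst right_diff_distrib) (use \<open>h > 0\<close> in simp)
      finally show ?thesis using \<open>h > 0\<close> by (simp add: h_def mult.commute)
    next
      case less
      define h where "h = t - y"
      have "norm (integral {-t..-t+h} (\<lambda>x. f0 (-x)) / h - f t) < e"
        using d2(2)[of h] less y by (auto simp: h_def)
      moreover have "integral {-t..-t+h} (\<lambda>x. f0 (-x)) = integral {y..t} f0"
        using Henstock_Kurzweil_Integration.integral_reflect_real[of t y f0] by (simp add: h_def)
      moreover have "F t - F y = integral {y..t} f0" using F[of y t] less y t by simp
      ultimately have "norm ((F t - F y) / h - f t) < e" by simp
      moreover have "h > 0" using less by (simp add: h_def)
      ultimately have "h * norm ((F t - F y) / h - f t) \<le> h * e" by simp
      also have "h * norm ((F t - F y) / h - f t) = norm (h * ((F t - F y) / h - f t))"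
        using \<open>h > 0\<close> by (simp add: abs_mult)
      also have "h * ((F t - F y) / h - f t) = F t - F y - h * f t"
        by (subst right_diff_distrib) (use \<open>h > 0\<close> in simp)
      finally have "norm (F t - F y - h * f t) \<le> h * e" .
      moreover have "F y - F t - (y - t) *\<^sub>R f t = - (F t - F y - h * f t)"
        by (simp add: h_def algebra_simps)
      then have "norm (F y - F t - (y - t) *\<^sub>R f t) = norm (F t - F y - h * f t)"
        by (simp only: norm_minus_cancel)
      ultimately show ?thesis using less by (simp add: h_def mult.commute)
    qed simp
    then show "\<exists>d>0. \<forall>y\<in>{a..b}. norm (y - t) < d \<longrightarrow> norm (F y - F t - (y - t) *\<^sub>R f t) \<le> e * norm (y - t)"
      using d1(1) d2(1) by (intro exI[of _ "min d1 d2"]) auto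
  qed
  with N show ?thesis unfolding F_def AE_lebesgue_iff_negligible by blast
qed

text \<open>Primitives in the sense of Lebesgue, stated by derivatives rather than integrals so that
  sums, products and exponentials follow from the pointwise rules of differentiation.\<close>

definition ac_primitive :: "real \<Rightarrow> real \<Rightarrow> (real \<Rightarrow> 'e::euclidean_space) \<Rightarrow> (real \<Rightarrow> 'e) \<Rightarrow> bool" where
  "ac_primitive a b F f \<longleftrightarrow> absolutely_continuous_on {a..b} F \<and>
     (AE t in lebesgue. t \<in> {a..b} \<longrightarrow> (F has_vector_derivative f t) (at t within {a..b}))"

lemma ac_primitive_ac: "ac_primitive a b F f \<Longrightarrow> absolutely_continuous_on {a..b} F"
  and ac_primitive_AE: "ac_primitive a b F f \<Longrightarrow>
    AE t in lebesgue. t \<in> {a..b} \<longrightarrow> (F has_vector_derivative f t) (at t within {a..b})"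
  by (simp_all add: ac_primitive_def)

lemma ac_primitive_continuous: "ac_primitive a b F f \<Longrightarrow> continuous_on {a..b} F"
  by (rule absolutely_continuous_on_imp_continuous_on[OF ac_primitive_ac])

lemma ac_primitive_subset:
  assumes F: "ac_primitive a b F f" and "a \<le> c" "d \<le> b"
  shows "ac_primitive c d F f"
  unfolding ac_primitive_def
proof
  have sub: "{c..d} \<subseteq> {a..b}" using assms by auto
  show "absolutely_continuous_on {c..d} F"
    by (rule absolutely_continuous_on_subset[OF ac_primitive_ac[OF F] sub])
  show "AE t in lebesgue. t \<in> {c..d} \<longrightarrow> (F has_vector_derivative f t) (at t within {c..d})"
    using ac_primitive_AE[OF F]
    by eventually_elim (use sub in \<open>blast intro: has_vector_derivative_within_subset\<close>)
qed

lemma ac_primitive_has_integral: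
  assumes F: "ac_primitive a b F f" and t: "t \<in> {a..b}"
  shows "(f has_integral F t - F a) {a..t}"
proof -
  have F': "ac_primitive a t F f" by (rule ac_primitive_subset[OF F]) (use t in auto)
  obtain N where N: "negligible N"
    "\<forall>s. s \<notin> N \<longrightarrow> s \<in> {a..t} \<longrightarrow> (F has_vector_derivative f s) (at s within {a..t})"
    using ac_primitive_AE[OF F'] unfolding AE_lebesgue_iff_negligible by blast
  show ?thesis
    by (rule fundamental_theorem_of_calculus_absolutely_continuous[OF ac_primitive_ac[OF F'] _ N(1)])
      (use t N(2) in auto)
qed

text \<open>Both functions are recovered from their common derivative by the fundamental
  theorem.\<close>

lemma ac_primitive_unique:
  assumes "ac_primitive a b F f" "ac_primitive a b G g" "\<And>s. s \<in> {a..b} \<Longrightarrow> f s = g s"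
    "F a = G a" "t \<in> {a..b}"
  shows "F t = G t"
proof -
  have "(f has_integral F t - F a) {a..t}" "(g has_integral G t - G a) {a..t}"
    using ac_primitive_has_integral assms by blast+
  moreover have "(f has_integral y) {a..t} \<longleftrightarrow> (g has_integral y) {a..t}" for y
    by (rule has_integral_cong) (use assms in auto)
  ultimately have "F t - F a = G t - G a" using has_integral_unique by blast
  then show ?thesis using assms(4) by simp
qed

lemma ac_primitive_cong:
  assumes F: "ac_primitive a b F f"
    and eq: "\<And>t. t \<in> {a..b} \<Longrightarrow> F t = G t" "\<And>t. t \<in> {a..b} \<Longrightarrow> f t = g t"
  shows "ac_primitive a b G g"
  unfolding ac_primitive_def
proof
  show "absolutely_continuous_on {a..b} G"
    by (rule absolutely_continuous_on_dominated[OF ac_primitive_ac[OF F], of _ 1]) (simp add: eq)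
  show "AE t in lebesgue. t \<in> {a..b} \<longrightarrow> (G has_vector_derivative g t) (at t within {a..b})"
    using ac_primitive_AE[OF F]
  proof (eventually_elim, intro impI)
    fix t assume t: "t \<in> {a..b} \<longrightarrow> (F has_vector_derivative f t) (at t within {a..b})" "t \<in> {a..b}"
    then show "(G has_vector_derivative g t) (at t within {a..b})"
      using has_vector_derivative_transform[OF t(2), of G F "f t"] eq by simp
  qed
qed

lemma ac_primitive_lipschitz:
  assumes "\<And>t. t \<in> {a..b} \<Longrightarrow> (F has_vector_derivative f t) (at t within {a..b})"
    and "\<And>t. t \<in> {a..b} \<Longrightarrow> norm (f t) \<le> B"
  shows "ac_primitive a b F f"
  unfolding ac_primitive_def
proof
  show "absolutely_continuous_on {a..b} F"
  proof (rule absolutely_continuous_on_lipschitz)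
    show "norm (F t - F s) \<le> B * \<bar>t - s\<bar>" if "s \<in> {a..b}" "t \<in> {a..b}" for s t
      using differentiable_bound[of "{a..b}" F "\<lambda>t h. h *\<^sub>R f t" B t s] assms that
      by (auto simp: has_vector_derivative_def onorm_scaleR_left onorm_id)
  qed
qed (use assms in auto)

lemma ac_primitive_const: "ac_primitive a b (\<lambda>t. c) (\<lambda>t. 0)"
  by (rule ac_primitive_lipschitz[where B = 0]) auto

lemma ac_primitive_add:
  assumes F: "ac_primitive a b F f" and G: "ac_primitive a b G g"
  shows "ac_primitive a b (\<lambda>t. F t + G t) (\<lambda>t. f t + g t)"
  unfolding ac_primitive_def
proof
  show "absolutely_continuous_on {a..b} (\<lambda>t. F t + G t)"
  proof (rule absolutely_continuous_on_dominated[OF absolutely_continuous_on_Pair[OF F[THEN ac_primitive_ac] G[THEN ac_primitive_ac]]])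
    fix s t
    have "norm (F t + G t - (F s + G s)) \<le> norm (F t - F s) + norm (G t - G s)"
      by (metis add_diff_add norm_triangle_ineq)
    then show "norm (F t + G t - (F s + G s)) \<le> 2 * norm ((F t, G t) - (F s, G s))"
      using norm_fst_le[of "F t - F s" "G t - G s"] norm_snd_le[of "G t - G s" "F t - F s"] by simp
  qed
  show "AE t in lebesgue. t \<in> {a..b} \<longrightarrow> ((\<lambda>t. F t + G t) has_vector_derivative f t + g t) (at t within {a..b})"
    using ac_primitive_AE[OF F] ac_primitive_AE[OF G]
    by eventually_elim (blast intro: has_vector_derivative_add)
qed

lemma ac_primitive_mult:
  fixes F G :: "real \<Rightarrow> real"
  assumes F: "ac_primitive a b F f" and G: "ac_primitive a b G g"
  shows "ac_primitive a b (\<lambda>t. F t * G t) (\<lambda>t. F t * g t + f t * G t)"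
  unfolding ac_primitive_def
proof
  show "absolutely_continuous_on {a..b} (\<lambda>t. F t * G t)"
    by (intro absolutely_continuous_on_mult ac_primitive_ac[OF F] ac_primitive_ac[OF G])
  show "AE t in lebesgue. t \<in> {a..b} \<longrightarrow>
      ((\<lambda>t. F t * G t) has_vector_derivative F t * g t + f t * G t) (at t within {a..b})"
    using ac_primitive_AE[OF F] ac_primitive_AE[OF G]
    by eventually_elim (blast intro: has_vector_derivative_mult)
qed

lemma ac_primitive_exp:
  fixes F :: "real \<Rightarrow> real"
  assumes F: "ac_primitive a b F f"
  shows "ac_primitive a b (\<lambda>t. exp (F t)) (\<lambda>t. exp (F t) * f t)"
  unfolding ac_primitive_def
proof
  have "bounded (F ` {a..b})"
    using ac_primitive_continuous[OF F] by (intro compact_imp_bounded compact_continuous_image) auto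
  \<comment> \<open>The exponential is Lipschitz on bounded sets only; \<open>F\<close> stays in
    one.\<close>
  then obtain B where B: "\<And>t. t \<in> {a..b} \<Longrightarrow> F t \<in> {-B..B}"
    unfolding bounded_iff by (force simp: abs_le_iff)
  show "absolutely_continuous_on {a..b} (\<lambda>t. exp (F t))"
  proof (rule absolutely_continuous_on_dominated[OF ac_primitive_ac[OF F]])
    fix s t assume st: "s \<in> {a..b}" "t \<in> {a..b}"
    have *: "(exp has_derivative (\<lambda>h. h * exp x)) (at x within {-B..B})" for x :: real
      using has_field_derivative_imp_has_derivative[OF DERIV_subset[OF DERIV_exp, of "{-B..B}" x]]
      by (simp add: mult_commute_abs)
    show "norm (exp (F t) - exp (F s)) \<le> exp B * norm (F t - F s)"
    proof (rule differentiable_bound[of "{-B..B}" exp "\<lambda>x h. h * exp x"])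
      show "onorm (\<lambda>h. h * exp x) \<le> exp B" if "x \<in> {-B..B}" for x
        using that by (intro onorm_bound) (auto simp: abs_mult mult.commute mult_left_mono)
    qed (use B st * in auto)
  qed
  show "AE t in lebesgue. t \<in> {a..b} \<longrightarrow> ((\<lambda>t. exp (F t)) has_vector_derivative exp (F t) * f t) (at t within {a..b})"
    using ac_primitive_AE[OF F]
    by eventually_elim
      (auto simp: has_real_derivative_iff_has_vector_derivative[symmetric] intro!: derivative_eq_intros)
qed

lemma ac_primitive_set_integral:
  fixes f :: "real \<Rightarrow> real"
  assumes "set_integrable lebesgue {a..b} f"
  shows "ac_primitive a b (\<lambda>t. LINT s:{a..t}|lebesgue. f s) f"
  using absolutely_continuous_on_set_integral[OF assms] has_vector_derivative_set_integral_AE[OF assms]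
  unfolding ac_primitive_def by blast

text \<open>Evaluates iterated integrals, and what is built from them, at time 0, where
  \<open>{0..0}\<close> is a point.\<close>

lemma set_integral_singleton [simp]:
  fixes f :: "real \<Rightarrow> real"
  shows "(LINT s:{t}|lebesgue. f s) = 0"
  unfolding set_lebesgue_integral_def
proof (rule integral_eq_zero_AE)
  have "AE s in lebesgue. s \<noteq> t"
    using AE_completion[OF AE_lborel_singleton[of t]] .
  then show "AE s in lebesgue. indicator {t} s *\<^sub>R f s = 0"
    by eventually_elim simp
qed

lemma set_integrable_mult_continuous:
  fixes f g :: "real \<Rightarrow> real"
  assumes "set_integrable lebesgue {a..b} f" "continuous_on {a..b} g"
  shows "set_integrable lebesgue {a..b} (\<lambda>s. f s * g s)"
proof -
  have "bounded (g ` {a..b})"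
    using assms(2) by (intro compact_imp_bounded compact_continuous_image) auto
  then have "(\<lambda>s. g s * f s) absolutely_integrable_on {a..b}"
    using assms by (intro absolutely_integrable_bounded_measurable_product_real
        continuous_imp_measurable_on_sets_lebesgue) auto
  then show ?thesis by (simp add: mult.commute)
qed

section \<open>Iterated integrals\<close>

lemma iter_int_Nil [simp]: "iter_int u t [] = 1"
  by (simp add: iter_int_def)

lemma iter_int_append:
  "iter_int u t (w @ [x]) = (LINT s:{0..t}|lebesgue. u x s * iter_int u s w)"
  by (simp add: iter_int_def)

text \<open>Partial sums of \<open>Upsilon\<close> by word length: removing the last letter passes
  from level \<open>Suc n\<close> to level \<open>n\<close>, and on this the inductions run.\<close>

definition truncated :: "(letter \<Rightarrow> real \<Rightarrow> real) \<Rightarrow> series \<Rightarrow> nat \<Rightarrow> real \<Rightarrow> real" where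
  "truncated u P n t = (\<Sum>w\<in>words n. P w * iter_int u t w)"

text \<open>Kept abstract for three uses: words by length, pairs of words by separate lengths, and
  pairs of words by total length.\<close>

locale exhaustion =
  fixes A :: "nat \<Rightarrow> 'b set"
  assumes fin: "\<And>n. finite (A n)" and mono: "\<And>m n. m \<le> n \<Longrightarrow> A m \<subseteq> A n" and cover: "\<And>x. \<exists>n. x \<in> A n"
begin

lemma ex_superset: "finite F \<Longrightarrow> \<exists>n. F \<subseteq> A n"
proof (induction F rule: finite_induct)
  case (insert x F)
  then obtain m n where "F \<subseteq> A m" "x \<in> A n" using cover by blast
  then show ?case using mono[of m "max m n"] mono[of n "max m n"] by (intro exI[of _ "max m n"]) auto
qed simp

lemma tendsto_infsum:
  fixes f :: "'b \<Rightarrow> 'c::{comm_monoid_add, t2_space}"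
  assumes "f summable_on UNIV"
  shows "(\<lambda>n. sum f (A n)) \<longlonglongrightarrow> infsum f UNIV"
proof -
  have "filterlim A (finite_subsets_at_top UNIV) sequentially"
    unfolding filterlim_finite_subsets_at_top
  proof (intro allI impI)
    fix F :: "'b set" assume "finite F \<and> F \<subseteq> UNIV"
    then obtain n where "F \<subseteq> A n" using ex_superset by blast
    then show "\<forall>\<^sub>F n in sequentially. finite (A n) \<and> F \<subseteq> A n \<and> A n \<subseteq> UNIV"
      using fin mono by (intro eventually_sequentiallyI[of n]) blast
  qed
  from filterlim_compose[OF infsum_tendsto[OF assms] this] show ?thesis .
qed

lemma summable:
  fixes f :: "'b \<Rightarrow> real"
  assumes le: "\<And>n. (\<Sum>x\<in>A n. norm (f x)) \<le> C"
  shows "f summable_on UNIV"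
proof (rule Infinite_Sum.abs_summable_summable, rule nonneg_bdd_above_summable_on)
  show "bdd_above (sum (\<lambda>x. norm (f x)) ` {F. F \<subseteq> UNIV \<and> finite F})"
  proof (rule bdd_aboveI2)
    fix F :: "'b set" assume "F \<in> {F. F \<subseteq> UNIV \<and> finite F}"
    then obtain n where "F \<subseteq> A n" using ex_superset by blast
    then have "(\<Sum>x\<in>F. norm (f x)) \<le> (\<Sum>x\<in>A n. norm (f x))"
      by (intro sum_mono2 fin) auto
    also have "\<dots> \<le> C" by (rule le)
    finally show "(\<Sum>x\<in>F. norm (f x)) \<le> C" .
  qed
qed simp

end

interpretation words: exhaustion words
proof
  show "\<exists>n. w \<in> words n" for w by (intro exI[of _ "length w"]) simp
qed auto

section \<open>Iterated integrals of integrable controls and the functional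
  \<open>Upsilon\<close>\<close>

locale controls =
  fixes u :: "letter \<Rightarrow> real \<Rightarrow> real" and T :: real
  assumes integrable_u: "\<And>d. set_integrable lebesgue {0..T} (u d)"
begin

lemma continuous_iter_int: "continuous_on {0..T} (\<lambda>t. iter_int u t w)"
proof (induction w rule: rev_induct)
  case (snoc x w)
  have "set_integrable lebesgue {0..T} (\<lambda>s. u x s * iter_int u s w)"
    by (rule set_integrable_mult_continuous[OF integrable_u snoc])
  from ac_primitive_continuous[OF ac_primitive_set_integral[OF this]]
  show ?case by (simp add: iter_int_append)
qed simp

lemma integrable_iter_int: "set_integrable lebesgue {0..T} (\<lambda>s. u x s * iter_int u s w)"
  by (rule set_integrable_mult_continuous[OF integrable_u continuous_iter_int])

lemma ac_primitive_iter_int: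
  "ac_primitive 0 T (\<lambda>t. iter_int u t (w @ [x])) (\<lambda>s. u x s * iter_int u s w)"
  unfolding iter_int_append by (rule ac_primitive_set_integral[OF integrable_iter_int])

lemma iter_int_0 [simp]: "w \<noteq> [] \<Longrightarrow> iter_int u 0 w = 0"
  by (cases w rule: rev_cases) (simp_all add: iter_int_append)

lemma iter_int_sum_mset:
  "ac_primitive 0 T (\<lambda>t. \<Sum>w\<in>#M. iter_int u t (w @ [x])) (\<lambda>s. u x s * (\<Sum>w\<in>#M. iter_int u s w))"
proof (induction M)
  case (add w M)
  then show ?case
    using ac_primitive_add[OF ac_primitive_iter_int add, of w x] by (simp add: distrib_left)
qed (simp add: ac_primitive_const)

text \<open>Integration by parts. For nonempty words, the derivative of the product removes the last
  letter of one factor, the induction hypothesis expands the shorter products, and both sides vanish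
  at time 0.\<close>

lemma iter_int_shuffle:
  assumes "t \<in> {0..T}"
  shows "iter_int u t a * iter_int u t b = (\<Sum>w\<in>#shuffle_word a b. iter_int u t w)"
  using assms
proof (induction a b arbitrary: t rule: shuffle_word.induct)
  case (1 a b)
  show ?case
  proof (cases "a = [] \<or> b = []")
    case False
    define a' x b' y where "a' = butlast a" "x = last a" "b' = butlast b" "y = last b"
    with False have ab: "a = a' @ [x]" "b = b' @ [y]" by simp_all
    have sw: "shuffle_word a b = image_mset (\<lambda>w. w @ [x]) (shuffle_word a' b) + image_mset (\<lambda>w. w @ [y]) (shuffle_word a b')"
      using False by (subst shuffle_word.simps) (simp add: a'_x_b'_y_def)
    have IH: "iter_int u s a' * iter_int u s b = (\<Sum>w\<in>#shuffle_word a' b. iter_int u s w)"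
      "iter_int u s a * iter_int u s b' = (\<Sum>w\<in>#shuffle_word a b'. iter_int u s w)" if "s \<in> {0..T}" for s
      using "1.IH" False that by (auto simp: a'_x_b'_y_def)
    have P: "ac_primitive 0 T (\<lambda>t. iter_int u t a) (\<lambda>s. u x s * iter_int u s a')"
      "ac_primitive 0 T (\<lambda>t. iter_int u t b) (\<lambda>s. u y s * iter_int u s b')"
      using ac_primitive_iter_int ab by simp_all
    have "iter_int u t a * iter_int u t b =
      (\<Sum>w\<in>#shuffle_word a' b. iter_int u t (w @ [x])) + (\<Sum>w\<in>#shuffle_word a b'. iter_int u t (w @ [y]))"
    proof (rule ac_primitive_unique[OF ac_primitive_mult[OF P] ac_primitive_add[OF iter_int_sum_mset iter_int_sum_mset]])
      fix s assume "s \<in> {0..T}"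
      from IH[OF this, symmetric]
      show "iter_int u s a * (u y s * iter_int u s b') + u x s * iter_int u s a' * iter_int u s b =
        u x s * (\<Sum>w\<in>#shuffle_word a' b. iter_int u s w) + u y s * (\<Sum>w\<in>#shuffle_word a b'. iter_int u s w)"
        by (simp add: algebra_simps)
    next
      show "iter_int u 0 a * iter_int u 0 b =
        (\<Sum>w\<in>#shuffle_word a' b. iter_int u 0 (w @ [x])) + (\<Sum>w\<in>#shuffle_word a b'. iter_int u 0 (w @ [y]))"
        using False by simp
    qed (use "1.prems" in auto)
    then show ?thesis by (simp add: sw image_mset.compositionality comp_def)
  qed auto
qed

text \<open>The source of the bounds and, in the limit, of the integral equation for
  \<open>Upsilon\<close>.\<close>

lemma truncated_Suc:
  assumes t: "t \<in> {0..T}"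
  shows "truncated u P (Suc n) t = P [] + (\<Sum>x\<in>UNIV. LINT s:{0..t}|lebesgue. u x s * truncated u (rquot x P) n s)"
proof -
  have int: "set_integrable lebesgue {0..t} (\<lambda>s. u x s * iter_int u s w)" for x w
    using t by (intro set_integrable_subset[OF integrable_iter_int]) auto
  have "(LINT s:{0..t}|lebesgue. u x s * truncated u (rquot x P) n s) =
      (LINT s:{0..t}|lebesgue. \<Sum>w\<in>words n. P (w @ [x]) * (u x s * iter_int u s w))" for x
    by (simp add: truncated_def rquot_def sum_distrib_left mult.left_commute)
  also have "\<dots> x = (\<Sum>w\<in>words n. P (w @ [x]) * iter_int u t (w @ [x]))" for x
    using int unfolding iter_int_append set_lebesgue_integral_def set_integrable_def scaleR_sum_right
    by (subst Bochner_Integration.integral_sum) (auto simp: mult.left_commute[of _ "P _"])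
  finally show ?thesis
    by (simp add: truncated_def sum_words_Suc)
qed

lemma continuous_truncated: "continuous_on {0..T} (truncated u P n)"
  unfolding truncated_def by (intro continuous_intros continuous_iter_int)

lemma integrable_truncated: "set_integrable lebesgue {0..T} (\<lambda>s. u x s * truncated u P n s)"
  by (rule set_integrable_mult_continuous[OF integrable_u continuous_truncated])

abbreviation abs_u :: "letter \<Rightarrow> real \<Rightarrow> real" where
  "abs_u \<equiv> (\<lambda>d s. \<bar>u d s\<bar>)"

text \<open>Absolute values are taken of the controls inside the integrals, not only of the
  resulting terms. Majorants are thus truncations for other integrable controls, so that the
  recursion and the shuffle formula hold for them too.\<close>

abbreviation majorant :: "series \<Rightarrow> nat \<Rightarrow> real \<Rightarrow> real" where
  "majorant P \<equiv> truncated abs_u (\<lambda>w. \<bar>P w\<bar>)"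

lemma controls_abs: "controls abs_u T"
  by unfold_locales (rule set_integrable_abs[OF integrable_u])

lemma iter_int_abs_le:
  assumes "t \<in> {0..T}"
  shows "\<bar>iter_int u t w\<bar> \<le> iter_int abs_u t w"
  using assms
proof (induction w arbitrary: t rule: rev_induct)
  case (snoc x w)
  interpret abs: controls abs_u T by (rule controls_abs)
  have sub: "{0..t} \<subseteq> {0..T}" using snoc.prems by auto
  have i: "set_integrable lebesgue {0..t} (\<lambda>s. u x s * iter_int u s w)"
    "set_integrable lebesgue {0..t} (\<lambda>s. \<bar>u x s\<bar> * iter_int abs_u s w)"
    by (rule set_integrable_subset[OF integrable_iter_int _ sub] set_integrable_subset[OF abs.integrable_iter_int _ sub], simp)+
  have "\<bar>iter_int u t (w @ [x])\<bar> \<le> (LINT s:{0..t}|lebesgue. \<bar>u x s * iter_int u s w\<bar>)"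
    using set_integral_norm_bound[OF i(1)] by (simp add: iter_int_append)
  also have "\<dots> \<le> (LINT s:{0..t}|lebesgue. \<bar>u x s\<bar> * iter_int abs_u s w)"
    using sub snoc.IH by (intro set_integral_mono set_integrable_abs i) (auto simp: abs_mult intro!: mult_left_mono)
  finally show ?case by (simp add: iter_int_append)
qed simp

lemma iter_int_abs_nonneg: "t \<in> {0..T} \<Longrightarrow> 0 \<le> iter_int abs_u t w"
  using iter_int_abs_le[of t w] by linarith

lemma majorant_Suc_le:
  assumes t: "t \<in> {0..T}"
    and le: "\<And>s x. s \<in> {0..t} \<Longrightarrow> majorant (rquot x P) n s \<le> C"
  shows "majorant P (Suc n) t \<le> \<bar>P []\<bar> + C * (\<Sum>x\<in>UNIV. LINT s:{0..t}|lebesgue. \<bar>u x s\<bar>)"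
proof -
  interpret abs: controls abs_u T by (rule controls_abs)
  have sub: "{0..t} \<subseteq> {0..T}" using t by auto
  have "(LINT s:{0..t}|lebesgue. \<bar>u x s\<bar> * majorant (rquot x P) n s) \<le>
      (LINT s:{0..t}|lebesgue. \<bar>u x s\<bar> * C)" for x
  proof (rule set_integral_mono)
    show "set_integrable lebesgue {0..t} (\<lambda>s. \<bar>u x s\<bar> * majorant (rquot x P) n s)"
      by (rule set_integrable_subset[OF abs.integrable_truncated _ sub]) simp
    show "set_integrable lebesgue {0..t} (\<lambda>s. \<bar>u x s\<bar> * C)"
      by (rule set_integrable_subset[OF set_integrable_mult_left[OF abs.integrable_u] _ sub]) simp
  qed (use le in \<open>auto intro: mult_left_mono\<close>)
  also have "\<dots> x = C * (LINT s:{0..t}|lebesgue. \<bar>u x s\<bar>)" for x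
    by (simp add: mult.commute)
  finally have le: "(LINT s:{0..t}|lebesgue. \<bar>u x s\<bar> * majorant (rquot x P) n s) \<le>
      C * (LINT s:{0..t}|lebesgue. \<bar>u x s\<bar>)" for x .
  have rq: "rquot x (\<lambda>w. \<bar>P w\<bar>) = (\<lambda>w. \<bar>rquot x P w\<bar>)" for x
    by (simp add: rquot_def fun_eq_iff)
  have "majorant P (Suc n) t = \<bar>P []\<bar> +
      (\<Sum>x\<in>UNIV. LINT s:{0..t}|lebesgue. \<bar>u x s\<bar> * majorant (rquot x P) n s)"
    using abs.truncated_Suc[OF t, of "\<lambda>w. \<bar>P w\<bar>" n] by (simp add: rq)
  also have "\<dots> \<le> \<bar>P []\<bar> + (\<Sum>x\<in>UNIV. C * (LINT s:{0..t}|lebesgue. \<bar>u x s\<bar>))"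
    by (intro add_left_mono sum_mono le)
  finally show ?thesis by (simp add: sum_distrib_left)
qed

lemma sum_count_eq_sum_mset:
  fixes f :: "'b \<Rightarrow> real"
  assumes "finite B" "set_mset M \<subseteq> B"
  shows "(\<Sum>w\<in>B. real (count M w) * f w) = (\<Sum>w\<in>#M. f w)"
  using assms(2)
proof (induction M)
  case (add x M)
  have "(\<Sum>w\<in>B. real (count (add_mset x M) w) * f w) =
      (\<Sum>w\<in>B. (if w = x then f w else 0) + real (count M w) * f w)"
    by (intro sum.cong) (auto simp: algebra_simps)
  then show ?case using add assms(1) by (simp add: sum.distrib)
qed simp

lemma sum_count_le_sum_mset:
  fixes f :: "'b \<Rightarrow> real"
  assumes "finite B" "\<And>w. f w \<ge> 0"
  shows "(\<Sum>w\<in>B. real (count M w) * f w) \<le> (\<Sum>w\<in>#M. f w)"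
proof -
  have "(\<Sum>w\<in>B. real (count M w) * f w) \<le> (\<Sum>w\<in>B \<union> set_mset M. real (count M w) * f w)"
    using assms by (intro sum_mono2) auto
  then show ?thesis using assms(1) by (simp add: sum_count_eq_sum_mset)
qed

lemma truncated_shuffle_eq:
  "truncated v (shuffle P Q) n t =
    (\<Sum>a\<in>words n. \<Sum>b\<in>words n. P a * Q b * (\<Sum>w\<in>words n. real (count (shuffle_word a b) w) * iter_int v t w))"
proof -
  have "truncated v (shuffle P Q) n t =
      (\<Sum>w\<in>words n. \<Sum>a\<in>words n. \<Sum>b\<in>words n. P a * Q b * (real (count (shuffle_word a b) w) * iter_int v t w))"
    unfolding truncated_def
  proof (intro sum.cong refl)
    fix w assume "w \<in> words n"
    then have "shuffle P Q w = (\<Sum>u\<in>words n. \<Sum>v\<in>words n. P u * Q v * real (count (shuffle_word u v) w))"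
      by (intro shuffle_eq_sum) auto
    then show "shuffle P Q w * iter_int v t w =
        (\<Sum>a\<in>words n. \<Sum>b\<in>words n. P a * Q b * (real (count (shuffle_word a b) w) * iter_int v t w))"
      by (simp add: sum_distrib_right mult.assoc)
  qed
  also have "\<dots> = (\<Sum>a\<in>words n. \<Sum>w\<in>words n. \<Sum>b\<in>words n. P a * Q b * (real (count (shuffle_word a b) w) * iter_int v t w))"
    by (rule sum.swap)
  also have "\<dots> = (\<Sum>a\<in>words n. \<Sum>b\<in>words n. \<Sum>w\<in>words n. P a * Q b * (real (count (shuffle_word a b) w) * iter_int v t w))"
    by (intro sum.cong refl sum.swap)
  finally show ?thesis by (simp add: sum_distrib_left)
qed

text \<open>The product of the truncations involves words up to length \<open>2 * n\<close>, of
  which the left side keeps those up to \<open>n\<close>; the discarded terms are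
  nonnegative.\<close>

lemma majorant_shuffle_le:
  assumes t: "t \<in> {0..T}"
  shows "majorant (shuffle P Q) n t \<le> majorant P n t * majorant Q n t"
proof -
  interpret abs: controls abs_u T by (rule controls_abs)
  let ?I = "iter_int abs_u t"
  have "majorant (shuffle P Q) n t \<le> truncated abs_u (shuffle (\<lambda>w. \<bar>P w\<bar>) (\<lambda>w. \<bar>Q w\<bar>)) n t"
    unfolding truncated_def by (intro sum_mono mult_right_mono abs_shuffle_le iter_int_abs_nonneg t)
  also have "\<dots> \<le> (\<Sum>a\<in>words n. \<Sum>b\<in>words n. \<bar>P a\<bar> * \<bar>Q b\<bar> * (?I a * ?I b))"
    unfolding truncated_shuffle_eq abs.iter_int_shuffle[OF t]
    by (intro sum_mono mult_left_mono sum_count_le_sum_mset iter_int_abs_nonneg t) auto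
  also have "\<dots> = majorant P n t * majorant Q n t"
    unfolding truncated_def sum_product by (simp add: mult_ac)
  finally show ?thesis .
qed

lemma truncated_le_majorant:
  assumes t: "t \<in> {0..T}"
  shows "\<bar>truncated u P n t\<bar> \<le> majorant P n t"
  unfolding truncated_def
  by (rule order_trans[OF sum_abs]) (intro sum_mono, simp add: abs_mult, intro mult_left_mono iter_int_abs_le t abs_ge_zero)

lemma majorant_nonneg: "t \<in> {0..T} \<Longrightarrow> 0 \<le> majorant P n t"
  unfolding truncated_def by (intro sum_nonneg mult_nonneg_nonneg iter_int_abs_nonneg) simp_all

lemma summable_iter_int:
  assumes t: "t \<in> {0..T}" and le: "\<And>n. majorant P n t \<le> C"
  shows "(\<lambda>w. P w * iter_int u t w) summable_on UNIV"
proof (rule words.summable)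
  fix n
  have "(\<Sum>w\<in>words n. norm (P w * iter_int u t w)) \<le> majorant P n t"
    unfolding truncated_def by (intro sum_mono, simp add: abs_mult, intro mult_left_mono iter_int_abs_le t abs_ge_zero)
  also have "\<dots> \<le> C" by (rule le)
  finally show "(\<Sum>w\<in>words n. norm (P w * iter_int u t w)) \<le> C" .
qed

lemma Upsilon_definedI:
  assumes "t \<in> {0..T}" "\<And>n. majorant P n t \<le> C"
  shows "Upsilon_defined u t P"
  unfolding Upsilon_defined_def by (rule summable_iter_int[OF assms])

lemma truncated_tendsto:
  assumes "Upsilon_defined u t P"
  shows "(\<lambda>n. truncated u P n t) \<longlonglongrightarrow> Upsilon u t P"
  using words.tendsto_infsum assms
  unfolding truncated_def Upsilon_def Upsilon_defined_def by blast

text \<open>One summable family over pairs of words is summed in two ways. Its sums over boxes are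
  products of truncations, its sums over pairs of total length at most \<open>n\<close> are
  truncations of the shuffle product, and both converge to the same value.\<close>

lemma Upsilon_shuffle:
  assumes t: "t \<in> {0..T}"
    and P: "\<And>n. majorant P n t \<le> C" and Q: "\<And>n. majorant Q n t \<le> D"
  shows "Upsilon u t (shuffle P Q) = Upsilon u t P * Upsilon u t Q"
proof -
  let ?I = "iter_int u t"
  define g where "g = (\<lambda>(a, b). P a * Q b * (?I a * ?I b))"
  define A where "A n = {(a, b). length a + length b \<le> n \<and> a \<in> words n \<and> b \<in> words n}" for n
  interpret A: exhaustion A
  proof
    show "finite (A n)" for n
      by (rule finite_subset[of _ "words n \<times> words n"]) (auto simp: A_def)
    show "\<exists>n. z \<in> A n" for z
      by (cases z) (auto simp: A_def intro!: exI[of _ "length (fst z) + length (snd z)"])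
  qed (auto simp: A_def)
  interpret B: exhaustion "\<lambda>n. words n \<times> words n"
  proof
    show "\<exists>n. z \<in> words n \<times> words n" for z
      by (cases z) (auto intro!: exI[of _ "length (fst z) + length (snd z)"])
  qed auto
  have "0 \<le> majorant P 0 t" by (rule majorant_nonneg[OF t])
  then have "C \<ge> 0" using P[of 0] by linarith
  then have CD: "majorant P n t * majorant Q n t \<le> C * D" for n
    by (intro mult_mono P Q majorant_nonneg[OF t])
  have g: "g summable_on UNIV"
  proof (rule B.summable)
    fix n
    have "(\<Sum>z\<in>words n \<times> words n. norm (g z)) = (\<Sum>a\<in>words n. \<bar>P a\<bar> * \<bar>?I a\<bar>) * (\<Sum>b\<in>words n. \<bar>Q b\<bar> * \<bar>?I b\<bar>)"
      unfolding sum_product sum.cartesian_product by (intro sum.cong) (auto simp: g_def abs_mult)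
    also have "\<dots> \<le> majorant P n t * majorant Q n t"
      unfolding truncated_def
      by (intro mult_mono sum_mono mult_left_mono iter_int_abs_le t sum_nonneg mult_nonneg_nonneg iter_int_abs_nonneg) auto
    also have "\<dots> \<le> C * D" by (rule CD)
    finally show "(\<Sum>z\<in>words n \<times> words n. norm (g z)) \<le> C * D" .
  qed
  note 1 = A.tendsto_infsum[OF g] and 2 = B.tendsto_infsum[OF g]
  have "sum g (words n \<times> words n) = truncated u P n t * truncated u Q n t" for n
    unfolding truncated_def sum_product sum.cartesian_product by (intro sum.cong) (auto simp: g_def)
  moreover have "(\<lambda>n. truncated u P n t * truncated u Q n t) \<longlonglongrightarrow> Upsilon u t P * Upsilon u t Q"
    by (intro tendsto_mult truncated_tendsto Upsilon_definedI[OF t P] Upsilon_definedI[OF t Q])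
  ultimately have eq: "infsum g UNIV = Upsilon u t P * Upsilon u t Q"
    using LIMSEQ_unique[OF 2] by simp
  have "truncated u (shuffle P Q) n t = sum g (A n)" for n
  proof -
    \<comment> \<open>All terms of a shuffle have the same length, so truncation keeps all of them
      or none.\<close>
    have count: "(\<Sum>w\<in>words n. real (count (shuffle_word a b) w) * ?I w) =
        (if length a + length b \<le> n then ?I a * ?I b else 0)" for a b
    proof (cases "length a + length b \<le> n")
      case True
      then show ?thesis
        unfolding iter_int_shuffle[OF t] by (subst sum_count_eq_sum_mset) (auto dest: length_shuffle_word)
    next
      case False
      then have "count (shuffle_word a b) w = 0" if "w \<in> words n" for w
        using that length_shuffle_word[of w a b] by (auto simp: not_in_iff[symmetric])
      then show ?thesis using False by simp
    qed
    have "truncated u (shuffle P Q) n t = (\<Sum>(a, b)\<in>words n \<times> words n. if (a, b) \<in> A n then g (a, b) else 0)"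
      unfolding truncated_shuffle_eq count sum.cartesian_product
      by (intro sum.cong) (auto simp: A_def g_def)
    also have "\<dots> = sum g (A n)"
    proof -
      have "A n \<subseteq> words n \<times> words n" by (auto simp: A_def)
      then show ?thesis by (simp add: case_prod_unfold sum.If_cases Int_absorb1)
    qed
    finally show ?thesis .
  qed
  moreover have "(\<lambda>n. truncated u (shuffle P Q) n t) \<longlonglongrightarrow> Upsilon u t (shuffle P Q)"
  proof (rule truncated_tendsto[OF Upsilon_definedI[OF t]])
    fix n
    show "majorant (shuffle P Q) n t \<le> C * D"
      by (rule order_trans[OF majorant_shuffle_le[OF t] CD])
  qed
  ultimately show ?thesis using LIMSEQ_unique[OF 1] eq by simp
qed

text \<open>The limit of \<open>truncated_Suc\<close> under the integral. The bound for the
  quotients, uniform in \<open>n\<close>, \<open>s\<close> and \<open>x\<close>, supplies the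
  integrable dominating function \<open>\<bar>u x s\<bar> * C\<close>.\<close>

lemma Upsilon_integral:
  assumes P: "\<And>n s. s \<in> {0..T} \<Longrightarrow> majorant P n s \<le> D"
    and rP: "\<And>n s x. s \<in> {0..T} \<Longrightarrow> majorant (rquot x P) n s \<le> C"
  shows "ac_primitive 0 T (\<lambda>t. Upsilon u t P) (\<lambda>s. \<Sum>x\<in>UNIV. u x s * Upsilon u s (rquot x P))"
    and "T \<ge> 0 \<Longrightarrow> Upsilon u 0 P = P []"
proof -
  let ?f = "\<lambda>x s. u x s * Upsilon u s (rquot x P)"
  have "?f x absolutely_integrable_on {0..t} \<and>
      (\<lambda>n. LINT s:{0..t}|lebesgue. u x s * truncated u (rquot x P) n s) \<longlonglongrightarrow> (LINT s:{0..t}|lebesgue. ?f x s)"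
    if t: "t \<in> {0..T}" for t x
  proof
    have sub: "{0..t} \<subseteq> {0..T}" using t by auto
    have i: "set_integrable lebesgue {0..t} (\<lambda>s. u x s * truncated u (rquot x P) n s)" for n
      by (rule set_integrable_subset[OF integrable_truncated _ sub]) simp
    have hi: "(\<lambda>s. \<bar>u x s\<bar> * C) integrable_on {0..t}"
      by (rule set_lebesgue_integral_eq_integral(1), rule set_integrable_subset[OF set_integrable_mult_left[OF set_integrable_abs[OF integrable_u]] _ sub]) simp
    have lim: "(\<lambda>n. u x s * truncated u (rquot x P) n s) \<longlonglongrightarrow> ?f x s" if "s \<in> {0..t}" for s
      using that sub by (intro tendsto_mult_left truncated_tendsto Upsilon_definedI[OF _ rP]) auto
    have bd: "norm (u x s * truncated u (rquot x P) n s) \<le> \<bar>u x s\<bar> * C" if "s \<in> {0..t}" for s n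
    proof -
      have "s \<in> {0..T}" using that sub by auto
      from order_trans[OF truncated_le_majorant[OF this] rP[OF this]]
      show ?thesis by (auto simp: abs_mult intro: mult_left_mono)
    qed
    have "norm (?f x s) \<le> \<bar>u x s\<bar> * C" if "s \<in> {0..t}" for s
      by (rule tendsto_upperbound[OF tendsto_norm[OF lim[OF that]]]) (use bd that in auto)
    then show *: "?f x absolutely_integrable_on {0..t}"
      by (rule dominated_convergence_absolutely_integrable[OF i hi _ lim])
    have "(\<lambda>n. integral {0..t} (\<lambda>s. u x s * truncated u (rquot x P) n s)) \<longlonglongrightarrow> integral {0..t} (?f x)"
      by (rule dominated_convergence(2)[OF set_lebesgue_integral_eq_integral(1)[OF i] hi bd lim])
    then show "(\<lambda>n. LINT s:{0..t}|lebesgue. u x s * truncated u (rquot x P) n s) \<longlonglongrightarrow> (LINT s:{0..t}|lebesgue. ?f x s)"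
      by (simp only: set_lebesgue_integral_eq_integral(2)[OF i] set_lebesgue_integral_eq_integral(2)[OF *])
  qed
  note * = this
  have eq: "Upsilon u t P = P [] + (\<Sum>x\<in>UNIV. LINT s:{0..t}|lebesgue. ?f x s)" if t: "t \<in> {0..T}" for t
  proof (rule LIMSEQ_unique)
    have "Upsilon_defined u t P" by (rule Upsilon_definedI[OF t P[OF t]])
    from LIMSEQ_Suc[OF truncated_tendsto[OF this]]
    show "(\<lambda>n. P [] + (\<Sum>x\<in>UNIV. LINT s:{0..t}|lebesgue. u x s * truncated u (rquot x P) n s)) \<longlonglongrightarrow> Upsilon u t P"
      by (simp only: truncated_Suc[OF t])
    show "(\<lambda>n. P [] + (\<Sum>x\<in>UNIV. LINT s:{0..t}|lebesgue. u x s * truncated u (rquot x P) n s)) \<longlonglongrightarrow>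
        P [] + (\<Sum>x\<in>UNIV. LINT s:{0..t}|lebesgue. ?f x s)"
      by (intro tendsto_add tendsto_const tendsto_sum conjunct2[OF *[OF t]])
  qed
  show "Upsilon u 0 P = P []" if "T \<ge> 0"
    using eq[of 0] that by simp
  show "ac_primitive 0 T (\<lambda>t. Upsilon u t P) (\<lambda>s. \<Sum>x\<in>UNIV. ?f x s)"
  proof (cases "T \<ge> 0")
    case True
    then have prim: "ac_primitive 0 T (\<lambda>t. LINT s:{0..t}|lebesgue. ?f x s) (?f x)" for x
      using * [of T x] by (intro ac_primitive_set_integral) auto
    have "ac_primitive 0 T (\<lambda>t. P [] + ((LINT s:{0..t}|lebesgue. ?f La s) +
        ((LINT s:{0..t}|lebesgue. ?f Lb s) + (LINT s:{0..t}|lebesgue. ?f Lc s))))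
        (\<lambda>s. 0 + (?f La s + (?f Lb s + ?f Lc s)))"
      by (intro ac_primitive_add ac_primitive_const prim)
    then show ?thesis
      by (rule ac_primitive_cong) (simp_all add: eq sum_letter)
  next
    case False
    then show ?thesis
      by (intro ac_primitive_lipschitz) auto
  qed
qed

end

lemma Upsilon_scale: "Upsilon u t (\<lambda>w. r * P w) = r * Upsilon u t P"
  unfolding Upsilon_def by (simp add: mult.assoc infsum_cmult_right')

lemma Upsilon_one [simp]: "Upsilon u t one_series = 1"
proof -
  have "Upsilon u t one_series = (\<Sum>\<^sub>\<infinity>w\<in>{[]}. one_series w * iter_int u t w)"
    unfolding Upsilon_def by (rule infsum_cong_neutral) (auto simp: one_series_def)
  then show ?thesis by (simp add: one_series_def)
qed

lemma Upsilon_zero [simp]: "Upsilon u t (\<lambda>w. 0) = 0"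
  by (simp add: Upsilon_def)

section \<open>Convergence for small controls\<close>

locale small_controls = controls +
  assumes T_nonneg: "0 \<le> T"
    and small: "(\<Sum>x\<in>UNIV. LINT s:{0..T}|lebesgue. \<bar>u x s\<bar>) \<le> 1 / 8"
begin

lemma small': "t \<in> {0..T} \<Longrightarrow> (\<Sum>x\<in>UNIV. LINT s:{0..t}|lebesgue. \<bar>u x s\<bar>) \<le> 1 / 8"
proof (rule order_trans[OF sum_mono small])
  fix x assume t: "t \<in> {0..T}"
  have "(LINT s:{0..T}|lebesgue. \<bar>u x s\<bar>) - (LINT s:{0..t}|lebesgue. \<bar>u x s\<bar>) = integral {t..T} (\<lambda>s. \<bar>u x s\<bar>)"
    by (rule set_integral_interval_diff[OF set_integrable_abs[OF integrable_u[of x]]]) (use t in auto)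
  moreover have "\<dots> \<ge> 0"
    using set_lebesgue_integral_eq_integral(1)[OF set_integrable_subset[OF set_integrable_abs[OF integrable_u[of x]], of "{t..T}"]] t
    by (intro Henstock_Kurzweil_Integration.integral_nonneg) auto
  ultimately show "(LINT s:{0..t}|lebesgue. \<bar>u x s\<bar>) \<le> (LINT s:{0..T}|lebesgue. \<bar>u x s\<bar>)" by simp
qed

lemma truncated_one: "truncated v one_series n t = 1"
proof -
  have "truncated v one_series n t = (\<Sum>w\<in>{[]}. one_series w * iter_int v t w)"
    unfolding truncated_def by (rule sum.mono_neutral_right) (auto simp: one_series_def)
  then show ?thesis by (simp add: one_series_def)
qed

lemma truncated_zero: "truncated v (\<lambda>w. 0) n t = 0"
  by (simp add: truncated_def)

lemma truncated_scale: "truncated v (\<lambda>w. r * P w) n t = r * truncated v P n t"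
  by (simp add: truncated_def sum_distrib_left mult.assoc)

lemma truncated_0: "truncated v P 0 t = P []"
  by (simp add: truncated_def)

lemma majorant_Suc_le_small:
  assumes t: "t \<in> {0..T}" and "0 \<le> C"
    and le: "\<And>s x. s \<in> {0..T} \<Longrightarrow> majorant (rquot x P) n s \<le> C"
  shows "majorant P (Suc n) t \<le> \<bar>P []\<bar> + C / 8"
proof -
  have "majorant P (Suc n) t \<le> \<bar>P []\<bar> + C * (\<Sum>x\<in>UNIV. LINT s:{0..t}|lebesgue. \<bar>u x s\<bar>)"
    by (rule majorant_Suc_le[OF t]) (use le t in auto)
  also have "\<dots> \<le> \<bar>P []\<bar> + C * (1 / 8)"
    by (intro add_left_mono mult_left_mono small' t \<open>0 \<le> C\<close>)
  finally show ?thesis by simp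
qed

lemma abs_one_series [simp]: "(\<lambda>w. \<bar>one_series w\<bar>) = one_series"
  by (auto simp: one_series_def)

text \<open>The two bounds support each other. If the truncation at level \<open>n\<close> is at
  most 1, then its quotients, which are 1, twice the series and the negative of its shuffle square,
  are at most 2 in absolute value; the constant term being 0, level \<open>Suc n\<close> is at most
  \<open>2 / 8\<close>.\<close>

lemma bound_S_a:
  assumes "t \<in> {0..T}"
  shows "majorant (S_of La) n t \<le> 1"
    and "majorant (rquot x (S_of La)) n t \<le> 2"
proof -
  have step: "majorant (rquot x (S_of La)) n s \<le> 2"
    if IH: "majorant (S_of La) n s \<le> 1" and s: "s \<in> {0..T}" for n s x
  proof (cases x)
    case La
    then show ?thesis by (simp add: rquot_S_La truncated_one del: S_of.simps)
  next
    case Lb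
    then show ?thesis using IH by (simp add: rquot_S_La abs_mult truncated_scale del: S_of.simps)
  next
    case Lc
    have "majorant (shuffle (S_of La) (S_of La)) n s \<le>
        majorant (S_of La) n s * majorant (S_of La) n s"
      by (rule majorant_shuffle_le[OF s])
    also have "\<dots> \<le> 1 * 1"
      by (intro mult_mono IH majorant_nonneg[OF s]) simp
    finally show ?thesis using Lc by (simp add: rquot_S_La del: S_of.simps)
  qed
  have "majorant (S_of La) n s \<le> 1" if "s \<in> {0..T}" for s n
    using that
  proof (induction n arbitrary: s)
    case 0
    then show ?case by (simp only: truncated_0 S_of_La_Nil)
  next
    case (Suc n)
    from majorant_Suc_le_small[OF Suc.prems _ step[OF Suc.IH]]
    show ?case by (simp del: S_of.simps add: S_of_La_Nil)
  qed
  with step assms show "majorant (S_of La) n t \<le> 1"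
    "majorant (rquot x (S_of La)) n t \<le> 2" by blast+
qed

text \<open>Here the quotients are bounded by \<open>2 * 2\<close> and \<open>2 * (1 * 2)\<close>,
  where the 1 is the bound for \<open>S_of La\<close>; with the constant term 1 the next level is at
  most \<open>1 + 4 / 8\<close>.\<close>

lemma bound_exp2_S:
  assumes "t \<in> {0..T}"
  shows "majorant (exp2 S_a1) n t \<le> 2"
    and "majorant (rquot x (exp2 S_a1)) n t \<le> 4"
proof -
  have step: "majorant (rquot x (exp2 S_a1)) n s \<le> 4"
    if IH: "majorant (exp2 S_a1) n s \<le> 2" and s: "s \<in> {0..T}" for n s x
  proof (cases x)
    case La
    then show ?thesis by (simp add: rquot_exp2_S truncated_zero)
  next
    case Lb
    then show ?thesis using IH by (simp add: rquot_exp2_S abs_mult truncated_scale)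
  next
    case Lc
    have "majorant (shuffle (S_of La) (exp2 S_a1)) n s \<le>
        majorant (S_of La) n s * majorant (exp2 S_a1) n s"
      by (rule majorant_shuffle_le[OF s])
    also have "\<dots> \<le> 1 * 2"
      by (intro mult_mono IH bound_S_a(1)[OF s] majorant_nonneg[OF s]) simp
    finally show ?thesis using Lc by (simp add: rquot_exp2_S abs_mult truncated_scale del: S_of.simps)
  qed
  have "majorant (exp2 S_a1) n s \<le> 2" if "s \<in> {0..T}" for s n
    using that
  proof (induction n arbitrary: s)
    case 0
    then show ?case by (simp only: truncated_0 exp2_S_Nil)
  next
    case (Suc n)
    from majorant_Suc_le_small[OF Suc.prems _ step[OF Suc.IH]]
    show ?case by (simp add: exp2_S_Nil)
  qed
  with step assms show "majorant (exp2 S_a1) n t \<le> 2"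
    "majorant (rquot x (exp2 S_a1)) n t \<le> 4" by blast+
qed

text \<open>For \<open>S_of Lb\<close> and \<open>S_of Lc\<close> the quotients are series that are
  bounded already, so a single step replaces the induction.\<close>

lemma bound_of_rquot:
  assumes "t \<in> {0..T}" "0 \<le> C"
    and "\<And>s x n. s \<in> {0..T} \<Longrightarrow> majorant (rquot x P) n s \<le> C"
  shows "majorant P n t \<le> \<bar>P []\<bar> + C / 8"
proof (cases n)
  case 0
  then show ?thesis using assms(2) by (simp add: truncated_0)
next
  case (Suc m)
  then show ?thesis using majorant_Suc_le_small[OF assms(1,2), of P m] assms(3) by simp
qed

lemma bound_rquot_S_b:
  assumes "t \<in> {0..T}"
  shows "majorant (rquot x (S_of Lb)) n t \<le> 1"
  by (cases x) (simp_all add: rquot_S_b truncated_zero truncated_one bound_S_a(1)[OF assms] del: S_of.simps(1,3))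

lemma bound_rquot_S_c:
  assumes "t \<in> {0..T}"
  shows "majorant (rquot x (S_of Lc)) n t \<le> 2"
  by (cases x) (simp_all add: rquot_conc_letter truncated_zero bound_exp2_S[OF assms])

lemma bound_S:
  assumes "t \<in> {0..T}"
  shows "majorant (S_of d) n t \<le> 1"
proof (cases d)
  case Lb
  then show ?thesis using bound_of_rquot[OF assms, of 1 "S_of Lb" n] bound_rquot_S_b by (simp add: S_a1_eq(1))
next
  case Lc
  then show ?thesis using bound_of_rquot[OF assms, of 2 "S_of Lc" n] bound_rquot_S_c by simp
qed (simp only: bound_S_a(1)[OF assms])

lemma Upsilon_defined_S: "t \<in> {0..T} \<Longrightarrow> Upsilon_defined u t (S_of d)"
  by (rule Upsilon_definedI[OF _ bound_S])

lemma Xi_0: "Xi u d 0 = 0"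
proof -
  have "\<And>n s x. s \<in> {0..T} \<Longrightarrow> majorant (rquot x (S_of d)) n s \<le> 2"
  proof (cases d)
    case Lb
    then show "majorant (rquot x (S_of d)) n s \<le> 2" if "s \<in> {0..T}" for n s x
      using bound_rquot_S_b[OF that, of x n] by simp
  qed (simp_all only: bound_S_a(2) bound_rquot_S_c)
  from Upsilon_integral(2)[OF bound_S this T_nonneg] show ?thesis
    unfolding Xi_def by (cases d) (simp_all add: S_a1_eq(1))
qed

lemma Xi_La:
  "ac_primitive 0 T (Xi u La) (\<lambda>s. u La s + 2 * u Lb s * Xi u La s - u Lc s * (Xi u La s)\<^sup>2)"
proof -
  have "ac_primitive 0 T (\<lambda>t. Upsilon u t (S_of La)) (\<lambda>s. \<Sum>x\<in>UNIV. u x s * Upsilon u s (rquot x (S_of La)))"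
    by (rule Upsilon_integral(1)[OF bound_S bound_S_a(2)])
  then show ?thesis
    unfolding Xi_def
  proof (rule ac_primitive_cong)
    fix s assume s: "s \<in> {0..T}"
    have "Upsilon u s (\<lambda>w. - shuffle (S_of La) (S_of La) w) = - (Upsilon u s (S_of La))\<^sup>2"
      using Upsilon_scale[of u s "-1" "shuffle (S_of La) (S_of La)"] Upsilon_shuffle[OF s bound_S_a(1)[OF s] bound_S_a(1)[OF s]]
      by (simp add: power2_eq_square del: S_of.simps)
    then show "(\<Sum>x\<in>UNIV. u x s * Upsilon u s (rquot x (S_of La))) =
        u La s + 2 * u Lb s * Upsilon u s (S_of La) - u Lc s * (Upsilon u s (S_of La))\<^sup>2"
      unfolding sum_letter rquot_S_La Upsilon_scale by simp
  qed simp
qed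

lemma Xi_Lb: "ac_primitive 0 T (Xi u Lb) (\<lambda>s. u Lb s - u Lc s * Xi u La s)"
proof -
  have "ac_primitive 0 T (\<lambda>t. Upsilon u t (S_of Lb)) (\<lambda>s. \<Sum>x\<in>UNIV. u x s * Upsilon u s (rquot x (S_of Lb)))"
    by (rule Upsilon_integral(1)[OF bound_S bound_rquot_S_b])
  then show ?thesis
    unfolding Xi_def
    by (rule ac_primitive_cong) (use Upsilon_scale[of u _ "-1" "S_of La"] in \<open>simp_all add: sum_letter rquot_S_b del: S_of.simps(1,3)\<close>)
qed

text \<open>The exponential series is not summed: by the linear equation that the right quotients of
  \<open>exp2 S_a1\<close> yield, the quotient of the two sides has derivative 0, and its value at
  time 0 is 1.\<close>

lemma Upsilon_exp2_S:
  assumes t: "t \<in> {0..T}"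
  shows "Upsilon u t (exp2 S_a1) = exp (2 * Xi u Lb t)"
proof -
  let ?e = "\<lambda>t. Upsilon u t (exp2 S_a1)" and ?b = "\<lambda>s. u Lb s - u Lc s * Xi u La s"
  have "ac_primitive 0 T ?e (\<lambda>s. \<Sum>x\<in>UNIV. u x s * Upsilon u s (rquot x (exp2 S_a1)))"
    by (rule Upsilon_integral(1)[OF bound_exp2_S])
  then have e: "ac_primitive 0 T ?e (\<lambda>s. 2 * ?b s * ?e s)"
  proof (rule ac_primitive_cong)
    fix s assume s: "s \<in> {0..T}"
    show "(\<Sum>x\<in>UNIV. u x s * Upsilon u s (rquot x (exp2 S_a1))) = 2 * ?b s * ?e s"
      unfolding sum_letter rquot_exp2_S Upsilon_scale Upsilon_shuffle[OF s bound_S_a(1)[OF s] bound_exp2_S(1)[OF s]] Xi_def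
      by (simp add: algebra_simps)
  qed simp
  have "ac_primitive 0 T (\<lambda>t. - 2 * Xi u Lb t) (\<lambda>t. - 2 * ?b t + 0 * Xi u Lb t)"
    by (rule ac_primitive_mult[OF ac_primitive_const Xi_Lb])
  from ac_primitive_mult[OF e ac_primitive_exp[OF this]]
  have prim: "ac_primitive 0 T (\<lambda>t. ?e t * exp (- 2 * Xi u Lb t)) (\<lambda>t. 0)"
    by (rule ac_primitive_cong) (simp_all add: algebra_simps)
  have e0: "?e 0 * exp (- 2 * Xi u Lb 0) = 1"
    using Upsilon_integral(2)[OF bound_exp2_S T_nonneg] exp2_S_Nil Xi_0 by simp
  have "?e t * exp (- 2 * Xi u Lb t) = 1"
    by (rule ac_primitive_unique[OF prim ac_primitive_const _ e0 t]) simp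
  then show ?thesis by (simp add: exp_minus field_simps)
qed

lemma Xi_Lc: "ac_primitive 0 T (Xi u Lc) (\<lambda>s. u Lc s * exp (2 * Xi u Lb s))"
proof -
  have "ac_primitive 0 T (\<lambda>t. Upsilon u t (S_of Lc)) (\<lambda>s. \<Sum>x\<in>UNIV. u x s * Upsilon u s (rquot x (S_of Lc)))"
    by (rule Upsilon_integral(1)[OF bound_S bound_rquot_S_c])
  moreover have "(\<lambda>t. Upsilon u t (S_of Lc)) = Xi u Lc" by (simp add: Xi_def fun_eq_iff)
  ultimately show ?thesis
    by (simp only:, elim ac_primitive_cong) (simp_all add: sum_letter rquot_conc_letter Upsilon_exp2_S)
qed

end

text \<open>\<open>Ck_on\<close> treats one direction at a time; in finite dimension this amounts to
  continuity in the operator norm, which the compactness arguments below require.\<close>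

lemma smooth_on_has_blinfun_derivative:
  fixes f :: "'e::euclidean_space \<Rightarrow> 'f::euclidean_space"
  assumes "smooth_on W f"
  obtains D where "\<And>x. x \<in> W \<Longrightarrow> (f has_derivative blinfun_apply (D x)) (at x)"
    "\<And>x. x \<in> W \<Longrightarrow> blinfun_apply (D x) = frechet_derivative f (at x)"
    "continuous_on W D"
proof
  define D where "D x = Blinfun (frechet_derivative f (at x))" for x
  have C1: "Ck_on (Suc 0) W f" using assms unfolding smooth_on_def by blast
  have der: "(f has_derivative frechet_derivative f (at x)) (at x)" if "x \<in> W" for x
    using C1 that frechet_derivative_works by auto
  show D: "blinfun_apply (D x) = frechet_derivative f (at x)" if "x \<in> W" for x
    unfolding D_def by (rule bounded_linear_Blinfun_apply[OF has_derivative_bounded_linear[OF der[OF that]]])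
  show "(f has_derivative blinfun_apply (D x)) (at x)" if "x \<in> W" for x
    using der[OF that] D[OF that] by simp
  show "continuous_on W D"
  proof (rule continuous_on_blinfun_componentwise)
    fix i :: 'e
    have "continuous_on W (\<lambda>x. frechet_derivative f (at x) i)" using C1 by simp
    then show "continuous_on W (\<lambda>x. blinfun_apply (D x) i)"
      by (rule continuous_on_eq) (simp add: D)
  qed
qed

section \<open>Local flows\<close>

text \<open>Banach's fixed point theorem for the integral equation;
  \<open>\<rho> * L \<le> 1 / 2\<close> makes the contraction factor one half.\<close>

lemma picard_global:
  fixes G :: "'e::euclidean_space \<Rightarrow> 'e"
  assumes lip: "\<And>x y. norm (G x - G y) \<le> L * norm (x - y)" and \<rho>: "0 \<le> \<rho>" "\<rho> * L \<le> 1 / 2" and "0 \<le> L"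
  obtains f where "f 0 = p"
    "\<And>s. s \<in> {-\<rho>..\<rho>} \<Longrightarrow> (f has_vector_derivative G (f s)) (at s within {-\<rho>..\<rho>})"
proof -
  have contG: "continuous_on UNIV G"
    by (rule lipschitz_on_continuous_on[of L]) (use lip \<open>0 \<le> L\<close> in \<open>auto simp: lipschitz_on_def dist_norm\<close>)
  \<comment> \<open>The integral from 0 to \<open>t\<close>, written as a difference to cover both
    signs of \<open>t\<close>.\<close>
  define J where "J x t = integral {-\<rho>..t} (\<lambda>s. G (x s)) - integral {-\<rho>..0} (\<lambda>s. G (x s))"
    for x :: "real \<Rightarrow> 'e" and t
  have cont: "continuous_on {-\<rho>..\<rho>} (\<lambda>s. G (apply_bcontfun x s))" for x :: "real \<Rightarrow>\<^sub>C 'e"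
    by (rule continuous_on_compose2[OF contG]) auto
  have J: "(J (apply_bcontfun x) has_vector_derivative G (apply_bcontfun x t)) (at t within {-\<rho>..\<rho>})"
    if "t \<in> {-\<rho>..\<rho>}" for x t
    unfolding J_def
    by (rule has_vector_derivative_diff_const[THEN iffD2] integral_has_vector_derivative[OF cont that])+
  have J0: "J x 0 = 0" for x by (simp add: J_def)
  \<comment> \<open>Bounded continuous functions are defined on the whole line, so curves are frozen
    outside the interval.\<close>
  define cl where "cl t = max (-\<rho>) (min \<rho> t)" for t
  have cl: "cl t \<in> {-\<rho>..\<rho>}" for t using \<rho> by (auto simp: cl_def)
  have cl_id: "cl t = t" if "t \<in> {-\<rho>..\<rho>}" for t using that by (auto simp: cl_def)
  have contJ: "continuous_on {-\<rho>..\<rho>} (J (apply_bcontfun x))" for x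
    using J has_vector_derivative_continuous continuous_on_eq_continuous_within by blast
  have "(\<lambda>t. p + J (apply_bcontfun x) (cl t)) \<in> bcontfun" for x
  proof -
    have "continuous_on UNIV cl" unfolding cl_def by (intro continuous_intros)
    moreover have "cl ` UNIV \<subseteq> {-\<rho>..\<rho>}" using cl by blast
    ultimately have "continuous_on UNIV (\<lambda>t. J (apply_bcontfun x) (cl t))"
      by (rule continuous_on_compose2[OF contJ])
    then have 1: "continuous_on UNIV (\<lambda>t. p + J (apply_bcontfun x) (cl t))"
      by (intro continuous_on_add continuous_on_const)
    have "bounded (J (apply_bcontfun x) ` {-\<rho>..\<rho>})"
      by (intro compact_imp_bounded compact_continuous_image contJ) simp
    moreover have "range (\<lambda>t. p + J (apply_bcontfun x) (cl t)) \<subseteq> (\<lambda>y. p + y) ` J (apply_bcontfun x) ` {-\<rho>..\<rho>}"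
      by (intro image_subsetI imageI cl)
    ultimately have "bounded (range (\<lambda>t. p + J (apply_bcontfun x) (cl t)))"
      using bounded_subset bounded_translation by blast
    with 1 show ?thesis
      by (simp add: bcontfun_def)
  qed
  then have \<Phi>: "apply_bcontfun (Bcontfun (\<lambda>t. p + J (apply_bcontfun x) (cl t))) =
      (\<lambda>t. p + J (apply_bcontfun x) (cl t))" for x
    by (rule Bcontfun_inverse)
  define \<Phi> where "\<Phi> x = Bcontfun (\<lambda>t. p + J (apply_bcontfun x) (cl t))" for x
  have "\<exists>!x. \<Phi> x = x"
  proof (rule banach_fix_type[of "1/2"])
    show "\<forall>x y. dist (\<Phi> x) (\<Phi> y) \<le> 1 / 2 * dist x y"
    proof (intro allI dist_bound)
      fix x y t
      have "norm ((J (apply_bcontfun x) (cl t) - J (apply_bcontfun y) (cl t)) -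
          (J (apply_bcontfun x) 0 - J (apply_bcontfun y) 0)) \<le> (L * dist x y) * norm (cl t - 0)"
      proof (rule differentiable_bound[of "{-\<rho>..\<rho>}" _ "\<lambda>s h. h *\<^sub>R (G (apply_bcontfun x s) - G (apply_bcontfun y s))"])
        fix s assume s: "s \<in> {-\<rho>..\<rho>}"
        show "((\<lambda>t. J (apply_bcontfun x) t - J (apply_bcontfun y) t) has_derivative
            (\<lambda>h. h *\<^sub>R (G (apply_bcontfun x s) - G (apply_bcontfun y s)))) (at s within {-\<rho>..\<rho>})"
          using has_vector_derivative_diff[OF J[OF s] J[OF s]] unfolding has_vector_derivative_def .
        have "norm (G (apply_bcontfun x s) - G (apply_bcontfun y s)) \<le> L * dist x y"
          using lip[of "apply_bcontfun x s" "apply_bcontfun y s"]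
            mult_left_mono[OF dist_bounded[of x s y] \<open>0 \<le> L\<close>] unfolding dist_norm by (rule order_trans)
        then show "onorm (\<lambda>h. h *\<^sub>R (G (apply_bcontfun x s) - G (apply_bcontfun y s))) \<le> L * dist x y"
          by (simp add: onorm_scaleR_left onorm_id)
      qed (use cl \<rho> in auto)
      also have "\<dots> \<le> (L * dist x y) * \<rho>"
        using cl[of t] \<open>0 \<le> L\<close> by (intro mult_left_mono) auto
      also have "\<dots> \<le> 1 / 2 * dist x y"
        using mult_right_mono[OF \<rho>(2), of "dist x y"] by (simp add: mult_ac)
      finally show "dist (apply_bcontfun (\<Phi> x) t) (apply_bcontfun (\<Phi> y) t) \<le> 1 / 2 * dist x y"
        unfolding \<Phi>_def \<Phi> J0 by (simp add: dist_norm)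
    qed
  qed auto
  then obtain x where x: "\<Phi> x = x" by blast
  have x': "apply_bcontfun x t = p + J (apply_bcontfun x) (cl t)" for t
    using \<Phi>[of x] x unfolding \<Phi>_def by metis
  show thesis
  proof
    show "apply_bcontfun x 0 = p"
      using x'[of 0] cl_id[of 0] \<rho> J0 by simp
    fix s assume s: "s \<in> {-\<rho>..\<rho>}"
    have "((\<lambda>t. p + J (apply_bcontfun x) t) has_vector_derivative G (apply_bcontfun x s)) (at s within {-\<rho>..\<rho>})"
      using has_vector_derivative_add[OF has_vector_derivative_const J[OF s], of p] by simp
    then show "(apply_bcontfun x has_vector_derivative G (apply_bcontfun x s)) (at s within {-\<rho>..\<rho>})"
      by (rule has_vector_derivative_transform[OF s, rotated]) (simp add: x' cl_id)
  qed
qed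

text \<open>Where the norm attains its maximum \<open>M\<close>, the estimate reads
  \<open>M \<le> norm (r 0) + M / 2 + \<eta>\<close> and absorbs its middle term. Keeping Lipschitz
  constant times duration below one half thus replaces the usual exponential by a factor 2.\<close>

lemma short_gronwall:
  fixes r :: "real \<Rightarrow> 'e::euclidean_space"
  assumes der: "\<And>s. s \<in> {0..1} \<Longrightarrow> (r has_vector_derivative r' s) (at s within {0..1})"
    and le: "\<And>s. s \<in> {0..1} \<Longrightarrow> norm (r' s) \<le> 1 / 2 * norm (r s) + \<eta>"
    and s: "s \<in> {0..1}"
  shows "norm (r s) \<le> 2 * (norm (r 0) + \<eta>)"
proof -
  have "continuous_on {0..1} r"
    using der has_vector_derivative_continuous continuous_on_eq_continuous_within by blast
  then have "continuous_on {0..1} (\<lambda>s. norm (r s))" by (intro continuous_intros)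
  then obtain m where m: "m \<in> {0..1}" "\<And>s. s \<in> {0..1} \<Longrightarrow> norm (r s) \<le> norm (r m)"
    using continuous_attains_sup[of "{0..1}" "\<lambda>s. norm (r s)"] by auto
  have K: "norm (r' s) \<le> 1 / 2 * norm (r m) + \<eta>" if "s \<in> {0..1}" for s
    using le[OF that] m(2)[OF that] by linarith
  have K0: "0 \<le> 1 / 2 * norm (r m) + \<eta>" using K[OF m(1)] norm_ge_zero order_trans by blast
  have "norm (r m - r 0) \<le> (1 / 2 * norm (r m) + \<eta>) * norm (m - 0)"
    by (rule differentiable_bound[of "{0..1}" r "\<lambda>s h. h *\<^sub>R r' s"])
      (use der K m(1) in \<open>auto simp: has_vector_derivative_def onorm_scaleR_left onorm_id\<close>)
  also have "\<dots> \<le> (1 / 2 * norm (r m) + \<eta>) * 1"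
    using K0 m(1) by (intro mult_left_mono) auto
  finally have "norm (r m - r 0) \<le> norm (r m) / 2 + \<eta>" by simp
  then have "norm (r m) \<le> 2 * (norm (r 0) + \<eta>)"
    using norm_triangle_sub[of "r m" "r 0"] by (simp add: field_simps)
  then show ?thesis using m(2)[OF s] by linarith
qed

text \<open>Differentiability with tolerance 1 gives a Lipschitz bound at the base point; the factor
  \<open>1 *\<close> matches that instance.\<close>

lemma norm_le_of_linear_approx:
  fixes v :: "'v::real_normed_vector"
  assumes "norm (x - h *\<^sub>R v) \<le> 1 * norm h"
  shows "norm x \<le> (norm v + 1) * norm h"
proof -
  have "norm x \<le> norm (x - h *\<^sub>R v) + norm (h *\<^sub>R v)"
    using norm_triangle_ineq[of "x - h *\<^sub>R v" "h *\<^sub>R v"] by simp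
  also have "\<dots> \<le> 1 * norm h + norm h * norm v"
    using assms by simp
  finally show ?thesis by (simp add: algebra_simps)
qed

section \<open>C1 fields on a ball and the dependence of endpoints on parameters\<close>

locale c1_field =
  fixes X :: "'e::euclidean_space \<Rightarrow> 'e" and DX :: "'e \<Rightarrow> 'e \<Rightarrow>\<^sub>L 'e"
    and p0 :: 'e and R B L :: real
  assumes R_pos: "0 < R"
    and DX: "\<And>y. y \<in> cball p0 R \<Longrightarrow> (X has_derivative blinfun_apply (DX y)) (at y)"
    and cont_DX: "continuous_on (cball p0 R) DX"
    and bound_X: "\<And>y. y \<in> cball p0 R \<Longrightarrow> norm (X y) \<le> B"
    and bound_DX: "\<And>y. y \<in> cball p0 R \<Longrightarrow> norm (DX y) \<le> L"
begin

lemma B_nonneg: "0 \<le> B" and L_nonneg: "0 \<le> L"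
proof -
  have "p0 \<in> cball p0 R" using R_pos by simp
  then show "0 \<le> B" "0 \<le> L" using bound_X bound_DX norm_ge_zero order_trans by blast+
qed

lemma lipschitz_X:
  assumes "x \<in> cball p0 R" "y \<in> cball p0 R"
  shows "norm (X x - X y) \<le> L * norm (x - y)"
proof (rule differentiable_bound[of "cball p0 R" X "\<lambda>y. blinfun_apply (DX y)"])
  show "onorm (blinfun_apply (DX x)) \<le> L" if "x \<in> cball p0 R" for x
    using bound_DX[OF that] by (simp add: norm_blinfun.rep_eq)
qed (use assms DX in \<open>auto intro: has_derivative_at_withinI\<close>)

text \<open>The radius \<open>d\<close> is the same for all \<open>x\<close>, by uniform continuity
  of \<open>DX\<close> on the compact ball; below, \<open>x\<close> runs through all points of a
  trajectory.\<close>

lemma linearization: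
  assumes \<epsilon>: "0 < \<epsilon>"
  obtains d where "0 < d"
    "\<And>x y. x \<in> cball p0 R \<Longrightarrow> y \<in> cball p0 R \<Longrightarrow> norm (y - x) < d \<Longrightarrow>
      norm (X y - X x - DX x (y - x)) \<le> \<epsilon> * norm (y - x)"
proof -
  have "uniformly_continuous_on (cball p0 R) DX"
    by (rule compact_uniformly_continuous[OF cont_DX]) simp
  then obtain d where d: "d > 0" "\<forall>x\<in>cball p0 R. \<forall>y\<in>cball p0 R. dist y x < d \<longrightarrow> dist (DX y) (DX x) < \<epsilon>"
    unfolding uniformly_continuous_on_def using \<epsilon> by blast
  show thesis
  proof (rule that[OF d(1)])
    fix x y assume xy: "x \<in> cball p0 R" "y \<in> cball p0 R" "norm (y - x) < d"
    let ?S = "closed_segment x y"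
    have sub: "?S \<subseteq> cball p0 R"
      using closed_segment_subset[OF xy(1,2) convex_cball] .
    have "norm (X y - X x - DX x (y - x)) \<le> norm (y - x) * \<epsilon>"
    proof (rule differentiable_bound_linearization[where S = ?S and f' = "\<lambda>y. blinfun_apply (DX y)"])
      show "x + t *\<^sub>R (y - x) \<in> ?S" if "t \<in> {0..1}" for t
        using that unfolding closed_segment_def by (auto intro!: exI[of _ t] simp: algebra_simps)
      show "(X has_derivative blinfun_apply (DX z)) (at z within ?S)" if "z \<in> ?S" for z
        by (rule has_derivative_at_withinI[OF DX]) (use that sub in blast)
      show "onorm (blinfun_apply (DX z) - blinfun_apply (DX x)) \<le> \<epsilon>" if z: "z \<in> ?S" for z
      proof -
        have "dist z x < d"
          using segment_bound(1)[OF z] xy(3) by (simp add: dist_norm)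
        then have "norm (DX z - DX x) < \<epsilon>" using d(2) xy(1) z sub by (auto simp: dist_norm)
        then show ?thesis by (simp add: norm_blinfun.rep_eq minus_blinfun.rep_eq fun_diff_def)
      qed
    qed simp
    then show "norm (X y - X x - DX x (y - x)) \<le> \<epsilon> * norm (y - x)" by (simp add: mult.commute)
  qed
qed

text \<open>The candidate \<open>V\<close> for the derivative of the endpoints is compared directly with the difference
  quotients; this avoids solving the variational equation.\<close>

lemma propagation:
  assumes t0: "t0 \<in> I"
    and f: "\<And>t s. t \<in> I \<Longrightarrow> s \<in> {0..1} \<Longrightarrow> (f t has_vector_derivative \<alpha> t *\<^sub>R X (f t s)) (at s within {0..1})"
    and fR: "\<And>t s. t \<in> I \<Longrightarrow> s \<in> {0..1} \<Longrightarrow> f t s \<in> cball p0 R"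
    and \<alpha>L: "\<And>t. t \<in> I \<Longrightarrow> \<bar>\<alpha> t\<bar> * L \<le> 1 / 2"
    and \<alpha>': "(\<alpha> has_vector_derivative \<alpha>') (at t0 within I)"
    and f0: "((\<lambda>t. f t 0) has_vector_derivative V 0) (at t0 within I)"
    and V: "\<And>s. s \<in> {0..1} \<Longrightarrow>
      (V has_vector_derivative \<alpha>' *\<^sub>R X (f t0 s) + \<alpha> t0 *\<^sub>R DX (f t0 s) (V s)) (at s within {0..1})"
  shows "((\<lambda>t. f t 1) has_vector_derivative V 1) (at t0 within I)"
  unfolding has_vector_derivative_def has_derivative_within_alt2
proof (intro conjI allI impI bounded_linear_scaleR_left)
  fix e :: real assume e: "e > 0"
  have ev\<alpha>: "\<forall>\<^sub>F t in at t0 within I. norm (\<alpha> t - \<alpha> t0 - (t - t0) *\<^sub>R \<alpha>') \<le> \<epsilon> * norm (t - t0)" if "\<epsilon> > 0" for \<epsilon>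
    using \<alpha>' that unfolding has_vector_derivative_def has_derivative_within_alt2 by blast
  have evf: "\<forall>\<^sub>F t in at t0 within I. norm (f t 0 - f t0 0 - (t - t0) *\<^sub>R V 0) \<le> \<epsilon> * norm (t - t0)" if "\<epsilon> > 0" for \<epsilon>
    using f0 that unfolding has_vector_derivative_def has_derivative_within_alt2 by blast
  have evI: "\<forall>\<^sub>F t in at t0 within I. t \<in> I" by (simp add: eventually_at_topological) blast
  have evd: "\<forall>\<^sub>F t in at t0 within I. norm (t - t0) < d" if "d > 0" for d
    using that unfolding eventually_at by (auto simp: dist_norm)
  \<comment> \<open>Lipschitz constant at \<open>t0\<close> of the trajectories as functions of
    \<open>t\<close>, uniform in \<open>s\<close>; the factor 2 is that of
    \<open>short_gronwall\<close>. This crude estimate first brings the trajectories within reach of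
    \<open>linearization\<close>.\<close>
  define C where "C = 2 * (norm (V 0) + 1 + (\<bar>\<alpha>'\<bar> + 1) * B)"
  have "0 \<le> (\<bar>\<alpha>'\<bar> + 1) * B" using B_nonneg by simp
  moreover have "0 < norm (V 0) + 1" by (simp add: add_nonneg_pos)
  ultimately have C: "C > 0" unfolding C_def by (simp add: add_pos_nonneg)
  have lip: "\<forall>\<^sub>F t in at t0 within I. \<forall>s\<in>{0..1}. norm (f t s - f t0 s) \<le> C * norm (t - t0)"
    using ev\<alpha>[OF zero_less_one] evf[OF zero_less_one] evI
  proof eventually_elim
    case (elim t)
    have a: "\<bar>\<alpha> t - \<alpha> t0\<bar> \<le> (\<bar>\<alpha>'\<bar> + 1) * norm (t - t0)"
      using norm_le_of_linear_approx[OF elim(1)] by simp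
    have b: "norm (f t 0 - f t0 0) \<le> (norm (V 0) + 1) * norm (t - t0)"
      using norm_le_of_linear_approx[OF elim(2)] by simp
    show ?case
    proof
      fix s :: real assume s: "s \<in> {0..1}"
      have "norm (f t s - f t0 s) \<le> 2 * (norm (f t 0 - f t0 0) + \<bar>\<alpha> t - \<alpha> t0\<bar> * B)"
      proof (rule short_gronwall[OF _ _ s])
        fix s :: real assume s: "s \<in> {0..1}"
        show "((\<lambda>s. f t s - f t0 s) has_vector_derivative \<alpha> t *\<^sub>R X (f t s) - \<alpha> t0 *\<^sub>R X (f t0 s)) (at s within {0..1})"
          by (intro has_vector_derivative_diff f s elim t0)
        have "\<alpha> t *\<^sub>R X (f t s) - \<alpha> t0 *\<^sub>R X (f t0 s) = \<alpha> t *\<^sub>R (X (f t s) - X (f t0 s)) + (\<alpha> t - \<alpha> t0) *\<^sub>R X (f t0 s)"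
          by (simp add: algebra_simps)
        also have "norm \<dots> \<le> \<bar>\<alpha> t\<bar> * (L * norm (f t s - f t0 s)) + \<bar>\<alpha> t - \<alpha> t0\<bar> * B"
          using elim t0 s by (intro norm_triangle_le add_mono) (auto intro!: mult_left_mono lipschitz_X bound_X fR)
        also have "\<bar>\<alpha> t\<bar> * (L * norm (f t s - f t0 s)) \<le> 1 / 2 * norm (f t s - f t0 s)"
          using mult_right_mono[OF \<alpha>L[OF elim(3)], of "norm (f t s - f t0 s)"] by (simp add: mult.assoc)
        finally show "norm (\<alpha> t *\<^sub>R X (f t s) - \<alpha> t0 *\<^sub>R X (f t0 s)) \<le>
            1 / 2 * norm (f t s - f t0 s) + \<bar>\<alpha> t - \<alpha> t0\<bar> * B" by simp
      qed
      also have "\<dots> \<le> 2 * ((norm (V 0) + 1) * norm (t - t0) + (\<bar>\<alpha>'\<bar> + 1) * norm (t - t0) * B)"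
        using a b B_nonneg by (intro mult_left_mono add_mono mult_right_mono) auto
      also have "\<dots> = C * norm (t - t0)" by (simp add: C_def algebra_simps)
      finally show "norm (f t s - f t0 s) \<le> C * norm (t - t0)" .
    qed
  qed
  \<comment> \<open>Four errors of \<open>e / 8\<close> each: linearising \<open>X\<close>,
    linearising \<open>\<alpha>\<close>, the initial point, and the product of two small increments.
    \<open>short_gronwall\<close> doubles their sum to \<open>e\<close>.\<close>
  define \<epsilon>1 \<epsilon>2 \<epsilon>3 d2 where "\<epsilon>1 = e / (8 * (\<bar>\<alpha> t0\<bar> * C + 1))" "\<epsilon>2 = e / (8 * (B + 1))" "\<epsilon>3 = e / 8"
    "d2 = e / (8 * (\<bar>\<alpha>'\<bar> * (L * C) + 1))"
  have "\<bar>\<alpha> t0\<bar> * C + 1 > 0" "\<bar>\<alpha>'\<bar> * (L * C) + 1 > 0" "B + 1 > 0"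
    using C L_nonneg B_nonneg by (auto intro!: add_nonneg_pos)
  then have pos: "\<epsilon>1 > 0" "\<epsilon>2 > 0" "\<epsilon>3 > 0" "d2 > 0"
    and le: "\<epsilon>1 * (\<bar>\<alpha> t0\<bar> * C) \<le> e / 8" "\<epsilon>2 * B \<le> e / 8" "d2 * (\<bar>\<alpha>'\<bar> * (L * C)) \<le> e / 8"
    using e C L_nonneg B_nonneg unfolding \<epsilon>1_\<epsilon>2_\<epsilon>3_d2_def by (auto simp: field_simps)
  obtain d1 where d1: "d1 > 0" "\<And>x y. x \<in> cball p0 R \<Longrightarrow> y \<in> cball p0 R \<Longrightarrow> norm (y - x) < d1 \<Longrightarrow>
      norm (X y - X x - DX x (y - x)) \<le> \<epsilon>1 * norm (y - x)"
    using linearization[OF pos(1)] by blast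
  have "d1 / C > 0" using d1 C by simp
  from evd[OF this] evd[OF pos(4)] ev\<alpha>[OF pos(2)] evf[OF pos(3)] lip evI
  show "\<forall>\<^sub>F t in at t0 within I. norm (f t 1 - f t0 1 - (t - t0) *\<^sub>R V 1) \<le> e * norm (t - t0)"
  proof eventually_elim
    case (elim t)
    define h where "h = t - t0"
    define r where "r s = f t s - f t0 s - h *\<^sub>R V s" for s
    define r' where "r' s = \<alpha> t *\<^sub>R X (f t s) - \<alpha> t0 *\<^sub>R X (f t0 s) -
        h *\<^sub>R (\<alpha>' *\<^sub>R X (f t0 s) + \<alpha> t0 *\<^sub>R DX (f t0 s) (V s))" for s
    define \<eta> where "\<eta> = (\<epsilon>2 * B + d2 * (\<bar>\<alpha>'\<bar> * (L * C)) + \<epsilon>1 * (\<bar>\<alpha> t0\<bar> * C)) * \<bar>h\<bar>"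
    have "norm (r 1) \<le> 2 * (norm (r 0) + \<eta>)"
    proof (rule short_gronwall)
      fix s :: real assume s: "s \<in> {0..1}"
      show "(r has_vector_derivative r' s) (at s within {0..1})"
        unfolding r_def[abs_def] r'_def
        by (intro has_vector_derivative_diff f[OF elim(6) s] f[OF t0 s]
            bounded_linear.has_vector_derivative[OF bounded_linear_scaleR_right] V[OF s])
      let ?x = "f t0 s" and ?y = "f t s"
      have xy: "?x \<in> cball p0 R" "?y \<in> cball p0 R" using fR elim t0 s by auto
      have yx: "norm (?y - ?x) \<le> C * \<bar>h\<bar>" using elim(5) s by (simp add: h_def)
      have "norm (t - t0) * C < d1" using elim(1) C by (simp add: field_simps)
      then have "norm (?y - ?x) < d1" using yx by (simp add: h_def mult.commute)
      from d1(2)[OF xy this] have lin: "norm (X ?y - X ?x - DX ?x (?y - ?x)) \<le> \<epsilon>1 * (C * \<bar>h\<bar>)"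
        using mult_left_mono[OF yx less_imp_le[OF pos(1)]] by linarith
      \<comment> \<open>Arranged so that the remainder \<open>r\<close> itself occurs only in the
        last summand, linearly; the other three are \<open>h\<close> times a small factor.\<close>
      have eq: "r' s = ((\<alpha> t - \<alpha> t0 - h * \<alpha>') *\<^sub>R X ?y + (h * \<alpha>') *\<^sub>R (X ?y - X ?x)) +
          (\<alpha> t0 *\<^sub>R (X ?y - X ?x - DX ?x (?y - ?x)) + \<alpha> t0 *\<^sub>R DX ?x (r s))"
        by (simp add: r'_def r_def blinfun.diff_right blinfun.add_right blinfun.scaleR_right algebra_simps)
      have 1: "norm ((\<alpha> t - \<alpha> t0 - h * \<alpha>') *\<^sub>R X ?y) \<le> (\<epsilon>2 * B) * \<bar>h\<bar>"
      proof -
        have "norm ((\<alpha> t - \<alpha> t0 - h * \<alpha>') *\<^sub>R X ?y) \<le> (\<epsilon>2 * \<bar>h\<bar>) * B"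
        proof -
          have "\<bar>\<alpha> t - \<alpha> t0 - h * \<alpha>'\<bar> \<le> \<epsilon>2 * \<bar>h\<bar>" using elim(3) by (simp add: h_def)
          from mult_mono[OF this bound_X[OF xy(2)]] pos show ?thesis by simp
        qed
        then show ?thesis by (simp add: mult_ac)
      qed
      have 2: "norm ((h * \<alpha>') *\<^sub>R (X ?y - X ?x)) \<le> (d2 * (\<bar>\<alpha>'\<bar> * (L * C))) * \<bar>h\<bar>"
      proof -
        have "norm (X ?y - X ?x) \<le> L * (C * \<bar>h\<bar>)"
          using lipschitz_X[OF xy(2,1)] mult_left_mono[OF yx L_nonneg] by linarith
        then have "norm ((h * \<alpha>') *\<^sub>R (X ?y - X ?x)) \<le> (\<bar>h\<bar> * \<bar>\<alpha>'\<bar>) * (L * (C * \<bar>h\<bar>))"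
          by (simp add: abs_mult mult_left_mono)
        also have "\<dots> \<le> (d2 * \<bar>\<alpha>'\<bar>) * (L * (C * \<bar>h\<bar>))"
          using elim(2) L_nonneg C by (intro mult_right_mono) (auto simp: h_def)
        finally show ?thesis by (simp add: mult_ac)
      qed
      have 3: "norm (\<alpha> t0 *\<^sub>R (X ?y - X ?x - DX ?x (?y - ?x))) \<le> (\<epsilon>1 * (\<bar>\<alpha> t0\<bar> * C)) * \<bar>h\<bar>"
        using mult_left_mono[OF lin abs_ge_zero[of "\<alpha> t0"]] by (simp add: mult_ac)
      have 4: "norm (\<alpha> t0 *\<^sub>R DX ?x (r s)) \<le> 1 / 2 * norm (r s)"
      proof -
        have "norm (DX ?x (r s)) \<le> L * norm (r s)"
          using norm_blinfun[of "DX ?x" "r s"] mult_right_mono[OF bound_DX[OF xy(1)] norm_ge_zero[of "r s"]] by linarith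
        then have "norm (\<alpha> t0 *\<^sub>R DX ?x (r s)) \<le> \<bar>\<alpha> t0\<bar> * L * norm (r s)"
          by (simp add: mult_left_mono mult.assoc)
        also have "\<dots> \<le> 1 / 2 * norm (r s)" by (rule mult_right_mono[OF \<alpha>L[OF t0]]) simp
        finally show ?thesis .
      qed
      have "norm (r' s) \<le> ((\<epsilon>2 * B) * \<bar>h\<bar> + (d2 * (\<bar>\<alpha>'\<bar> * (L * C))) * \<bar>h\<bar>) +
          ((\<epsilon>1 * (\<bar>\<alpha> t0\<bar> * C)) * \<bar>h\<bar> + 1 / 2 * norm (r s))"
        unfolding eq by (intro norm_triangle_le add_mono 1 2 3 4)
      then show "norm (r' s) \<le> 1 / 2 * norm (r s) + \<eta>"
        by (simp add: \<eta>_def algebra_simps)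
    qed simp
    also have "norm (r 0) \<le> e / 8 * \<bar>h\<bar>"
      using elim(4) by (simp add: r_def h_def \<epsilon>1_\<epsilon>2_\<epsilon>3_d2_def)
    also have "\<eta> \<le> (e / 8 + e / 8 + e / 8) * \<bar>h\<bar>"
      unfolding \<eta>_def using le by (intro mult_right_mono add_mono) auto
    finally have "norm (r 1) \<le> e * \<bar>h\<bar>" by (simp add: algebra_simps)
    then show ?case by (simp add: r_def h_def)
  qed
qed

end

context c1_field
begin

text \<open>The projection onto a closed convex set is nonexpansive, so the field composed with it
  is Lipschitz everywhere with the same \<open>L\<close>.\<close>

lemma ex_flow:
  assumes "0 \<le> \<rho>" "\<rho> * L \<le> 1 / 2"
  shows "\<exists>fl. \<forall>p. fl p 0 = p \<and> (\<forall>s\<in>{-\<rho>..\<rho>}.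
    (fl p has_vector_derivative X (closest_point (cball p0 R) (fl p s))) (at s within {-\<rho>..\<rho>}))"
proof -
  have ne: "cball p0 R \<noteq> {}" using R_pos by simp
  have lip: "norm (X (closest_point (cball p0 R) x) - X (closest_point (cball p0 R) y)) \<le> L * norm (x - y)" for x y
  proof -
    have "norm (X (closest_point (cball p0 R) x) - X (closest_point (cball p0 R) y)) \<le>
        L * norm (closest_point (cball p0 R) x - closest_point (cball p0 R) y)"
      by (intro lipschitz_X closest_point_in_set closed_cball ne)
    also have "\<dots> \<le> L * norm (x - y)"
      using closest_point_lipschitz[OF convex_cball closed_cball ne, of x y] L_nonneg
      by (intro mult_left_mono) (simp_all add: dist_norm)
    finally show ?thesis .
  qed
  have "\<exists>f. f 0 = p \<and> (\<forall>s\<in>{-\<rho>..\<rho>}.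
    (f has_vector_derivative X (closest_point (cball p0 R) (f s))) (at s within {-\<rho>..\<rho>}))" for p
    by (rule picard_global[OF lip assms L_nonneg, of p]) blast
  then show ?thesis by (intro choice allI)
qed

end

text \<open>Extending the field to the whole space by the projection onto the ball makes it globally
  Lipschitz; for curves that stay in the ball this changes nothing.\<close>

locale local_flow = c1_field X DX p0 R B L
  for X :: "'e::euclidean_space \<Rightarrow> 'e" and DX :: "'e \<Rightarrow> 'e \<Rightarrow>\<^sub>L 'e" and p0 R B L +
  fixes \<rho> :: real and fl :: "'e \<Rightarrow> real \<Rightarrow> 'e"
  assumes \<rho>: "0 < \<rho>" "\<rho> * L \<le> 1 / 2"
    and fl_0: "fl p 0 = p"
    and fl_der: "s \<in> {-\<rho>..\<rho>} \<Longrightarrow>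
      (fl p has_vector_derivative X (closest_point (cball p0 R) (fl p s))) (at s within {-\<rho>..\<rho>})"
begin

lemma fl_lipschitz_time:
  assumes "s \<in> {-\<rho>..\<rho>}" "s' \<in> {-\<rho>..\<rho>}"
  shows "norm (fl p s - fl p s') \<le> B * \<bar>s - s'\<bar>"
proof -
  have "closest_point (cball p0 R) y \<in> cball p0 R" for y
    using R_pos by (intro closest_point_in_set) auto
  then have "norm (fl p s - fl p s') \<le> B * norm (s - s')"
    using assms fl_der bound_X
    by (intro differentiable_bound[of "{-\<rho>..\<rho>}" "fl p" "\<lambda>s h. h *\<^sub>R X (closest_point (cball p0 R) (fl p s))"])
      (auto simp: has_vector_derivative_def onorm_scaleR_left onorm_id simp del: mem_cball)
  then show ?thesis by simp
qed

text \<open>The extended field is bounded by \<open>B\<close> everywhere, so a trajectory travels at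
  most \<open>B * \<rho>\<close> even before it is known to stay in the ball of radius
  \<open>R\<close>.\<close>

lemma fl_in_cball:
  assumes "p \<in> cball p0 r" "s \<in> {-\<rho>..\<rho>}"
  shows "fl p s \<in> cball p0 (r + B * \<rho>)"
proof -
  have "norm (fl p s - fl p 0) \<le> B * \<bar>s - 0\<bar>"
    using assms(2) \<rho> by (intro fl_lipschitz_time) auto
  also have "\<dots> \<le> B * \<rho>" using assms(2) B_nonneg by (intro mult_left_mono) auto
  finally have "dist p (fl p s) \<le> B * \<rho>" by (simp add: fl_0 dist_norm norm_minus_commute)
  moreover have "dist p0 p \<le> r" using assms(1) by simp
  ultimately show ?thesis using dist_triangle[of p0 "fl p s" p] by simp
qed

lemma fl_ode:
  assumes "p \<in> cball p0 r" "r + B * \<rho> \<le> R" "s \<in> {-\<rho>..\<rho>}"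
  shows "(fl p has_vector_derivative X (fl p s)) (at s within {-\<rho>..\<rho>})"
proof -
  have "fl p s \<in> cball p0 R" using fl_in_cball[OF assms(1,3)] assms(2) by simp
  then show ?thesis using fl_der[OF assms(3), of p] closest_point_self by metis
qed

text \<open>Rescaling time puts trajectories of different durations \<open>\<alpha>\<close> on a
  common interval, as \<open>propagation\<close> demands; the duration becomes a factor of the
  field.\<close>

lemma fl_scaled:
  assumes "p \<in> cball p0 r" "r + B * \<rho> \<le> R" "\<alpha> \<in> {-\<rho>..\<rho>}" "s \<in> {0..1}"
  shows "fl p (s * \<alpha>) \<in> cball p0 R"
    "((\<lambda>s. fl p (s * \<alpha>)) has_vector_derivative \<alpha> *\<^sub>R X (fl p (s * \<alpha>))) (at s within {0..1})"
proof -
  have *: "s * \<alpha> \<in> {-\<rho>..\<rho>}" if "s \<in> {0..1}" for s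
  proof -
    have "\<bar>s * \<alpha>\<bar> \<le> 1 * \<rho>" unfolding abs_mult using that assms(3) by (intro mult_mono) auto
    then show ?thesis by (simp add: abs_le_iff)
  qed
  show "fl p (s * \<alpha>) \<in> cball p0 R"
    using fl_in_cball[OF assms(1) *[OF assms(4)]] assms(2) by simp
  have "(fl p has_vector_derivative X (fl p (s * \<alpha>))) (at (s * \<alpha>) within (\<lambda>s. s * \<alpha>) ` {0..1})"
    by (rule has_vector_derivative_within_subset[OF fl_ode[OF assms(1,2) *[OF assms(4)]]]) (use * in blast)
  moreover have "((\<lambda>s. s * \<alpha>) has_vector_derivative \<alpha>) (at s within {0..1})"
    by (auto intro!: derivative_eq_intros simp: has_real_derivative_iff_has_vector_derivative[symmetric])
  ultimately show "((\<lambda>s. fl p (s * \<alpha>)) has_vector_derivative \<alpha> *\<^sub>R X (fl p (s * \<alpha>))) (at s within {0..1})"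
    using vector_diff_chain_within[of "\<lambda>s. s * \<alpha>" \<alpha> s "{0..1}" "fl p"] by (simp add: comp_def)
qed

lemma scale_small: "\<alpha> \<in> {-\<rho>..\<rho>} \<Longrightarrow> \<bar>\<alpha>\<bar> * L \<le> 1 / 2"
  using mult_right_mono[OF _ L_nonneg, of "\<bar>\<alpha>\<bar>" \<rho>] \<rho>(2) by (auto simp: abs_le_iff)

lemma fl_lipschitz:
  assumes "p \<in> cball p0 r" "q \<in> cball p0 r" "r + B * \<rho> \<le> R" "s \<in> {-\<rho>..\<rho>}" "s' \<in> {-\<rho>..\<rho>}"
  shows "norm (fl p s - fl q s') \<le> 2 * norm (p - q) + B * \<bar>s - s'\<bar>"
proof -
  have "norm (fl p (1 * s) - fl q (1 * s)) \<le> 2 * (norm (fl p (0 * s) - fl q (0 * s)) + 0)"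
  proof (rule short_gronwall[where s = 1 and r = "\<lambda>\<tau>. fl p (\<tau> * s) - fl q (\<tau> * s)"])
    fix \<tau> :: real assume \<tau>: "\<tau> \<in> {0..1}"
    show "((\<lambda>\<tau>. fl p (\<tau> * s) - fl q (\<tau> * s)) has_vector_derivative s *\<^sub>R X (fl p (\<tau> * s)) - s *\<^sub>R X (fl q (\<tau> * s)))
        (at \<tau> within {0..1})"
      using assms \<tau> by (intro has_vector_derivative_diff fl_scaled(2))
    have "norm (s *\<^sub>R X (fl p (\<tau> * s)) - s *\<^sub>R X (fl q (\<tau> * s))) = \<bar>s\<bar> * norm (X (fl p (\<tau> * s)) - X (fl q (\<tau> * s)))"
      by (simp flip: scaleR_diff_right)
    also have "\<dots> \<le> \<bar>s\<bar> * (L * norm (fl p (\<tau> * s) - fl q (\<tau> * s)))"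
      by (rule mult_left_mono[OF lipschitz_X[OF fl_scaled(1)[OF assms(1,3,4) \<tau>] fl_scaled(1)[OF assms(2,3,4) \<tau>]]]) simp
    also have "\<dots> \<le> 1 / 2 * norm (fl p (\<tau> * s) - fl q (\<tau> * s))"
      using mult_right_mono[OF scale_small[OF assms(4)] norm_ge_zero[of "fl p (\<tau> * s) - fl q (\<tau> * s)"]]
      by (simp add: mult.assoc)
    finally show "norm (s *\<^sub>R X (fl p (\<tau> * s)) - s *\<^sub>R X (fl q (\<tau> * s))) \<le>
        1 / 2 * norm (fl p (\<tau> * s) - fl q (\<tau> * s)) + 0" by simp
  qed simp
  then have "norm (fl p s - fl q s) \<le> 2 * norm (p - q)" by (simp add: fl_0)
  then show ?thesis
    using fl_lipschitz_time[OF assms(4,5), of q] norm_triangle_ineq[of "fl p s - fl q s" "fl q s - fl q s'"] by simp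
qed

text \<open>Starting point and duration of the flow both move. The solution \<open>V\<close> of the
  linearised equation along the trajectory is a parameter; for the three fields below it is
  explicit.\<close>

lemma stage:
  assumes t0: "t0 \<in> I"
    and q: "\<And>t. t \<in> I \<Longrightarrow> q t \<in> cball p0 r" and r: "r + B * \<rho> \<le> R"
    and \<alpha>: "\<And>t. t \<in> I \<Longrightarrow> \<alpha> t \<in> {-\<rho>..\<rho>}"
    and \<alpha>': "(\<alpha> has_vector_derivative \<alpha>') (at t0 within I)"
    and q': "(q has_vector_derivative V 0) (at t0 within I)"
    and V: "\<And>s. s \<in> {0..1} \<Longrightarrow> (V has_vector_derivative \<alpha>' *\<^sub>R X (fl (q t0) (s * \<alpha> t0)) +
        \<alpha> t0 *\<^sub>R DX (fl (q t0) (s * \<alpha> t0)) (V s)) (at s within {0..1})"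
  shows "((\<lambda>t. fl (q t) (\<alpha> t)) has_vector_derivative V 1) (at t0 within I)"
proof -
  have "((\<lambda>t. fl (q t) (1 * \<alpha> t)) has_vector_derivative V 1) (at t0 within I)"
  proof (rule propagation[where f = "\<lambda>t s. fl (q t) (s * \<alpha> t)", OF t0 _ _ _ \<alpha>'])
    show "((\<lambda>s. fl (q t) (s * \<alpha> t)) has_vector_derivative \<alpha> t *\<^sub>R X (fl (q t) (s * \<alpha> t))) (at s within {0..1})"
      if "t \<in> I" "s \<in> {0..1}" for t s
      by (rule fl_scaled(2)[OF q[OF that(1)] r \<alpha>[OF that(1)] that(2)])
    show "fl (q t) (s * \<alpha> t) \<in> cball p0 R" if "t \<in> I" "s \<in> {0..1}" for t s
      by (rule fl_scaled(1)[OF q[OF that(1)] r \<alpha>[OF that(1)] that(2)])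
    show "\<bar>\<alpha> t\<bar> * L \<le> 1 / 2" if "t \<in> I" for t
      by (rule scale_small[OF \<alpha>[OF that]])
    show "((\<lambda>t. fl (q t) (0 * \<alpha> t)) has_vector_derivative V 0) (at t0 within I)"
      using q' by (simp add: fl_0)
  qed (rule V)
  then show ?thesis by simp
qed

end

section \<open>The product of the three flows in a chart\<close>

lemma has_vector_derivative_along_flow:
  assumes "(f has_vector_derivative k *\<^sub>R v) (at s within S)" "(X has_derivative blinfun_apply D) (at (f s))"
  shows "((\<lambda>s. X (f s)) has_vector_derivative k *\<^sub>R D v) (at s within S)"
  using vector_derivative_diff_chain_within[OF assms(1) has_derivative_at_withinI[OF assms(2)]]
  by (simp add: comp_def blinfun.scaleR_right)

text \<open>\<open>radius\<close> leaves room for three successive flows, each moving a point by at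
  most \<open>B * \<rho>\<close>.\<close>

locale sl2_flows =
  fixes X :: "letter \<Rightarrow> 'e::euclidean_space \<Rightarrow> 'e" and DX :: "letter \<Rightarrow> 'e \<Rightarrow> 'e \<Rightarrow>\<^sub>L 'e"
    and p0 :: 'e and R B L \<rho> :: real and fl :: "letter \<Rightarrow> 'e \<Rightarrow> real \<Rightarrow> 'e"
  assumes fields: "\<And>d. local_flow (X d) (DX d) p0 R B L \<rho> (fl d)"
    and bracket_ab: "\<And>y. y \<in> cball p0 R \<Longrightarrow> DX Lb y (X La y) - DX La y (X Lb y) = 2 *\<^sub>R X La y"
    and bracket_ac: "\<And>y. y \<in> cball p0 R \<Longrightarrow> DX Lc y (X La y) - DX La y (X Lc y) = - X Lb y"
    and bracket_bc: "\<And>y. y \<in> cball p0 R \<Longrightarrow> DX Lc y (X Lb y) - DX Lb y (X Lc y) = 2 *\<^sub>R X Lc y"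
    and radius: "3 * (B * \<rho>) \<le> R"
begin

lemma c1: "c1_field (X d) (DX d) p0 R B L"
  using fields[of d] by (simp add: local_flow_def)

lemma B\<rho>: "0 \<le> B * \<rho>"
  using c1_field.B_nonneg[OF c1] local_flow.\<rho>(1)[OF fields] by simp

lemma along:
  assumes "p \<in> cball p0 r" "r + B * \<rho> \<le> R" "k \<in> {-\<rho>..\<rho>}" "s \<in> {0..1}"
  shows "((\<lambda>s. X d (fl e p (s * k))) has_vector_derivative k *\<^sub>R DX d (fl e p (s * k)) (X e (fl e p (s * k)))) (at s within {0..1})"
  by (rule has_vector_derivative_along_flow[OF local_flow.fl_scaled(2)[OF fields assms]
        c1_field.DX[OF c1 local_flow.fl_scaled(1)[OF fields assms]]])

text \<open>A field is invariant under its own flow; the starting point being fixed, only the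
  variation of the duration contributes.\<close>

lemma stage_c:
  assumes t0: "t0 \<in> I"
    and \<gamma>: "\<And>t. t \<in> I \<Longrightarrow> \<gamma> t \<in> {-\<rho>..\<rho>}" "(\<gamma> has_vector_derivative c) (at t0 within I)"
  shows "((\<lambda>t. fl Lc p0 (\<gamma> t)) has_vector_derivative c *\<^sub>R X Lc (fl Lc p0 (\<gamma> t0))) (at t0 within I)"
proof -
  define V where "V s = (s * c) *\<^sub>R X Lc (fl Lc p0 (s * \<gamma> t0))" for s
  have p: "p0 \<in> cball p0 0" and r: "0 + B * \<rho> \<le> R" using radius B\<rho> by auto
  have "((\<lambda>t. fl Lc p0 (\<gamma> t)) has_vector_derivative V 1) (at t0 within I)"
  proof (rule local_flow.stage[OF fields t0 p r \<gamma>])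
    fix s :: real assume s: "s \<in> {0..1}"
    let ?y = "fl Lc p0 (s * \<gamma> t0)"
    have "((\<lambda>s. s * c) has_real_derivative c) (at s within {0..1})"
      by (auto intro!: derivative_eq_intros)
    from has_vector_derivative_scaleR[OF this along[OF p r \<gamma>(1)[OF t0] s, of Lc Lc]]
    show "(V has_vector_derivative c *\<^sub>R X Lc ?y + \<gamma> t0 *\<^sub>R DX Lc ?y (V s)) (at s within {0..1})"
      unfolding V_def[abs_def] by (simp add: blinfun.scaleR_right algebra_simps)
  qed (simp_all add: V_def)
  then show ?thesis by (simp add: V_def)
qed

text \<open>For a coefficient \<open>k s\<close> at \<open>X Lc\<close> in \<open>V\<close>, the
  linearised equation and the relation [X_b, X_c] = 2 X_c leave
  \<open>k' = - 2 * \<beta> t0 * k\<close>; hence the exponential.\<close>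

lemma stage_b:
  assumes t0: "t0 \<in> I"
    and q: "\<And>t. t \<in> I \<Longrightarrow> q t \<in> cball p0 r" and r: "r + B * \<rho> \<le> R"
    and \<beta>: "\<And>t. t \<in> I \<Longrightarrow> \<beta> t \<in> {-\<rho>..\<rho>}" "(\<beta> has_vector_derivative b) (at t0 within I)"
    and q': "(q has_vector_derivative c *\<^sub>R X Lc (q t0)) (at t0 within I)"
  shows "((\<lambda>t. fl Lb (q t) (\<beta> t)) has_vector_derivative
    b *\<^sub>R X Lb (fl Lb (q t0) (\<beta> t0)) + (c * exp (- 2 * \<beta> t0)) *\<^sub>R X Lc (fl Lb (q t0) (\<beta> t0))) (at t0 within I)"
proof -
  let ?f = "\<lambda>s. fl Lb (q t0) (s * \<beta> t0)"
  define V where "V s = (s * b) *\<^sub>R X Lb (?f s) + (c * exp (- 2 * s * \<beta> t0)) *\<^sub>R X Lc (?f s)" for s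
  have "((\<lambda>t. fl Lb (q t) (\<beta> t)) has_vector_derivative V 1) (at t0 within I)"
  proof (rule local_flow.stage[OF fields t0 q r \<beta>])
    show "(q has_vector_derivative V 0) (at t0 within I)"
      using q' by (simp add: V_def local_flow.fl_0[OF fields])
    fix s :: real assume s: "s \<in> {0..1}"
    let ?y = "?f s"
    have y: "?y \<in> cball p0 R" by (rule local_flow.fl_scaled(1)[OF fields q[OF t0] r \<beta>(1)[OF t0] s])
    have 1: "((\<lambda>s. s * b) has_real_derivative b) (at s within {0..1})"
      by (auto intro!: derivative_eq_intros)
    have 2: "((\<lambda>s. c * exp (- 2 * s * \<beta> t0)) has_real_derivative - 2 * \<beta> t0 * (c * exp (- 2 * s * \<beta> t0))) (at s within {0..1})"
      by (auto intro!: derivative_eq_intros)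
    have br: "DX Lc ?y (X Lb ?y) = DX Lb ?y (X Lc ?y) + 2 *\<^sub>R X Lc ?y"
      using bracket_bc[OF y] by (simp add: algebra_simps)
    note al = along[OF q[OF t0] r \<beta>(1)[OF t0] s, of _ Lb]
    show "(V has_vector_derivative b *\<^sub>R X Lb ?y + \<beta> t0 *\<^sub>R DX Lb ?y (V s)) (at s within {0..1})"
      using has_vector_derivative_add[OF has_vector_derivative_scaleR[OF 1 al[of Lb]] has_vector_derivative_scaleR[OF 2 al[of Lc]]]
      unfolding V_def[abs_def] br by (simp add: blinfun.scaleR_right blinfun.add_right algebra_simps)
  qed
  then show ?thesis by (simp add: V_def)
qed

text \<open>The bracket with X_a sends X_c to -X_b, X_b to 2 X_a and X_a to 0. Hence the
  coefficients of \<open>V\<close> are polynomials in \<open>s\<close>, of degree at most 0, 1 and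
  2, which the linearised equation determines one after the other, starting with that of
  X_c.\<close>

lemma stage_a:
  assumes t0: "t0 \<in> I"
    and q: "\<And>t. t \<in> I \<Longrightarrow> q t \<in> cball p0 r" and r: "r + B * \<rho> \<le> R"
    and \<alpha>: "\<And>t. t \<in> I \<Longrightarrow> \<alpha> t \<in> {-\<rho>..\<rho>}" "(\<alpha> has_vector_derivative a) (at t0 within I)"
    and q': "(q has_vector_derivative b *\<^sub>R X Lb (q t0) + c *\<^sub>R X Lc (q t0)) (at t0 within I)"
  shows "((\<lambda>t. fl La (q t) (\<alpha> t)) has_vector_derivative
    (a - 2 * \<alpha> t0 * b - (\<alpha> t0)\<^sup>2 * c) *\<^sub>R X La (fl La (q t0) (\<alpha> t0)) +
    ((b + \<alpha> t0 * c) *\<^sub>R X Lb (fl La (q t0) (\<alpha> t0)) + c *\<^sub>R X Lc (fl La (q t0) (\<alpha> t0)))) (at t0 within I)"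
proof -
  let ?f = "\<lambda>s. fl La (q t0) (s * \<alpha> t0)"
  define V where "V s = (s * a - 2 * \<alpha> t0 * b * s - (\<alpha> t0)\<^sup>2 * c * s\<^sup>2) *\<^sub>R X La (?f s) +
    ((b + s * \<alpha> t0 * c) *\<^sub>R X Lb (?f s) + c *\<^sub>R X Lc (?f s))" for s
  have "((\<lambda>t. fl La (q t) (\<alpha> t)) has_vector_derivative V 1) (at t0 within I)"
  proof (rule local_flow.stage[OF fields t0 q r \<alpha>])
    show "(q has_vector_derivative V 0) (at t0 within I)"
      using q' by (simp add: V_def local_flow.fl_0[OF fields])
    fix s :: real assume s: "s \<in> {0..1}"
    let ?y = "?f s"
    have y: "?y \<in> cball p0 R" by (rule local_flow.fl_scaled(1)[OF fields q[OF t0] r \<alpha>(1)[OF t0] s])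
    have 1: "((\<lambda>s. s * a - 2 * \<alpha> t0 * b * s - (\<alpha> t0)\<^sup>2 * c * s\<^sup>2) has_real_derivative
        a - 2 * \<alpha> t0 * b - 2 * (\<alpha> t0)\<^sup>2 * c * s) (at s within {0..1})"
      by (auto intro!: derivative_eq_intros)
    have 2: "((\<lambda>s. b + s * \<alpha> t0 * c) has_real_derivative \<alpha> t0 * c) (at s within {0..1})"
      by (auto intro!: derivative_eq_intros)
    have 3: "((\<lambda>s. c) has_real_derivative 0) (at s within {0..1})" by simp
    have br: "DX Lb ?y (X La ?y) = DX La ?y (X Lb ?y) + 2 *\<^sub>R X La ?y"
      "DX Lc ?y (X La ?y) = DX La ?y (X Lc ?y) - X Lb ?y"
      using bracket_ab[OF y] bracket_ac[OF y] by (simp_all add: algebra_simps)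
    note al = along[OF q[OF t0] r \<alpha>(1)[OF t0] s, of _ La]
    show "(V has_vector_derivative a *\<^sub>R X La ?y + \<alpha> t0 *\<^sub>R DX La ?y (V s)) (at s within {0..1})"
      using has_vector_derivative_add[OF has_vector_derivative_scaleR[OF 1 al[of La]]
          has_vector_derivative_add[OF has_vector_derivative_scaleR[OF 2 al[of Lb]] has_vector_derivative_scaleR[OF 3 al[of Lc]]]]
      unfolding V_def[abs_def] br
      by (elim has_vector_derivative_eq_rhs)
        (simp add: blinfun.scaleR_right blinfun.add_right blinfun.diff_right algebra_simps power2_eq_square)
  qed
  then show ?thesis by (simp add: V_def)
qed

definition prod_flow :: "real \<Rightarrow> real \<Rightarrow> real \<Rightarrow> 'e" where
  "prod_flow \<alpha> \<beta> \<gamma> = fl La (fl Lb (fl Lc p0 \<gamma>) \<beta>) \<alpha>"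

lemma fl_c_in: "\<gamma> \<in> {-\<rho>..\<rho>} \<Longrightarrow> fl Lc p0 \<gamma> \<in> cball p0 (B * \<rho>)"
  using local_flow.fl_in_cball[OF fields, of p0 0 \<gamma> Lc] by simp

lemma fl_bc_in: "\<beta> \<in> {-\<rho>..\<rho>} \<Longrightarrow> \<gamma> \<in> {-\<rho>..\<rho>} \<Longrightarrow> fl Lb (fl Lc p0 \<gamma>) \<beta> \<in> cball p0 (B * \<rho> + B * \<rho>)"
  by (rule local_flow.fl_in_cball[OF fields fl_c_in])

lemma prod_flow_in:
  assumes "\<alpha> \<in> {-\<rho>..\<rho>}" "\<beta> \<in> {-\<rho>..\<rho>}" "\<gamma> \<in> {-\<rho>..\<rho>}"
  shows "prod_flow \<alpha> \<beta> \<gamma> \<in> cball p0 R"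
proof -
  have "fl La (fl Lb (fl Lc p0 \<gamma>) \<beta>) \<alpha> \<in> cball p0 (B * \<rho> + B * \<rho> + B * \<rho>)"
    by (rule local_flow.fl_in_cball[OF fields fl_bc_in[OF assms(2,3)] assms(1)])
  then have "dist p0 (prod_flow \<alpha> \<beta> \<gamma>) \<le> 3 * (B * \<rho>)" by (simp add: prod_flow_def)
  also have "\<dots> \<le> R" by (rule radius)
  finally show ?thesis by simp
qed

text \<open>The derivatives prescribed for the exponents undo the transport by the later flows: the
  exponentials cancel in the stage of \<open>X Lb\<close>, and the corrections that contain
  \<open>\<alpha> t0\<close> cancel in the stage of \<open>X La\<close>.\<close>

lemma has_vector_derivative_prod_flow:
  assumes t0: "t0 \<in> I"
    and in_I: "\<And>t. t \<in> I \<Longrightarrow> \<alpha> t \<in> {-\<rho>..\<rho>}" "\<And>t. t \<in> I \<Longrightarrow> \<beta> t \<in> {-\<rho>..\<rho>}" "\<And>t. t \<in> I \<Longrightarrow> \<gamma> t \<in> {-\<rho>..\<rho>}"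
    and der: "(\<alpha> has_vector_derivative ua + 2 * ub * \<alpha> t0 - uc * (\<alpha> t0)\<^sup>2) (at t0 within I)"
      "(\<beta> has_vector_derivative ub - uc * \<alpha> t0) (at t0 within I)"
      "(\<gamma> has_vector_derivative uc * exp (2 * \<beta> t0)) (at t0 within I)"
  defines "z \<equiv> \<lambda>t. prod_flow (\<alpha> t) (\<beta> t) (\<gamma> t)"
  shows "(z has_vector_derivative uc *\<^sub>R X Lc (z t0) + (ub *\<^sub>R X Lb (z t0) + ua *\<^sub>R X La (z t0))) (at t0 within I)"
proof -
  have r: "B * \<rho> + B * \<rho> \<le> R" "(B * \<rho> + B * \<rho>) + B * \<rho> \<le> R" using radius B\<rho> by auto
  have "exp (2 * \<beta> t0) * exp (- 2 * \<beta> t0) = 1" by (simp flip: exp_add)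
  then have e: "uc * exp (2 * \<beta> t0) * exp (- 2 * \<beta> t0) = uc" by (simp add: mult.assoc)
  note c = stage_c[OF t0 in_I(3) der(3)]
  note b = stage_b[OF t0 fl_c_in[OF in_I(3)] r(1) in_I(2) der(2) c, unfolded e]
  note a = stage_a[OF t0 fl_bc_in[OF in_I(2,3)] r(2) in_I(1) der(1) b]
  have "ua + 2 * ub * \<alpha> t0 - uc * (\<alpha> t0)\<^sup>2 - 2 * \<alpha> t0 * (ub - uc * \<alpha> t0) - (\<alpha> t0)\<^sup>2 * uc = ua"
    "ub - uc * \<alpha> t0 + \<alpha> t0 * uc = ub"
    by (simp_all add: algebra_simps power2_eq_square)
  with a show ?thesis
    unfolding z_def prod_flow_def by (simp only: add_ac)
qed

text \<open>\<open>7 = 1 + 2 + 4\<close>: each flow is Lipschitz in its duration with constant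
  \<open>B\<close> and at most doubles the distance of starting points, so the exponents enter with
  weights 1, 2 and 4.\<close>

lemma prod_flow_lipschitz:
  assumes "\<alpha> \<in> {-\<rho>..\<rho>}" "\<beta> \<in> {-\<rho>..\<rho>}" "\<gamma> \<in> {-\<rho>..\<rho>}" "\<alpha>' \<in> {-\<rho>..\<rho>}" "\<beta>' \<in> {-\<rho>..\<rho>}" "\<gamma>' \<in> {-\<rho>..\<rho>}"
  shows "norm (prod_flow \<alpha> \<beta> \<gamma> - prod_flow \<alpha>' \<beta>' \<gamma>') \<le> 7 * B * norm ((\<alpha>, \<beta>, \<gamma>) - (\<alpha>', \<beta>', \<gamma>'))"
proof -
  let ?n = "norm ((\<alpha>, \<beta>, \<gamma>) - (\<alpha>', \<beta>', \<gamma>'))"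
  have r: "B * \<rho> + B * \<rho> \<le> R" "(B * \<rho> + B * \<rho>) + B * \<rho> \<le> R" using radius B\<rho> by auto
  have 1: "norm (fl Lc p0 \<gamma> - fl Lc p0 \<gamma>') \<le> B * \<bar>\<gamma> - \<gamma>'\<bar>"
    by (rule local_flow.fl_lipschitz_time[OF fields assms(3,6)])
  have 2: "norm (fl Lb (fl Lc p0 \<gamma>) \<beta> - fl Lb (fl Lc p0 \<gamma>') \<beta>') \<le>
      2 * norm (fl Lc p0 \<gamma> - fl Lc p0 \<gamma>') + B * \<bar>\<beta> - \<beta>'\<bar>"
    by (rule local_flow.fl_lipschitz[OF fields fl_c_in[OF assms(3)] fl_c_in[OF assms(6)] r(1) assms(2,5)])
  have 3: "norm (prod_flow \<alpha> \<beta> \<gamma> - prod_flow \<alpha>' \<beta>' \<gamma>') \<le>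
      2 * norm (fl Lb (fl Lc p0 \<gamma>) \<beta> - fl Lb (fl Lc p0 \<gamma>') \<beta>') + B * \<bar>\<alpha> - \<alpha>'\<bar>"
    unfolding prod_flow_def
    by (rule local_flow.fl_lipschitz[OF fields fl_bc_in[OF assms(2,3)] fl_bc_in[OF assms(5,6)] r(2) assms(1,4)])
  have n: "\<bar>\<alpha> - \<alpha>'\<bar> \<le> ?n" "\<bar>\<beta> - \<beta>'\<bar> \<le> ?n" "\<bar>\<gamma> - \<gamma>'\<bar> \<le> ?n"
  proof -
    show "\<bar>\<alpha> - \<alpha>'\<bar> \<le> ?n" using norm_fst_le[of "\<alpha> - \<alpha>'" "(\<beta> - \<beta>', \<gamma> - \<gamma>')"] by simp
    have "norm (\<beta> - \<beta>', \<gamma> - \<gamma>') \<le> ?n" using norm_snd_le[of "(\<beta> - \<beta>', \<gamma> - \<gamma>')" "\<alpha> - \<alpha>'"] by simp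
    then show "\<bar>\<beta> - \<beta>'\<bar> \<le> ?n" "\<bar>\<gamma> - \<gamma>'\<bar> \<le> ?n"
      using norm_fst_le[of "\<beta> - \<beta>'" "\<gamma> - \<gamma>'"] norm_snd_le[of "\<gamma> - \<gamma>'" "\<beta> - \<beta>'"] by simp_all
  qed
  have B: "0 \<le> B" by (rule c1_field.B_nonneg[OF c1])
  have "B * \<bar>\<alpha> - \<alpha>'\<bar> \<le> B * ?n" "B * \<bar>\<beta> - \<beta>'\<bar> \<le> B * ?n" "B * \<bar>\<gamma> - \<gamma>'\<bar> \<le> B * ?n"
    by (rule mult_left_mono[OF _ B], fact n)+
  then show ?thesis using 1 2 3 by simp
qed

end

text \<open>As in \<open>short_gronwall\<close>, the largest distance is at most half of itself. The
  Lipschitz rate \<open>k\<close> is merely integrable, so its integral has to be small;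
  \<open>t0\<close> may lie anywhere, so the estimate runs in both directions.\<close>

lemma ac_unique_short:
  fixes f g :: "real \<Rightarrow> 'e::euclidean_space"
  assumes f: "ac_primitive a b f f'" and g: "ac_primitive a b g g'"
    and k: "k integrable_on {a..b}" "integral {a..b} k \<le> 1 / 2" "\<And>t. t \<in> {a..b} \<Longrightarrow> 0 \<le> k t"
    and le: "\<And>t. t \<in> {a..b} \<Longrightarrow> norm (f' t - g' t) \<le> k t * norm (f t - g t)"
    and t0: "t0 \<in> {a..b}" "f t0 = g t0" and t: "t \<in> {a..b}"
  shows "f t = g t"
proof -
  have cont: "continuous_on {a..b} (\<lambda>t. norm (f t - g t))"
    by (intro continuous_intros ac_primitive_continuous[OF f] ac_primitive_continuous[OF g])
  then obtain m where m: "m \<in> {a..b}" "\<And>t. t \<in> {a..b} \<Longrightarrow> norm (f t - g t) \<le> norm (f m - g m)"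
    using continuous_attains_sup[of "{a..b}" "\<lambda>t. norm (f t - g t)"] t by auto
  define M where "M = norm (f m - g m)"
  have le': "norm (f' t - g' t) \<le> k t * M" if "t \<in> {a..b}" for t
    using le[OF that] mult_left_mono[OF m(2)[OF that] k(3)[OF that]] by (simp add: M_def)
  have *: "norm ((f d - g d) - (f c - g c)) \<le> M / 2" if cd: "a \<le> c" "c \<le> d" "d \<le> b" for c d
  proof -
    have "(f' has_integral f d - f c) {c..d}" "(g' has_integral g d - g c) {c..d}"
      using cd by (auto intro!: ac_primitive_has_integral ac_primitive_subset[OF f] ac_primitive_subset[OF g])
    from has_integral_diff[OF this]
    have i: "((\<lambda>t. f' t - g' t) has_integral (f d - f c) - (g d - g c)) {c..d}" .
    have ks: "k integrable_on {c..d}" by (rule integrable_subinterval_real[OF k(1)]) (use cd in auto)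
    have "norm (integral {c..d} (\<lambda>t. f' t - g' t)) \<le> integral {c..d} (\<lambda>t. k t * M)"
      by (rule Henstock_Kurzweil_Integration.integral_norm_bound_integral)
        (use i ks le' cd in \<open>auto intro: integrable_on_mult_left\<close>)
    also have "\<dots> = integral {c..d} k * M" by simp
    also have "\<dots> \<le> 1 / 2 * M"
    proof (rule mult_right_mono)
      have "integral {c..d} k \<le> integral {a..b} k"
        by (rule integral_subset_le) (use cd ks k in auto)
      then show "integral {c..d} k \<le> 1 / 2" using k(2) by linarith
    qed (simp add: M_def)
    finally show ?thesis using integral_unique[OF i] by (simp add: algebra_simps)
  qed
  have "M \<le> M / 2"
  proof (cases "t0 \<le> m")
    case True
    then show ?thesis using *[of t0 m] t0 m(1) by (simp add: M_def)
  next
    case False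
    then show ?thesis using *[of m t0] t0 m(1) by (simp add: M_def norm_minus_commute)
  qed
  then have "M = 0" unfolding M_def using norm_ge_zero[of "f m - g m"] by linarith
  then show ?thesis using m(2)[OF t] by (simp add: M_def)
qed

section \<open>Solutions on the manifold\<close>

locale manifold =
  fixes M :: "'a::{t2_space, second_countable_topology} set"
    and \<A> :: "('a, 'e::euclidean_space) chart set"
  assumes smooth_manifold: "smooth_manifold M \<A>"
begin

lemma in_chart:
  assumes "p \<in> M"
  obtains U \<phi> where "(U, \<phi>) \<in> \<A>" "p \<in> U"
  using smooth_manifold assms unfolding smooth_manifold_def by blast

lemma chart:
  assumes "(U, \<phi>) \<in> \<A>"
  shows "openin (top_of_set M) U" "open (\<phi> ` U)" "homeomorphism U (\<phi> ` U) \<phi> (chart_inv (U, \<phi>))"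
  using smooth_manifold assms unfolding smooth_manifold_def by blast+

lemma chart_subset: "(U, \<phi>) \<in> \<A> \<Longrightarrow> U \<subseteq> M"
  using chart(1) openin_imp_subset by blast

lemma chart_inverse:
  assumes "(U, \<phi>) \<in> \<A>"
  shows "p \<in> U \<Longrightarrow> chart_inv (U, \<phi>) (\<phi> p) = p"
    "y \<in> \<phi> ` U \<Longrightarrow> \<phi> (chart_inv (U, \<phi>) y) = y"
    "y \<in> \<phi> ` U \<Longrightarrow> chart_inv (U, \<phi>) y \<in> U"
  using chart(3)[OF assms] unfolding homeomorphism_def by auto

lemma chart_continuous:
  assumes "(U, \<phi>) \<in> \<A>"
  shows "continuous_on U \<phi>" "continuous_on (\<phi> ` U) (chart_inv (U, \<phi>))"
  using chart(3)[OF assms] unfolding homeomorphism_def by auto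

lemma open_overlap:
  assumes "(U, \<phi>) \<in> \<A>" "(V, \<psi>) \<in> \<A>"
  shows "open (\<phi> ` (U \<inter> V))"
proof -
  have "openin (top_of_set M) (U \<inter> V)"
    using chart(1)[OF assms(1)] chart(1)[OF assms(2)] by (rule openin_Int)
  then have "openin (top_of_set U) (U \<inter> V)"
    using openin_subset_trans[of M "U \<inter> V" U] chart_subset[OF assms(1)] by blast
  then have "openin (top_of_set (\<phi> ` U)) (\<phi> ` (U \<inter> V))"
    by (rule homeomorphism_imp_open_map[OF chart(3)[OF assms(1)]])
  then show ?thesis using openin_open_eq[OF chart(2)[OF assms(1)]] by blast
qed

lemma transition:
  assumes "(U, \<phi>) \<in> \<A>" "(V, \<psi>) \<in> \<A>"
  obtains D where
    "\<And>y. y \<in> \<phi> ` (U \<inter> V) \<Longrightarrow> ((\<psi> \<circ> chart_inv (U, \<phi>)) has_derivative blinfun_apply (D y)) (at y)"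
    "\<And>y. y \<in> \<phi> ` (U \<inter> V) \<Longrightarrow> blinfun_apply (D y) = frechet_derivative (\<psi> \<circ> chart_inv (U, \<phi>)) (at y)"
    "continuous_on (\<phi> ` (U \<inter> V)) D"
proof -
  have "smooth_on (\<phi> ` (U \<inter> V)) (\<psi> \<circ> chart_inv (U, \<phi>))"
    using smooth_manifold assms unfolding smooth_manifold_def by blast
  then show thesis by (rule smooth_on_has_blinfun_derivative) (rule that)
qed

lemma stays_in_chart:
  fixes t :: real
  assumes "continuous_on I x" "x ` I \<subseteq> M" "(V, \<psi>) \<in> \<A>" "t \<in> I" "x t \<in> V"
  obtains d where "d > 0" "\<And>s. s \<in> I \<Longrightarrow> \<bar>s - t\<bar> < d \<Longrightarrow> x s \<in> V"
proof -
  have "openin (top_of_set I) (I \<inter> x -` V)"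
    by (rule continuous_openin_preimage[OF assms(1) _ chart(1)[OF assms(3)]]) (use assms(2) in blast)
  moreover have "t \<in> I \<inter> x -` V" using assms(4,5) by simp
  ultimately obtain d where "d > 0" "ball t d \<inter> I \<subseteq> I \<inter> x -` V"
    unfolding openin_contains_ball by blast
  then show thesis
    by (intro that[of d]) (auto simp: ball_def dist_real_def abs_minus_commute)
qed

text \<open>The velocities in the other charts are forced by the chain rule. The last assumption
  says that \<open>w\<close> transforms as a tangent vector at \<open>x t\<close>.\<close>

lemma has_velocity_in_chart:
  assumes c: "(U, \<phi>) \<in> \<A>" and t: "t \<in> I" and xU: "x ` I \<subseteq> U"
    and der: "((\<phi> \<circ> x) has_vector_derivative w (U, \<phi>)) (at t within I)"
    and w: "\<And>V \<psi>. (V, \<psi>) \<in> \<A> \<Longrightarrow> x t \<in> V \<Longrightarrow>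
      w (V, \<psi>) = frechet_derivative (\<psi> \<circ> chart_inv (U, \<phi>)) (at (\<phi> (x t))) (w (U, \<phi>))"
  shows "has_velocity \<A> I x t w"
  unfolding has_velocity_def
proof (clarify)
  fix V \<psi> assume V: "(V, \<psi>) \<in> \<A>" "x t \<in> V"
  obtain D where D: "\<And>y. y \<in> \<phi> ` (U \<inter> V) \<Longrightarrow> ((\<psi> \<circ> chart_inv (U, \<phi>)) has_derivative blinfun_apply (D y)) (at y)"
    "\<And>y. y \<in> \<phi> ` (U \<inter> V) \<Longrightarrow> blinfun_apply (D y) = frechet_derivative (\<psi> \<circ> chart_inv (U, \<phi>)) (at y)"
    using transition[OF c V(1)] by metis
  have y: "\<phi> (x t) \<in> \<phi> ` (U \<inter> V)" using t xU V(2) by blast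
  have "(((\<psi> \<circ> chart_inv (U, \<phi>)) \<circ> (\<phi> \<circ> x)) has_vector_derivative D (\<phi> (x t)) (w (U, \<phi>))) (at t within I)"
    by (rule vector_derivative_diff_chain_within[OF der])
      (use has_derivative_at_withinI[OF D(1)[OF y]] in \<open>simp add: comp_def\<close>)
  moreover have "D (\<phi> (x t)) (w (U, \<phi>)) = w (V, \<psi>)"
    using w[OF V] D(2)[OF y] by simp
  ultimately have "(((\<psi> \<circ> chart_inv (U, \<phi>)) \<circ> (\<phi> \<circ> x)) has_vector_derivative w (V, \<psi>)) (at t within I)" by simp
  then show "((\<psi> \<circ> x) has_vector_derivative w (V, \<psi>)) (at t within I)"
    by (rule has_vector_derivative_transform[OF t, rotated]) (use xU chart_inverse(1)[OF c] in auto)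
qed

text \<open>A transition map need not be Lipschitz on the whole overlap, but it is C1 and hence
  Lipschitz on the compact image of the curve.\<close>

lemma absolutely_continuous_change_chart:
  assumes c: "(U, \<phi>) \<in> \<A>" and V: "(V, \<psi>) \<in> \<A>"
    and x: "continuous_on {r..s} x" "x ` {r..s} \<subseteq> U" "x ` {r..s} \<subseteq> V"
    and ac: "absolutely_continuous_on {r..s} (\<phi> \<circ> x)"
  shows "absolutely_continuous_on {r..s} (\<psi> \<circ> x)"
proof -
  let ?W = "\<phi> ` (U \<inter> V)" and ?\<tau> = "\<psi> \<circ> chart_inv (U, \<phi>)" and ?C = "(\<phi> \<circ> x) ` {r..s}"
  obtain D where D: "\<And>y. y \<in> ?W \<Longrightarrow> (?\<tau> has_derivative blinfun_apply (D y)) (at y)" "continuous_on ?W D"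
    using transition[OF c V] by metis
  \<comment> \<open>\<open>local_lipschitz\<close> is about maps with a time parameter; a dummy real
    time is supplied.\<close>
  have "local_lipschitz UNIV ?W (\<lambda>_::real. ?\<tau>)"
  proof (rule c1_implies_local_lipschitz[where f' = "\<lambda>z. D (snd z)"])
    show "continuous_on (UNIV \<times> ?W) (\<lambda>z. D (snd z))"
      by (rule continuous_on_compose2[OF D(2)]) (auto intro: continuous_intros)
  qed (use D(1) open_overlap[OF c V] in auto)
  moreover have CW: "?C \<subseteq> ?W" using x(2,3) by auto
  ultimately have "local_lipschitz {0} ?C (\<lambda>_::real. ?\<tau>)"
    using local_lipschitz_subset[of UNIV ?W "\<lambda>_::real. ?\<tau>" "{0}" ?C] by simp
  moreover have "compact ?C"
  proof (intro compact_continuous_image)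
    show "continuous_on {r..s} (\<phi> \<circ> x)" by (rule absolutely_continuous_on_imp_continuous_on[OF ac])
  qed simp
  ultimately obtain L where "\<And>t. t \<in> {0::real} \<Longrightarrow> L-lipschitz_on ?C ?\<tau>"
    by (rule local_lipschitz_compact_implies_lipschitz) auto
  then have L: "L-lipschitz_on ?C ?\<tau>" by simp
  have eq: "(\<psi> \<circ> x) t = ?\<tau> ((\<phi> \<circ> x) t)" if "t \<in> {r..s}" for t
  proof -
    have "x t \<in> U" using that x(2) by blast
    then show ?thesis by (simp add: chart_inverse(1)[OF c])
  qed
  show ?thesis
  proof (rule absolutely_continuous_on_dominated[OF ac])
    fix a b assume ab: "a \<in> {r..s}" "b \<in> {r..s}"
    show "norm ((\<psi> \<circ> x) b - (\<psi> \<circ> x) a) \<le> L * norm ((\<phi> \<circ> x) b - (\<phi> \<circ> x) a)"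
      unfolding eq[OF ab(1)] eq[OF ab(2)] by (intro lipschitz_on_normD[OF L] imageI ab)
  qed
qed

end

text \<open>\<open>ode_solution\<close> without the initial value and on any set of times, so that
  one uniqueness theorem covers solutions on \<open>{0..\<tau>}\<close> and integral curves on open
  intervals.\<close>

definition caratheodory ::
  "'a::topological_space set \<Rightarrow> ('a, 'e::euclidean_space) chart set \<Rightarrow>
   (real \<Rightarrow> ('a, 'e) vector_field) \<Rightarrow> real set \<Rightarrow> (real \<Rightarrow> 'a) \<Rightarrow> bool" where
  "caratheodory M \<A> F I x \<longleftrightarrow> continuous_on I x \<and> x ` I \<subseteq> M \<and>
     (\<forall>(U, \<phi>)\<in>\<A>. \<forall>r s. {r..s} \<subseteq> I \<and> x ` {r..s} \<subseteq> U \<longrightarrow> absolutely_continuous_on {r..s} (\<phi> \<circ> x)) \<and>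
     (AE t in lebesgue. t \<in> I \<longrightarrow> has_velocity \<A> I x t (\<lambda>c. F t c (x t)))"

lemma ode_solution_iff_caratheodory:
  "ode_solution M \<A> F x0 \<tau> x \<longleftrightarrow> x 0 = x0 \<and> caratheodory M \<A> F {0..\<tau>} x"
  unfolding ode_solution_def caratheodory_def by blast

lemma has_velocity_subset: "has_velocity \<A> I x t w \<Longrightarrow> J \<subseteq> I \<Longrightarrow> has_velocity \<A> J x t w"
  unfolding has_velocity_def by (auto intro: has_vector_derivative_within_subset)

lemma caratheodory_subset:
  assumes "caratheodory M \<A> F I x" "J \<subseteq> I"
  shows "caratheodory M \<A> F J x"
proof -
  have "AE t in lebesgue. t \<in> J \<longrightarrow> has_velocity \<A> J x t (\<lambda>c. F t c (x t))"
  proof -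
    have "AE t in lebesgue. t \<in> I \<longrightarrow> has_velocity \<A> I x t (\<lambda>c. F t c (x t))"
      using assms(1) unfolding caratheodory_def by blast
    then show ?thesis
      by eventually_elim (use has_velocity_subset[OF _ assms(2)] assms(2) in blast)
  qed
  moreover have "continuous_on J x" "x ` J \<subseteq> M"
    using assms continuous_on_subset unfolding caratheodory_def by blast+
  moreover have "absolutely_continuous_on {r..s} (\<phi> \<circ> x)"
    if "(U, \<phi>) \<in> \<A>" "{r..s} \<subseteq> J" "x ` {r..s} \<subseteq> U" for U \<phi> r s
    using assms that unfolding caratheodory_def by blast
  ultimately show ?thesis unfolding caratheodory_def by blast
qed

lemma caratheodory_cong:
  assumes "caratheodory M \<A> F I x" "\<And>t. t \<in> I \<Longrightarrow> F t = G t"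
  shows "caratheodory M \<A> G I x"
proof -
  have "AE t in lebesgue. t \<in> I \<longrightarrow> has_velocity \<A> I x t (\<lambda>c. G t c (x t))"
  proof -
    have "AE t in lebesgue. t \<in> I \<longrightarrow> has_velocity \<A> I x t (\<lambda>c. F t c (x t))"
      using assms(1) unfolding caratheodory_def by blast
    then show ?thesis
      by eventually_elim (simp add: assms(2))
  qed
  then show ?thesis using assms(1) unfolding caratheodory_def by blast
qed

lemma control_field_apply:
  "control_field X u t c p = u Lc t *\<^sub>R X Lc c p + (u Lb t *\<^sub>R X Lb c p + u La t *\<^sub>R X La c p)"
  by (simp add: control_field_def vf_add_def vf_scale_def)

section \<open>Uniqueness of solutions and identification of flows\<close>

locale control_system = manifold M \<A> for M :: "'a::{t2_space, second_countable_topology} set"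
    and \<A> :: "('a, 'e::euclidean_space) chart set" +
  fixes X :: "letter \<Rightarrow> ('a, 'e) vector_field"
  assumes smooth_fields: "\<And>d. smooth_vector_field \<A> (X d)"
begin

lemma field_transition:
  assumes "(U, \<phi>) \<in> \<A>" "(V, \<psi>) \<in> \<A>" "p \<in> U" "p \<in> V"
  shows "X d (V, \<psi>) p = frechet_derivative (\<psi> \<circ> chart_inv (U, \<phi>)) (at (\<phi> p)) (X d (U, \<phi>) p)"
  using smooth_fields[of d] assms unfolding smooth_vector_field_def by blast

lemma control_field_transition:
  assumes "(U, \<phi>) \<in> \<A>" "(V, \<psi>) \<in> \<A>" "p \<in> U" "p \<in> V"
  shows "control_field X u t (V, \<psi>) p =
    frechet_derivative (\<psi> \<circ> chart_inv (U, \<phi>)) (at (\<phi> p)) (control_field X u t (U, \<phi>) p)"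
proof -
  obtain D where D: "\<And>y. y \<in> \<phi> ` (U \<inter> V) \<Longrightarrow> blinfun_apply (D y) = frechet_derivative (\<psi> \<circ> chart_inv (U, \<phi>)) (at y)"
    using transition[OF assms(1,2)] by metis
  have "\<phi> p \<in> \<phi> ` (U \<inter> V)" using assms by blast
  note D = D[OF this, symmetric]
  show ?thesis
    unfolding control_field_apply field_transition[OF assms] D by (simp add: blinfun.add_right blinfun.scaleR_right)
qed

definition rep :: "('a, 'e) chart \<Rightarrow> letter \<Rightarrow> 'e \<Rightarrow> 'e" where
  "rep c d = X d c \<circ> chart_inv c"

lemma rep_chart: "(U, \<phi>) \<in> \<A> \<Longrightarrow> p \<in> U \<Longrightarrow> rep (U, \<phi>) d (\<phi> p) = X d (U, \<phi>) p"
  by (simp add: rep_def chart_inverse(1))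

text \<open>One radius and one pair of bounds serve all three fields, because their flows are
  composed inside the same ball.\<close>

lemma c1_field_chart:
  assumes c: "(U, \<phi>) \<in> \<A>" and p: "p \<in> U"
  obtains DX R B L where "cball (\<phi> p) R \<subseteq> \<phi> ` U"
    "\<And>d. c1_field (rep (U, \<phi>) d) (DX d) (\<phi> p) R B L"
    "\<And>d y. y \<in> cball (\<phi> p) R \<Longrightarrow> blinfun_apply (DX d y) = frechet_derivative (rep (U, \<phi>) d) (at y)"
proof -
  have "\<exists>D. (\<forall>y\<in>\<phi> ` U. (rep (U, \<phi>) d has_derivative blinfun_apply (D y)) (at y) \<and>
      blinfun_apply (D y) = frechet_derivative (rep (U, \<phi>) d) (at y)) \<and> continuous_on (\<phi> ` U) D" for d
  proof -
    have "smooth_on (\<phi> ` U) (rep (U, \<phi>) d)"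
      using smooth_fields[of d] c unfolding smooth_vector_field_def rep_def by blast
    then show ?thesis by (rule smooth_on_has_blinfun_derivative) blast
  qed
  then obtain DX where DX: "\<And>d y. y \<in> \<phi> ` U \<Longrightarrow> (rep (U, \<phi>) d has_derivative blinfun_apply (DX d y)) (at y)"
    "\<And>d y. y \<in> \<phi> ` U \<Longrightarrow> blinfun_apply (DX d y) = frechet_derivative (rep (U, \<phi>) d) (at y)"
    "\<And>d. continuous_on (\<phi> ` U) (DX d)"
    by metis
  obtain R where R: "R > 0" "cball (\<phi> p) R \<subseteq> \<phi> ` U"
    using chart(2)[OF c] p unfolding open_contains_cball by blast
  have cont: "continuous_on (cball (\<phi> p) R) (DX d)" "continuous_on (cball (\<phi> p) R) (rep (U, \<phi>) d)" for d
  proof -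
    show "continuous_on (cball (\<phi> p) R) (DX d)" by (rule continuous_on_subset[OF DX(3) R(2)])
    show "continuous_on (cball (\<phi> p) R) (rep (U, \<phi>) d)"
    proof (intro continuous_at_imp_continuous_on ballI)
      fix y assume "y \<in> cball (\<phi> p) R"
      then have "y \<in> \<phi> ` U" using R(2) by blast
      from has_derivative_continuous[OF DX(1)[OF this]] show "isCont (rep (U, \<phi>) d) y" .
    qed
  qed
  have "bounded (DX d ` cball (\<phi> p) R)" "bounded (rep (U, \<phi>) d ` cball (\<phi> p) R)" for d
    by (intro compact_imp_bounded compact_continuous_image cont compact_cball)+
  then have "\<exists>L. \<forall>y\<in>cball (\<phi> p) R. norm (DX d y) \<le> L" "\<exists>B. \<forall>y\<in>cball (\<phi> p) R. norm (rep (U, \<phi>) d y) \<le> B" for d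
    unfolding bounded_iff by blast+
  then obtain L B where LB: "\<And>d y. y \<in> cball (\<phi> p) R \<Longrightarrow> norm (DX d y) \<le> L d"
    "\<And>d y. y \<in> cball (\<phi> p) R \<Longrightarrow> norm (rep (U, \<phi>) d y) \<le> B d"
    by metis
  have mx: "f d \<le> Max (range f)" for f :: "letter \<Rightarrow> real" and d
    by (rule Max_ge) auto
  show thesis
  proof (rule that[OF R(2)])
    show "c1_field (rep (U, \<phi>) d) (DX d) (\<phi> p) R (Max (range B)) (Max (range L))" for d
    proof
      fix y assume y: "y \<in> cball (\<phi> p) R"
      show "norm (rep (U, \<phi>) d y) \<le> Max (range B)" by (rule order_trans[OF LB(2)[OF y] mx])
      show "norm (DX d y) \<le> Max (range L)" by (rule order_trans[OF LB(1)[OF y] mx])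
      show "(rep (U, \<phi>) d has_derivative blinfun_apply (DX d y)) (at y)" using DX(1) y R(2) by blast
    qed (use R(1) cont(1) in auto)
    show "blinfun_apply (DX d y) = frechet_derivative (rep (U, \<phi>) d) (at y)" if "y \<in> cball (\<phi> p) R" for d y
      using DX(2) that R(2) by blast
  qed
qed

lemma caratheodory_unique:
  assumes I: "is_interval I"
    and u: "\<And>d r s. set_integrable lebesgue {r..s} (u d)"
    and x: "caratheodory M \<A> (control_field X u) I x" and y: "caratheodory M \<A> (control_field X u) I y"
    and t0: "t0 \<in> I" "x t0 = y t0" and t: "t \<in> I"
  shows "x t = y t"
proof -
  have xM: "continuous_on I x" "x ` I \<subseteq> M" and yM: "continuous_on I y" "y ` I \<subseteq> M"
    using x y unfolding caratheodory_def by blast+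
  define S where "S = {t \<in> I. x t = y t}"
  \<comment> \<open>The diagonal is closed since the space is Hausdorff.\<close>
  have "closedin (top_of_set I) (I \<inter> (\<lambda>t. (x t, y t)) -` {z. \<exists>p. z = (p, p)})"
    by (intro continuous_closedin_preimage continuous_on_Pair xM yM closed_diagonal)
  moreover have "I \<inter> (\<lambda>t. (x t, y t)) -` {z. \<exists>p. z = (p, p)} = S" by (auto simp: S_def)
  ultimately have "closedin (top_of_set I) S" by simp
  moreover have "openin (top_of_set I) S"
    unfolding openin_contains_ball
  proof (intro conjI ballI)
    show "S \<subseteq> I" by (auto simp: S_def)
    fix t1 assume "t1 \<in> S"
    then have t1: "t1 \<in> I" "x t1 = y t1" by (auto simp: S_def)
    then have "x t1 \<in> M" using xM by blast
    then obtain U \<phi> where c: "(U, \<phi>) \<in> \<A>" "x t1 \<in> U" by (rule in_chart)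
    obtain DX R B L where ball: "cball (\<phi> (x t1)) R \<subseteq> \<phi> ` U" and
      c1: "\<And>d. c1_field (rep (U, \<phi>) d) (DX d) (\<phi> (x t1)) R B L"
      by (rule c1_field_chart[OF c]) blast
    have R: "R > 0" by (rule c1_field.R_pos[OF c1])
    have near: "\<exists>d>0. \<forall>s\<in>I. \<bar>s - t1\<bar> < d \<longrightarrow> z s \<in> U \<and> \<phi> (z s) \<in> cball (\<phi> (x t1)) R"
      if z: "continuous_on I z" "z ` I \<subseteq> M" "z t1 = x t1" for z
    proof -
      obtain d where d: "d > 0" "\<And>s. s \<in> I \<Longrightarrow> \<bar>s - t1\<bar> < d \<Longrightarrow> z s \<in> U"
        using stays_in_chart[OF z(1,2) c(1) t1(1)] c(2) z(3) by metis
      let ?I = "I \<inter> ball t1 d"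
      have "z ` ?I \<subseteq> U" using d(2) by (auto simp: dist_real_def abs_minus_commute)
      then have "continuous_on ?I (\<phi> \<circ> z)"
        using z(1) chart_continuous(1)[OF c(1)] by (intro continuous_on_compose) (auto intro: continuous_on_subset)
      moreover have "t1 \<in> ?I" using t1 d by simp
      ultimately obtain e where e: "e > 0" "\<forall>s\<in>?I. dist s t1 < e \<longrightarrow> dist ((\<phi> \<circ> z) s) ((\<phi> \<circ> z) t1) < R"
        unfolding continuous_on_iff using R by meson
      show ?thesis
      proof (intro exI[of _ "min d e"] conjI ballI impI)
        fix s assume s: "s \<in> I" "\<bar>s - t1\<bar> < min d e"
        show "z s \<in> U" using d(2) s by simp
        have "dist (\<phi> (z s)) (\<phi> (z t1)) < R"
          using e(2) s by (auto simp: dist_real_def abs_minus_commute)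
        then show "\<phi> (z s) \<in> cball (\<phi> (x t1)) R" using z(3) by (simp add: dist_commute)
      qed (use d e in auto)
    qed
    obtain d1 where d1: "d1 > 0" "\<forall>s\<in>I. \<bar>s - t1\<bar> < d1 \<longrightarrow> x s \<in> U \<and> \<phi> (x s) \<in> cball (\<phi> (x t1)) R"
      using near[OF xM refl] by blast
    obtain d2 where d2: "d2 > 0" "\<forall>s\<in>I. \<bar>s - t1\<bar> < d2 \<longrightarrow> y s \<in> U \<and> \<phi> (y s) \<in> cball (\<phi> (x t1)) R"
      using near[OF yM t1(2)[symmetric]] by blast
    \<comment> \<open>The Lipschitz rate of the control field in the chart at time \<open>s\<close>.
      It may be unbounded, so smallness is asked of its integral.\<close>
    define k where "k s = (\<bar>u Lc s\<bar> + (\<bar>u Lb s\<bar> + \<bar>u La s\<bar>)) * L" for s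
    have L: "0 \<le> L" by (rule c1_field.L_nonneg[OF c1])
    have kint: "k integrable_on {r..s}" for r s
    proof -
      have "(\<lambda>s. \<bar>u d s\<bar>) integrable_on {r..s}" for d
        by (rule set_lebesgue_integral_eq_integral(1)[OF set_integrable_abs[OF u]])
      then show ?thesis unfolding k_def by (intro integrable_on_mult_left integrable_add)
    qed
    \<comment> \<open>Continuity of the indefinite integral provides a neighbourhood of
      \<open>t1\<close> with increments of the integral of \<open>k\<close> below one half; the
      window supplies a base point to the left of \<open>t1\<close>.\<close>
    have "continuous_on {t1 - 1..t1 + 1} (\<lambda>t. integral {t1 - 1..t} k)"
      by (rule indefinite_integral_continuous_1[OF kint])
    then obtain d3 where d3: "d3 > 0" "\<forall>s\<in>{t1 - 1..t1 + 1}. dist s t1 < d3 \<longrightarrow>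
        dist (integral {t1 - 1..s} k) (integral {t1 - 1..t1} k) < 1 / 2"
      using continuous_on_iff[THEN iffD1, rule_format, of "{t1 - 1..t1 + 1}" _ t1 "1 / 2"] by auto
    define e where "e = min (min d1 d2) (min d3 1)"
    have "x s = y s" if s: "s \<in> I" "\<bar>s - t1\<bar> < e" for s
    proof -
      \<comment> \<open>One endpoint is always \<open>t1\<close>, so times before and after it are
        treated alike.\<close>
      define a b where "a = min s t1" "b = max s t1"
      have ab: "a \<le> b" "t1 \<in> {a..b}" "s \<in> {a..b}" by (auto simp: a_b_def)
      have "a \<in> I" "b \<in> I" using s(1) t1(1) by (simp_all add: a_b_def min_def max_def)
      from mem_is_interval_1_I[OF I this] have abI: "{a..b} \<subseteq> I" by auto
      have near': "\<bar>r - t1\<bar> < e" if "r \<in> {a..b}" for r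
        using that s(2) by (auto simp: a_b_def min_def max_def split: if_splits)
      have xs: "x r \<in> U" "\<phi> (x r) \<in> cball (\<phi> (x t1)) R" and ys: "y r \<in> U" "\<phi> (y r) \<in> cball (\<phi> (x t1)) R"
        if "r \<in> {a..b}" for r
      proof -
        have "r \<in> I" "\<bar>r - t1\<bar> < d1" "\<bar>r - t1\<bar> < d2"
          using abI that near'[OF that] unfolding e_def by auto
        then show "x r \<in> U" "\<phi> (x r) \<in> cball (\<phi> (x t1)) R" "y r \<in> U" "\<phi> (y r) \<in> cball (\<phi> (x t1)) R"
          using d1(2) d2(2) by blast+
      qed
      have prim: "ac_primitive a b (\<phi> \<circ> z) (\<lambda>s. control_field X u s (U, \<phi>) (z s))"
        if z: "caratheodory M \<A> (control_field X u) I z" "\<And>r. r \<in> {a..b} \<Longrightarrow> z r \<in> U" for z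
      proof -
        have "AE t in lebesgue. t \<in> I \<longrightarrow> has_velocity \<A> I z t (\<lambda>c. control_field X u t c (z t))"
          using z(1) unfolding caratheodory_def by blast
        then have "AE t in lebesgue. t \<in> {a..b} \<longrightarrow>
            ((\<phi> \<circ> z) has_vector_derivative control_field X u t (U, \<phi>) (z t)) (at t within {a..b})"
        proof (eventually_elim, intro impI)
          fix t assume "t \<in> I \<longrightarrow> has_velocity \<A> I z t (\<lambda>c. control_field X u t c (z t))" and t: "t \<in> {a..b}"
          then have "((\<phi> \<circ> z) has_vector_derivative control_field X u t (U, \<phi>) (z t)) (at t within I)"
            using abI c(1) z(2)[OF t] unfolding has_velocity_def by blast
          then show "((\<phi> \<circ> z) has_vector_derivative control_field X u t (U, \<phi>) (z t)) (at t within {a..b})"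
            by (rule has_vector_derivative_within_subset[OF _ abI])
        qed
        moreover have "z ` {a..b} \<subseteq> U" using z(2) by blast
        then have "absolutely_continuous_on {a..b} (\<phi> \<circ> z)"
          using z(1) c(1) abI unfolding caratheodory_def by blast
        ultimately show ?thesis by (simp add: ac_primitive_def)
      qed
      have "(\<phi> \<circ> x) s = (\<phi> \<circ> y) s"
      proof (rule ac_unique_short[OF prim[OF x xs(1)] prim[OF y ys(1)] kint])
        show "0 \<le> k t" for t using L by (simp add: k_def)
        have ab1: "a \<in> {t1 - 1..t1 + 1}" "b \<in> {t1 - 1..t1 + 1}" "dist a t1 < d3" "dist b t1 < d3"
          using near'[of a] near'[of b] ab(1) by (auto simp: e_def dist_real_def)
        have "\<bar>integral {t1 - 1..a} k - integral {t1 - 1..t1} k\<bar> < 1 / 2"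
          "\<bar>integral {t1 - 1..b} k - integral {t1 - 1..t1} k\<bar> < 1 / 2"
          using d3(2) ab1 unfolding dist_real_def by blast+
        moreover have "integral {t1 - 1..a} k + integral {a..b} k = integral {t1 - 1..b} k"
          using ab1(1,2) ab(1) by (intro Henstock_Kurzweil_Integration.integral_combine kint) auto
        moreover have "a = t1 \<or> b = t1" by (auto simp: a_b_def)
        then have "integral {t1 - 1..a} k = integral {t1 - 1..t1} k \<or> integral {t1 - 1..b} k = integral {t1 - 1..t1} k"
          by blast
        ultimately show "integral {a..b} k \<le> 1 / 2"
          unfolding abs_less_iff by (elim disjE) linarith+
        fix r assume r: "r \<in> {a..b}"
        have le: "norm (X d (U, \<phi>) (x r) - X d (U, \<phi>) (y r)) \<le> L * norm ((\<phi> \<circ> x) r - (\<phi> \<circ> y) r)" for d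
          using c1_field.lipschitz_X[OF c1 xs(2)[OF r] ys(2)[OF r], of d]
          by (simp add: rep_chart[OF c(1)] xs(1)[OF r] ys(1)[OF r])
        have le': "norm (u d r *\<^sub>R (X d (U, \<phi>) (x r) - X d (U, \<phi>) (y r))) \<le> \<bar>u d r\<bar> * (L * norm ((\<phi> \<circ> x) r - (\<phi> \<circ> y) r))" for d
          unfolding norm_scaleR by (rule mult_left_mono[OF le]) simp
        have "control_field X u r (U, \<phi>) (x r) - control_field X u r (U, \<phi>) (y r) =
            u Lc r *\<^sub>R (X Lc (U, \<phi>) (x r) - X Lc (U, \<phi>) (y r)) +
            (u Lb r *\<^sub>R (X Lb (U, \<phi>) (x r) - X Lb (U, \<phi>) (y r)) + u La r *\<^sub>R (X La (U, \<phi>) (x r) - X La (U, \<phi>) (y r)))"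
          unfolding control_field_apply by (simp add: algebra_simps)
        also have "norm \<dots> \<le> \<bar>u Lc r\<bar> * (L * norm ((\<phi> \<circ> x) r - (\<phi> \<circ> y) r)) +
            (\<bar>u Lb r\<bar> * (L * norm ((\<phi> \<circ> x) r - (\<phi> \<circ> y) r)) + \<bar>u La r\<bar> * (L * norm ((\<phi> \<circ> x) r - (\<phi> \<circ> y) r)))"
          by (intro norm_triangle_le add_mono le')
        also have "\<dots> = k r * norm ((\<phi> \<circ> x) r - (\<phi> \<circ> y) r)" by (simp add: k_def algebra_simps)
        finally show "norm (control_field X u r (U, \<phi>) (x r) - control_field X u r (U, \<phi>) (y r)) \<le>
            k r * norm ((\<phi> \<circ> x) r - (\<phi> \<circ> y) r)" .
      next
        show "(\<phi> \<circ> x) t1 = (\<phi> \<circ> y) t1" using t1(2) by simp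
      qed (use ab in auto)
      then have eq: "\<phi> (x s) = \<phi> (y s)" unfolding comp_def .
      have "x s = chart_inv (U, \<phi>) (\<phi> (x s))"
        by (rule chart_inverse(1)[OF c(1) xs(1)[OF ab(3)], symmetric])
      also have "\<dots> = y s"
        unfolding eq by (rule chart_inverse(1)[OF c(1) ys(1)[OF ab(3)]])
      finally show "x s = y s" .
    qed
    then have "ball t1 e \<inter> I \<subseteq> S"
      by (auto simp: S_def dist_real_def abs_minus_commute)
    moreover have "e > 0" using d1(1) d2(1) d3(1) by (simp add: e_def)
    ultimately show "\<exists>e>0. ball t1 e \<inter> I \<subseteq> S" by blast
  qed
  ultimately have "S = {} \<or> S = I"
    using is_interval_connected[OF I] unfolding connected_clopen by blast
  moreover have "t0 \<in> S" using t0 by (simp add: S_def)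
  ultimately show ?thesis using t by (auto simp: S_def)
qed

text \<open>Makes uniqueness of integral curves a case of \<open>caratheodory_unique\<close>, with
  constant controls.\<close>

lemma control_field_unit: "control_field X (\<lambda>d' t. if d' = d then 1 else 0) t = X d"
  by (cases d) (simp_all add: fun_eq_iff control_field_apply)

lemma integral_curve_caratheodory:
  assumes "integral_curve M \<A> (X d) J \<gamma>"
  shows "caratheodory M \<A> (control_field X (\<lambda>d' t. if d' = d then 1 else 0)) J \<gamma>"
proof -
  have J: "continuous_on J \<gamma>" "\<gamma> ` J \<subseteq> M" "\<And>s. s \<in> J \<Longrightarrow> has_velocity \<A> J \<gamma> s (\<lambda>c. X d c (\<gamma> s))"
    using assms unfolding integral_curve_def by blast+
  have "absolutely_continuous_on {r..s} (\<phi> \<circ> \<gamma>)"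
    if c: "(U, \<phi>) \<in> \<A>" and rs: "{r..s} \<subseteq> J" "\<gamma> ` {r..s} \<subseteq> U" for U \<phi> r s
  proof -
    have "smooth_on (\<phi> ` U) (X d (U, \<phi>) \<circ> chart_inv (U, \<phi>))"
      using smooth_fields[of d] c unfolding smooth_vector_field_def by blast
    then have "Ck_on 0 (\<phi> ` U) (X d (U, \<phi>) \<circ> chart_inv (U, \<phi>))" unfolding smooth_on_def by blast
    then have "continuous_on (\<phi> ` U) (rep (U, \<phi>) d)" by (simp add: rep_def)
    moreover have "continuous_on {r..s} (\<phi> \<circ> \<gamma>)"
      using continuous_on_subset[OF J(1) rs(1)] continuous_on_subset[OF chart_continuous(1)[OF c] rs(2)]
      by (rule continuous_on_compose)
    ultimately have "continuous_on {r..s} (\<lambda>t. rep (U, \<phi>) d ((\<phi> \<circ> \<gamma>) t))"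
      by (rule continuous_on_compose2) (use rs(2) in auto)
    then have "bounded ((\<lambda>t. rep (U, \<phi>) d ((\<phi> \<circ> \<gamma>) t)) ` {r..s})"
      by (intro compact_imp_bounded compact_continuous_image) auto
    then obtain B where B: "\<forall>t\<in>{r..s}. norm (rep (U, \<phi>) d ((\<phi> \<circ> \<gamma>) t)) \<le> B"
      unfolding bounded_iff by blast
    have "ac_primitive r s (\<phi> \<circ> \<gamma>) (\<lambda>t. X d (U, \<phi>) (\<gamma> t))"
    proof (rule ac_primitive_lipschitz)
      fix t assume t: "t \<in> {r..s}"
      then have "((\<phi> \<circ> \<gamma>) has_vector_derivative X d (U, \<phi>) (\<gamma> t)) (at t within J)"
        using J(3)[of t] c rs unfolding has_velocity_def by blast
      then show "((\<phi> \<circ> \<gamma>) has_vector_derivative X d (U, \<phi>) (\<gamma> t)) (at t within {r..s})"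
        by (rule has_vector_derivative_within_subset[OF _ rs(1)])
      have "\<gamma> t \<in> U" using rs(2) t by blast
      then show "norm (X d (U, \<phi>) (\<gamma> t)) \<le> B"
        using bspec[OF B t] by (simp add: rep_chart[OF c])
    qed
    then show ?thesis by (rule ac_primitive_ac)
  qed
  then show ?thesis
    unfolding caratheodory_def control_field_unit using J by blast
qed

text \<open>Two integral curves from \<open>p\<close> agree on the intersection of their domains,
  which is again an interval containing 0 and \<open>t\<close>; so the description in
  \<open>flow\<close> has a unique value.\<close>

lemma flow_eq_Some:
  assumes "flows_to M \<A> (X d) t p q"
  shows "flow M \<A> (X d) t p = Some q"
proof -
  have uniq: "q1 = q2" if f: "flows_to M \<A> (X d) t p q1" "flows_to M \<A> (X d) t p q2" for q1 q2
  proof -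
    obtain J1 g1 where 1: "integral_curve M \<A> (X d) J1 g1" "0 \<in> J1" "t \<in> J1" "g1 0 = p" "g1 t = q1"
      using f(1) unfolding flows_to_def by blast
    obtain J2 g2 where 2: "integral_curve M \<A> (X d) J2 g2" "0 \<in> J2" "t \<in> J2" "g2 0 = p" "g2 t = q2"
      using f(2) unfolding flows_to_def by blast
    have I: "is_interval (J1 \<inter> J2)"
      using 1(1) 2(1) unfolding integral_curve_def by (intro is_interval_Int) auto
    have "g1 t = g2 t"
    proof (rule caratheodory_unique[OF I])
      show "caratheodory M \<A> (control_field X (\<lambda>d' t. if d' = d then 1 else 0)) (J1 \<inter> J2) g1"
        by (rule caratheodory_subset[OF integral_curve_caratheodory[OF 1(1)]]) simp
      show "caratheodory M \<A> (control_field X (\<lambda>d' t. if d' = d then 1 else 0)) (J1 \<inter> J2) g2"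
        by (rule caratheodory_subset[OF integral_curve_caratheodory[OF 2(1)]]) simp
      show "(\<lambda>t. if d' = d then 1 else (0::real)) absolutely_integrable_on {r..s}" for d' and r s :: real
        by (rule absolutely_integrable_continuous_real) (rule continuous_on_const)
      show "(0::real) \<in> J1 \<inter> J2" "t \<in> J1 \<inter> J2" "g1 0 = g2 0" using 1 2 by auto
    qed
    then show ?thesis using 1 2 by simp
  qed
  then have "(THE q. flows_to M \<A> (X d) t p q) = q"
    using assms by (intro the_equality) auto
  then show ?thesis using assms unfolding flow_def by auto
qed

lemma flows_to_local_flow:
  assumes c: "(U, \<phi>) \<in> \<A>" and lf: "local_flow (rep (U, \<phi>) d) DX p0 R B L \<rho> fl"
    and ball: "cball p0 R \<subseteq> \<phi> ` U" and y: "y \<in> cball p0 r" and r: "r + B * \<rho> \<le> R"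
    and t: "t \<in> {-\<rho><..<\<rho>}"
  shows "flows_to M \<A> (X d) t (chart_inv (U, \<phi>) y) (chart_inv (U, \<phi>) (fl y t))"
proof -
  \<comment> \<open>Integral curves have open domains, hence the open interval, although the local
    flow reaches the endpoints.\<close>
  let ?J = "{-\<rho><..<\<rho>}" and ?\<gamma> = "\<lambda>s. chart_inv (U, \<phi>) (fl y s)"
  have sub: "?J \<subseteq> {-\<rho>..\<rho>}" by auto
  have inU: "fl y s \<in> \<phi> ` U" if "s \<in> ?J" for s
    using local_flow.fl_in_cball[OF lf y, of s] that ball r by auto
  have der: "(fl y has_vector_derivative rep (U, \<phi>) d (fl y s)) (at s within ?J)" if "s \<in> ?J" for s
    by (rule has_vector_derivative_within_subset[OF local_flow.fl_ode[OF lf y r] sub]) (use that sub in blast)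
  have cont: "continuous_on ?J (fl y)"
    using der has_vector_derivative_continuous continuous_on_eq_continuous_within by blast
  have "integral_curve M \<A> (X d) ?J ?\<gamma>"
    unfolding integral_curve_def
  proof (intro conjI ballI)
    show "continuous_on ?J ?\<gamma>"
      by (rule continuous_on_compose2[OF chart_continuous(2)[OF c] cont]) (use inU in blast)
    show "?\<gamma> ` ?J \<subseteq> M" using inU chart_inverse(3)[OF c] chart_subset[OF c] by blast
    fix s assume s: "s \<in> ?J"
    show "has_velocity \<A> ?J ?\<gamma> s (\<lambda>c. X d c (?\<gamma> s))"
    proof (rule has_velocity_in_chart[OF c s])
      show "?\<gamma> ` ?J \<subseteq> U" using inU chart_inverse(3)[OF c] by blast
      have "(fl y has_vector_derivative X d (U, \<phi>) (?\<gamma> s)) (at s within ?J)"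
        using der[OF s] by (simp add: rep_def)
      then show "((\<phi> \<circ> ?\<gamma>) has_vector_derivative X d (U, \<phi>) (?\<gamma> s)) (at s within ?J)"
        by (rule has_vector_derivative_transform[OF s, rotated]) (use inU chart_inverse(2)[OF c] in auto)
      fix V \<psi> assume "(V, \<psi>) \<in> \<A>" "?\<gamma> s \<in> V"
      then show "X d (V, \<psi>) (?\<gamma> s) = frechet_derivative (\<psi> \<circ> chart_inv (U, \<phi>)) (at (\<phi> (?\<gamma> s))) (X d (U, \<phi>) (?\<gamma> s))"
        using chart_inverse(3)[OF c inU[OF s]] by (intro field_transition[OF c])
    qed
  qed (auto simp: is_interval_1)
  moreover have "0 \<in> ?J" using t by auto
  moreover have "?\<gamma> 0 = chart_inv (U, \<phi>) y" by (simp add: local_flow.fl_0[OF lf])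
  ultimately show ?thesis unfolding flows_to_def using t by blast
qed

end

section \<open>The local product representation for the given bracket relations\<close>

locale sl2_system = control_system +
  assumes bracket_ab: "vf_eq \<A> (lie_bracket (X La) (X Lb)) (vf_scale 2 (X La))"
    and bracket_ac: "vf_eq \<A> (lie_bracket (X La) (X Lc)) (vf_scale (-1) (X Lb))"
    and bracket_bc: "vf_eq \<A> (lie_bracket (X Lb) (X Lc)) (vf_scale 2 (X Lc))"
begin

lemma bracket_chart:
  assumes br: "vf_eq \<A> (lie_bracket (X d) (X e)) Z"
    and c: "(U, \<phi>) \<in> \<A>" and y: "y \<in> \<phi> ` U"
  shows "frechet_derivative (rep (U, \<phi>) e) (at y) (rep (U, \<phi>) d y) -
    frechet_derivative (rep (U, \<phi>) d) (at y) (rep (U, \<phi>) e y) = Z (U, \<phi>) (chart_inv (U, \<phi>) y)"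
proof -
  have "lie_bracket (X d) (X e) (U, \<phi>) (chart_inv (U, \<phi>) y) = Z (U, \<phi>) (chart_inv (U, \<phi>) y)"
    using br c chart_inverse(3)[OF c y] unfolding vf_eq_def by blast
  then show ?thesis
    by (simp add: lie_bracket_def rep_def chart_inverse(2)[OF c y])
qed

lemma ex_sl2_flows:
  assumes c: "(U, \<phi>) \<in> \<A>" and p: "p \<in> U"
  obtains DX R B L \<rho> fl where "sl2_flows (rep (U, \<phi>)) DX (\<phi> p) R B L \<rho> fl" "cball (\<phi> p) R \<subseteq> \<phi> ` U"
proof (rule c1_field_chart[OF c p])
  fix DX R B L
  assume ball: "cball (\<phi> p) R \<subseteq> \<phi> ` U" and c1: "\<And>d. c1_field (rep (U, \<phi>) d) (DX d) (\<phi> p) R B L"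
    and DX: "\<And>d y. y \<in> cball (\<phi> p) R \<Longrightarrow> blinfun_apply (DX d y) = frechet_derivative (rep (U, \<phi>) d) (at y)"
  have R: "R > 0" and B: "B \<ge> 0" and L: "L \<ge> 0"
    by (rule c1_field.R_pos[OF c1] c1_field.B_nonneg[OF c1] c1_field.L_nonneg[OF c1])+
  \<comment> \<open>The first bound gives \<open>\<rho> * L \<le> 1 / 2\<close>, the second
    \<open>3 * (B * \<rho>) \<le> R\<close>; the summands 1 exclude zero denominators.\<close>
  define \<rho> where "\<rho> = min (1 / (2 * (L + 1))) (R / (3 * (B + 1)))"
  have \<rho>: "\<rho> > 0" using R B L by (simp add: \<rho>_def)
  have "\<rho> * L \<le> 1 / (2 * (L + 1)) * (L + 1)"
    using L \<rho> by (intro mult_mono) (auto simp: \<rho>_def)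
  also have "\<dots> = 1 / 2" using L by simp
  finally have \<rho>L: "\<rho> * L \<le> 1 / 2" .
  have "3 * (B * \<rho>) \<le> 3 * ((B + 1) * (R / (3 * (B + 1))))"
    using B \<rho> R by (intro mult_left_mono mult_mono) (auto simp: \<rho>_def)
  also have "\<dots> = R" using B by (simp add: field_simps)
  finally have \<rho>B: "3 * (B * \<rho>) \<le> R" .
  have "\<exists>fl. local_flow (rep (U, \<phi>) d) (DX d) (\<phi> p) R B L \<rho> fl" for d
  proof -
    obtain fl where "\<forall>q. fl q 0 = q \<and> (\<forall>s\<in>{-\<rho>..\<rho>}.
        (fl q has_vector_derivative rep (U, \<phi>) d (closest_point (cball (\<phi> p) R) (fl q s))) (at s within {-\<rho>..\<rho>}))"
      using c1_field.ex_flow[OF c1 less_imp_le[OF \<rho>] \<rho>L] by blast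
    then have "local_flow (rep (U, \<phi>) d) (DX d) (\<phi> p) R B L \<rho> fl"
      by (intro local_flow.intro c1 local_flow_axioms.intro \<rho> \<rho>L) auto
    then show ?thesis by blast
  qed
  then obtain fl where fl: "\<And>d. local_flow (rep (U, \<phi>) d) (DX d) (\<phi> p) R B L \<rho> (fl d)" by metis
  have "sl2_flows (rep (U, \<phi>)) DX (\<phi> p) R B L \<rho> fl"
  proof (rule sl2_flows.intro[OF fl _ _ _ \<rho>B])
    fix y assume y: "y \<in> cball (\<phi> p) R"
    then have yU: "y \<in> \<phi> ` U" using ball by blast
    have r: "rep (U, \<phi>) d y = X d (U, \<phi>) (chart_inv (U, \<phi>) y)" for d by (simp add: rep_def)
    show "DX Lb y (rep (U, \<phi>) La y) - DX La y (rep (U, \<phi>) Lb y) = 2 *\<^sub>R rep (U, \<phi>) La y"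
      using bracket_chart[OF bracket_ab c yU] unfolding DX[OF y] by (simp add: vf_scale_def r)
    show "DX Lc y (rep (U, \<phi>) La y) - DX La y (rep (U, \<phi>) Lc y) = - rep (U, \<phi>) Lb y"
      using bracket_chart[OF bracket_ac c yU] unfolding DX[OF y] by (simp add: vf_scale_def r)
    show "DX Lc y (rep (U, \<phi>) Lb y) - DX Lb y (rep (U, \<phi>) Lc y) = 2 *\<^sub>R rep (U, \<phi>) Lc y"
      using bracket_chart[OF bracket_bc c yU] unfolding DX[OF y] by (simp add: vf_scale_def r)
  qed
  then show thesis using that ball by blast
qed

end

lemma ex_small_controls:
  assumes u: "controls u T" and "T > 0"
  obtains \<delta> where "0 < \<delta>" "\<delta> \<le> T" "small_controls u \<delta>"
proof -
  interpret controls u T by fact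
  define F where "F t = (\<Sum>x\<in>UNIV. LINT s:{0..t}|lebesgue. \<bar>u x s\<bar>)" for t
  have "continuous_on {0..T} F"
    unfolding F_def
    by (intro continuous_on_sum ac_primitive_continuous[OF ac_primitive_set_integral] set_integrable_abs integrable_u)
  then obtain d where d: "d > 0" "\<forall>t\<in>{0..T}. dist t 0 < d \<longrightarrow> dist (F t) (F 0) < 1 / 8"
    unfolding continuous_on_iff using \<open>T > 0\<close> by (metis atLeastAtMost_iff less_eq_real_def zero_less_divide_1_iff zero_less_numeral)
  define \<delta> where "\<delta> = min T (d / 2)"
  have \<delta>: "0 < \<delta>" "\<delta> \<le> T" "\<delta> < d" using d(1) \<open>T > 0\<close> by (auto simp: \<delta>_def)
  have "small_controls u \<delta>"
  proof
    show "set_integrable lebesgue {0..\<delta>} (u d)" for d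
      by (rule set_integrable_subset[OF integrable_u]) (use \<delta> in auto)
    have "dist (F \<delta>) (F 0) < 1 / 8" using d(2) \<delta> by (simp add: dist_real_def)
    moreover have "F 0 = 0" by (simp add: F_def)
    ultimately show "(\<Sum>x\<in>UNIV. LINT s:{0..\<delta>}|lebesgue. \<bar>u x s\<bar>) \<le> 1 / 8"
      unfolding F_def[symmetric] by (simp add: dist_real_def)
  qed (use \<delta> in simp)
  then show thesis using that \<delta> by blast
qed

text \<open>The exponents are continuous and start at 0. The bounds are strict to stay in the open
  domains of the integral curves.\<close>

lemma (in small_controls) ex_Xi_bound:
  assumes "T > 0" "\<rho> > 0"
  obtains \<delta> where "0 < \<delta>" "\<delta> \<le> T" "\<And>t d. t \<in> {0..\<delta>} \<Longrightarrow> Xi u d t \<in> {-\<rho><..<\<rho>}"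
proof -
  have "continuous_on {0..T} (Xi u d)" for d
    using ac_primitive_continuous[OF Xi_La] ac_primitive_continuous[OF Xi_Lb] ac_primitive_continuous[OF Xi_Lc]
    by (cases d) auto
  then have "\<exists>r>0. \<forall>t\<in>{0..T}. dist t 0 < r \<longrightarrow> dist (Xi u d t) (Xi u d 0) < \<rho>" for d
    by (rule continuous_on_iff[THEN iffD1, rule_format]) (use assms in auto)
  then obtain r where r: "\<And>d. r d > 0" "\<And>d t. t \<in> {0..T} \<Longrightarrow> dist t 0 < r d \<Longrightarrow> dist (Xi u d t) (Xi u d 0) < \<rho>"
    by metis
  define m where "m = Min (range r)"
  have m: "m > 0" unfolding m_def using r(1) by (subst Min_gr_iff) auto
  have le: "m \<le> r d" for d unfolding m_def by (rule Min_le) auto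
  define \<delta> where "\<delta> = min (T / 2) (m / 2)"
  show thesis
  proof (rule that[of \<delta>])
    show "0 < \<delta>" "\<delta> \<le> T" using m assms by (auto simp: \<delta>_def)
    fix t d assume t: "t \<in> {0..\<delta>}"
    then have "t \<in> {0..T}" "dist t 0 < r d" using le[of d] m assms by (auto simp: \<delta>_def dist_real_def)
    from r(2)[OF this] show "Xi u d t \<in> {-\<rho><..<\<rho>}" by (auto simp: Xi_0 dist_real_def)
  qed
qed

context sl2_system
begin

text \<open>The same curve in a chart solves the equation, by the derivative of the product of
  flows, and is the value of \<open>flow_product\<close>, by uniqueness of integral curves.\<close>

theorem local_solution:
  assumes u: "controls u T" and T: "T > 0" and x0: "x0 \<in> M"
  obtains \<delta> x where "0 < \<delta>" "\<delta> \<le> T" "\<And>t d. t \<in> {0..\<delta>} \<Longrightarrow> Upsilon_defined u t (S_of d)"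
    "ode_solution M \<A> (control_field X u) x0 \<delta> x"
    "\<And>t. t \<in> {0..\<delta>} \<Longrightarrow> flow_product M \<A> X (Xi u) t x0 = Some (x t)"
proof -
  obtain U \<phi> where c: "(U, \<phi>) \<in> \<A>" "x0 \<in> U" using in_chart[OF x0] by metis
  obtain DX R B L \<rho> fl where fl: "sl2_flows (rep (U, \<phi>)) DX (\<phi> x0) R B L \<rho> fl"
    and ball: "cball (\<phi> x0) R \<subseteq> \<phi> ` U"
    by (rule ex_sl2_flows[OF c]) blast
  interpret fl: sl2_flows "rep (U, \<phi>)" DX "\<phi> x0" R B L \<rho> fl by fact
  have \<rho>: "\<rho> > 0" by (rule local_flow.\<rho>(1)[OF fl.fields])
  obtain T' where T': "0 < T'" "T' \<le> T" and small: "small_controls u T'"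
    by (rule ex_small_controls[OF u T]) blast
  interpret small_controls u T' by fact
  obtain \<delta> where \<delta>: "0 < \<delta>" "\<delta> \<le> T'" and \<Xi>: "\<And>t d. t \<in> {0..\<delta>} \<Longrightarrow> Xi u d t \<in> {-\<rho><..<\<rho>}"
    by (rule ex_Xi_bound[OF T'(1) \<rho>]) blast
  have \<Xi>': "Xi u d t \<in> {-\<rho>..\<rho>}" if "t \<in> {0..\<delta>}" for t d
    using \<Xi>[OF that, of d] by simp
  define z where "z t = fl.prod_flow (Xi u La t) (Xi u Lb t) (Xi u Lc t)" for t
  define x where "x t = chart_inv (U, \<phi>) (z t)" for t
  have zU: "z t \<in> \<phi> ` U" if "t \<in> {0..\<delta>}" for t
    unfolding z_def using fl.prod_flow_in[OF \<Xi>'[OF that] \<Xi>'[OF that] \<Xi>'[OF that]] ball by blast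
  have xU: "x ` {0..\<delta>} \<subseteq> U" unfolding x_def using zU chart_inverse(3)[OF c(1)] by blast
  have \<phi>x: "\<phi> (x t) = z t" if "t \<in> {0..\<delta>}" for t
    unfolding x_def by (rule chart_inverse(2)[OF c(1) zU[OF that]])
  have prim: "ac_primitive 0 \<delta> (Xi u La) (\<lambda>s. u La s + 2 * u Lb s * Xi u La s - u Lc s * (Xi u La s)\<^sup>2)"
    "ac_primitive 0 \<delta> (Xi u Lb) (\<lambda>s. u Lb s - u Lc s * Xi u La s)"
    "ac_primitive 0 \<delta> (Xi u Lc) (\<lambda>s. u Lc s * exp (2 * Xi u Lb s))"
    using ac_primitive_subset[OF Xi_La order_refl \<delta>(2)] ac_primitive_subset[OF Xi_Lb order_refl \<delta>(2)]
      ac_primitive_subset[OF Xi_Lc order_refl \<delta>(2)] by blast+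
  \<comment> \<open>The product of flows is Lipschitz in its exponents, and these are absolutely
    continuous.\<close>
  have acz: "absolutely_continuous_on {0..\<delta>} z"
  proof (rule absolutely_continuous_on_dominated)
    show "absolutely_continuous_on {0..\<delta>} (\<lambda>t. (Xi u La t, Xi u Lb t, Xi u Lc t))"
      by (intro absolutely_continuous_on_Pair ac_primitive_ac[OF prim(1)] ac_primitive_ac[OF prim(2)]
          ac_primitive_ac[OF prim(3)])
    fix s t assume st: "s \<in> {0..\<delta>}" "t \<in> {0..\<delta>}"
    show "norm (z t - z s) \<le> 7 * B * norm ((Xi u La t, Xi u Lb t, Xi u Lc t) - (Xi u La s, Xi u Lb s, Xi u Lc s))"
      unfolding z_def by (intro fl.prod_flow_lipschitz \<Xi>' st)
  qed
  have contz: "continuous_on {0..\<delta>} z" by (rule absolutely_continuous_on_imp_continuous_on[OF acz])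
  have contx: "continuous_on {0..\<delta>} x"
    unfolding x_def by (rule continuous_on_compose2[OF chart_continuous(2)[OF c(1)] contz]) (use zU in blast)
  have z0: "z 0 = \<phi> x0"
    by (simp add: z_def fl.prod_flow_def Xi_0 local_flow.fl_0[OF fl.fields])
  have vel: "has_velocity \<A> {0..\<delta>} x t (\<lambda>c. control_field X u t c (x t))"
    if t: "t \<in> {0..\<delta>}"
      "(Xi u La has_vector_derivative u La t + 2 * u Lb t * Xi u La t - u Lc t * (Xi u La t)\<^sup>2) (at t within {0..\<delta>})"
      "(Xi u Lb has_vector_derivative u Lb t - u Lc t * Xi u La t) (at t within {0..\<delta>})"
      "(Xi u Lc has_vector_derivative u Lc t * exp (2 * Xi u Lb t)) (at t within {0..\<delta>})" for t
  proof (rule has_velocity_in_chart[OF c(1) t(1) xU])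
    have "(z has_vector_derivative u Lc t *\<^sub>R rep (U, \<phi>) Lc (z t) +
        (u Lb t *\<^sub>R rep (U, \<phi>) Lb (z t) + u La t *\<^sub>R rep (U, \<phi>) La (z t))) (at t within {0..\<delta>})"
      unfolding z_def by (rule fl.has_vector_derivative_prod_flow[OF t(1) \<Xi>' \<Xi>' \<Xi>' t(2-4)])
    then have "(z has_vector_derivative control_field X u t (U, \<phi>) (x t)) (at t within {0..\<delta>})"
      by (simp add: control_field_apply rep_def x_def)
    then show "((\<phi> \<circ> x) has_vector_derivative control_field X u t (U, \<phi>) (x t)) (at t within {0..\<delta>})"
      by (rule has_vector_derivative_transform[OF t(1), rotated]) (simp add: \<phi>x)
    show "control_field X u t (V, \<psi>) (x t) =
        frechet_derivative (\<psi> \<circ> chart_inv (U, \<phi>)) (at (\<phi> (x t))) (control_field X u t (U, \<phi>) (x t))"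
      if "(V, \<psi>) \<in> \<A>" "x t \<in> V" for V \<psi>
      by (rule control_field_transition[OF c(1) that(1) _ that(2)]) (use xU t in blast)
  qed
  have ode: "ode_solution M \<A> (control_field X u) x0 \<delta> x"
    unfolding ode_solution_iff_caratheodory caratheodory_def
  proof (intro conjI contx)
    show "x 0 = x0" unfolding x_def z0 by (rule chart_inverse(1)[OF c])
    show "x ` {0..\<delta>} \<subseteq> M" using xU chart_subset[OF c(1)] by blast
    show "AE t in lebesgue. t \<in> {0..\<delta>} \<longrightarrow> has_velocity \<A> {0..\<delta>} x t (\<lambda>c. control_field X u t c (x t))"
      using ac_primitive_AE[OF prim(1)] ac_primitive_AE[OF prim(2)] ac_primitive_AE[OF prim(3)]
      by eventually_elim (use vel in blast)
    \<comment> \<open>Absolute continuity is required in every chart that contains a piece of the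
      curve, not only in the one of the construction.\<close>
    show "\<forall>(V, \<psi>)\<in>\<A>. \<forall>r s. {r..s} \<subseteq> {0..\<delta>} \<and> x ` {r..s} \<subseteq> V \<longrightarrow> absolutely_continuous_on {r..s} (\<psi> \<circ> x)"
    proof clarify
      fix V \<psi> r s assume V: "(V, \<psi>) \<in> \<A>" and rs: "{r..s} \<subseteq> {0..\<delta>}" "x ` {r..s} \<subseteq> V"
      show "absolutely_continuous_on {r..s} (\<psi> \<circ> x)"
      proof (rule absolutely_continuous_change_chart[OF c(1) V _ _ rs(2)])
        show "continuous_on {r..s} x" by (rule continuous_on_subset[OF contx rs(1)])
        show "x ` {r..s} \<subseteq> U" using xU rs(1) by blast
        show "absolutely_continuous_on {r..s} (\<phi> \<circ> x)"
        proof (rule absolutely_continuous_on_dominated[OF absolutely_continuous_on_subset[OF acz rs(1)]])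
          fix a b assume "a \<in> {r..s}" "b \<in> {r..s}"
          then have "a \<in> {0..\<delta>}" "b \<in> {0..\<delta>}" using rs(1) by blast+
          then show "norm ((\<phi> \<circ> x) b - (\<phi> \<circ> x) a) \<le> 1 * norm (z b - z a)" by (simp add: \<phi>x)
        qed
      qed
    qed
  qed
  have prod: "flow_product M \<A> X (Xi u) t x0 = Some (x t)" if t: "t \<in> {0..\<delta>}" for t
  proof -
    let ?y1 = "fl Lc (\<phi> x0) (Xi u Lc t)" and ?ci = "chart_inv (U, \<phi>)"
    let ?y2 = "fl Lb ?y1 (Xi u Lb t)"
    have r: "0 + B * \<rho> \<le> R" "B * \<rho> + B * \<rho> \<le> R" "(B * \<rho> + B * \<rho>) + B * \<rho> \<le> R"
      using fl.radius fl.B\<rho> by auto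
    have "flows_to M \<A> (X Lc) (Xi u Lc t) (?ci (\<phi> x0)) (?ci ?y1)"
      by (rule flows_to_local_flow[OF c(1) fl.fields ball _ r(1) \<Xi>[OF t]]) simp
    then have 1: "flow M \<A> (X Lc) (Xi u Lc t) x0 = Some (?ci ?y1)"
      unfolding chart_inverse(1)[OF c] by (rule flow_eq_Some)
    have 2: "flow M \<A> (X Lb) (Xi u Lb t) (?ci ?y1) = Some (?ci ?y2)"
      by (rule flow_eq_Some[OF flows_to_local_flow[OF c(1) fl.fields ball fl.fl_c_in[OF \<Xi>'[OF t]] r(2) \<Xi>[OF t]]])
    have 3: "flow M \<A> (X La) (Xi u La t) (?ci ?y2) = Some (?ci (fl La ?y2 (Xi u La t)))"
      by (rule flow_eq_Some[OF flows_to_local_flow[OF c(1) fl.fields ball fl.fl_bc_in[OF \<Xi>'[OF t] \<Xi>'[OF t]] r(3) \<Xi>[OF t]]])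
    show ?thesis
      by (simp add: flow_product_def map_comp_def 1 2 3 x_def z_def fl.prod_flow_def)
  qed
  have "Upsilon_defined u t (S_of d)" if "t \<in> {0..\<delta>}" for t d
    using that \<delta>(2) by (intro Upsilon_defined_S) auto
  then show thesis
    using that[OF \<delta>(1) order_trans[OF \<delta>(2) T'(2)] _ ode prod] by blast
qed

lemma ode_solution_unique:
  assumes u: "controls u T"
    and x: "ode_solution M \<A> (control_field X u) x0 \<tau> x" and y: "ode_solution M \<A> (control_field X u) x0 \<tau>' y"
    and le: "\<tau> \<le> T" "\<tau>' \<le> T" and t: "t \<in> {0..min \<tau> \<tau>'}"
  shows "x t = y t"
proof -
  \<comment> \<open>The controls are integrable on \<open>{0..T}\<close>; cut off outside, they are
    integrable on every bounded interval, as \<open>caratheodory_unique\<close> asks, and unchanged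
    on \<open>I\<close>.\<close>
  define v where "v d s = indicator {0..T} s * u d s" for d s
  define I where "I = {0..min \<tau> \<tau>'}"
  have eq: "control_field X u s = control_field X v s" if "s \<in> I" for s
  proof -
    have "v d s = u d s" for d using that le by (simp add: v_def I_def)
    then show ?thesis by (simp add: fun_eq_iff control_field_apply)
  qed
  have "integrable lebesgue (v d)" for d
    using controls.integrable_u[OF u, of d] unfolding set_integrable_def v_def by simp
  then have v: "set_integrable lebesgue {r..s} (v d)" for d r s
    unfolding set_integrable_def by (rule integrable_mult_indicator[rotated]) simp
  have sub: "I \<subseteq> {0..\<tau>}" "I \<subseteq> {0..\<tau>'}" by (auto simp: I_def)
  have cx: "caratheodory M \<A> (control_field X v) I x"
    using x unfolding ode_solution_iff_caratheodory
    by (intro caratheodory_cong[OF caratheodory_subset[OF _ sub(1)] eq]) auto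
  have cy: "caratheodory M \<A> (control_field X v) I y"
    using y unfolding ode_solution_iff_caratheodory
    by (intro caratheodory_cong[OF caratheodory_subset[OF _ sub(2)] eq]) auto
  show ?thesis
  proof (rule caratheodory_unique[OF _ v cx cy])
    show "is_interval I" by (simp add: I_def is_interval_cc)
    show "0 \<in> I" "t \<in> I" using t by (auto simp: I_def)
    show "x 0 = y 0" using x y unfolding ode_solution_def by simp
  qed
qed

end

theorem theorem1:
  fixes M :: "'a::{t2_space, second_countable_topology} set"
    and \<A> :: "('a, 'e::euclidean_space) chart set"
    and X :: "letter \<Rightarrow> ('a, 'e) vector_field"
    and u :: "letter \<Rightarrow> real \<Rightarrow> real"
    and T :: real
    and x0 :: 'a
  assumes "smooth_manifold M \<A>"
    and "\<And>d. smooth_vector_field \<A> (X d)"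
    and "vf_eq \<A> (lie_bracket (X La) (X Lb)) (vf_scale 2 (X La))"
    and "vf_eq \<A> (lie_bracket (X La) (X Lc)) (vf_scale (-1) (X Lb))"
    and "vf_eq \<A> (lie_bracket (X Lb) (X Lc)) (vf_scale 2 (X Lc))"
    and "T > 0"
    and "\<And>d. set_integrable lebesgue {0..T} (u d)"
    and "x0 \<in> M"
  shows "(\<exists>!S. solves_series_eq S) \<and>
    (\<exists>\<delta>. 0 < \<delta> \<and> \<delta> \<le> T \<and>
       (\<forall>t\<in>{0..\<delta>}. \<forall>d. Upsilon_defined u t (S_of d)) \<and>
       (\<exists>x. ode_solution M \<A> (control_field X u) x0 \<delta> x) \<and>
       (\<forall>\<tau> x. 0 < \<tau> \<and> \<tau> \<le> T \<and> ode_solution M \<A> (control_field X u) x0 \<tau> x \<longrightarrow>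
          (\<forall>t\<in>{0..min \<delta> \<tau>}. flow_product M \<A> X (Xi u) t x0 = Some (x t)))) \<and>
    letter_series Lb - letter_series La \<cdot> S_of Lc = S_of Lb \<and>
    S_of Lb = letter_series Lb - S_of La \<cdot> letter_series Lc"
proof -
  interpret sl2_system M \<A> X
    by unfold_locales (use assms in auto)
  have u: "controls u T" by unfold_locales (rule assms(7))
  obtain \<delta> x where \<delta>: "0 < \<delta>" "\<delta> \<le> T" "\<And>t d. t \<in> {0..\<delta>} \<Longrightarrow> Upsilon_defined u t (S_of d)"
    and x: "ode_solution M \<A> (control_field X u) x0 \<delta> x"
    and flow: "\<And>t. t \<in> {0..\<delta>} \<Longrightarrow> flow_product M \<A> X (Xi u) t x0 = Some (x t)"
    by (rule local_solution[OF u assms(6,8)]) blast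
  \<comment> \<open>Any given solution agrees with the constructed one as long as both
    exist.\<close>
  have "flow_product M \<A> X (Xi u) t x0 = Some (y t)"
    if "\<tau> \<le> T" "ode_solution M \<A> (control_field X u) x0 \<tau> y" "t \<in> {0..min \<delta> \<tau>}" for \<tau> y t
    using flow[of t] ode_solution_unique[OF u x that(2) \<delta>(2) that(1,3)] that(3) by simp
  moreover have "letter_series Lb - letter_series La \<cdot> S_of Lc = S_of Lb"
    using S_a1_eq(2) by simp
  moreover have "S_of Lb = letter_series Lb - S_of La \<cdot> letter_series Lc"
    using S_a1_eq' by simp
  ultimately show ?thesis
    using ex1_solves_series_eq \<delta> x by blast
qed

end
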